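(* Let $L$ be a Dirac structure on a smooth manifold $M$. Given any point $m_0\in M$, there is a coordinate system $(x,y)=(x_1,\dots,x_r,y_1,\dots,y_s)$ defined on an open neighborhood $U$ of $m_0$ such that the intersection of $U$ with the pre-symplectic leaf through $m_0$ is the set $\{y_1=\dots=y_s=0\}$, and $\Gamma(L_{|U})$ is spanned by sections of the form $$\mathcal H_i=\Big(\frac{\partial}{\partial x_i}+\sum_{k=1}^s X_{ik}(x,y)\frac{\partial}{\partial y_k},\ \sum_{k=1}^r\alpha_{ik}(x,y)\,dx_k\Big)$$ and $$\mathcal V_j=\Big(\sum_{k=1}^s Z_{jk}(x,y)\frac{\partial}{\partial y_k},\ dy_j+\sum_{k=1}^r\beta_{jk}(x,y)\,dx_k\Big),$$ where $X_{ik}(m_0)=0$ and $Z_{jk}(m_0)=0$ for all $i\in\{1,\dots,r\}$ and $j\in\{1,\dots,s\}$ (and all $k\in\{1,\dots,s\}$).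
   Context: On $TM\oplus T^*M$ consider the symmetric pairing $\langle (X_1,\alpha_1),(X_2,\alpha_2)\rangle=\frac12(i_{X_2}\alpha_1+i_{X_1}\alpha_2)$, and on $\Gamma(TM\oplus T^*M)$ the Courant bracket $[(X_1,\alpha_1),(X_2,\alpha_2)]=([X_1,X_2],\ \mathcal L_{X_1}\alpha_2-i_{X_2}d\alpha_1)$. A Dirac structure on $M$ is a smooth vector subbundle $L\subset TM\oplus T^*M$ that is maximal isotropic for $\langle\cdot,\cdot\rangle$ and such that the space of sections $\Gamma(L)$ is closed under the Courant bracket. The distribution $(\mathcal D_L)_x=pr_1(L_x)\subset T_xM$ ($pr_1$ the projection to $TM$) integrates to a singular foliation, whose leaves are the pre-symplectic leaves of $L$. Here $X_{ik},\alpha_{ik},Z_{jk},\beta_{jk}$ are smooth functions on $U$, $r$ is the dimension of the leaf through $m_0$, and $r+s=\dim M$.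
   Formalization: The intersection of U with the leaf is read as its connected component through m_0 in the leaf topology; literal equality with {y=0} is claimed only for embedded leaves, since it fails e.g. for irrational foliations of the torus. *)

theory Defs
  imports "HOL-Analysis.Analysis"
begin

section \<open>Smooth functions on open subsets of Euclidean space\<close>

text \<open>
  Following the library's \<^const>\<open>Euclidean_space\<close>, the space of real \<open>n\<close>-tuples consists of the
  functions \<^typ>\<open>nat \<Rightarrow> real\<close> that vanish at all indices \<open>\<ge> n\<close>. Coordinates are numbered from 0,
  so the \<open>i\<close>-th coordinate in the usual numbering has index \<open>i - 1\<close>.
\<close>

definition partial_deriv :: "nat \<Rightarrow> ((nat \<Rightarrow> real) \<Rightarrow> real) \<Rightarrow> (nat \<Rightarrow> real) \<Rightarrow> real" where
  "partial_deriv i f x = deriv (\<lambda>t. f (x(i := t))) (x i)"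

fun Ck_on :: "nat \<Rightarrow> nat \<Rightarrow> (nat \<Rightarrow> real) set \<Rightarrow> ((nat \<Rightarrow> real) \<Rightarrow> real) \<Rightarrow> bool" where
  "Ck_on n 0 S f \<longleftrightarrow> continuous_on S f"
| "Ck_on n (Suc k) S f \<longleftrightarrow> continuous_on S f \<and>
     (\<forall>i<n. (\<forall>x\<in>S. (\<lambda>t. f (x(i := t))) differentiable (at (x i))) \<and>
            Ck_on n k S (partial_deriv i f))"

text \<open>Meaningful for sets \<open>S\<close> that are open in \<^term>\<open>Euclidean_space n\<close>.\<close>

definition smooth_on :: "nat \<Rightarrow> (nat \<Rightarrow> real) set \<Rightarrow> ((nat \<Rightarrow> real) \<Rightarrow> real) \<Rightarrow> bool" where
  "smooth_on n S f \<longleftrightarrow> (\<forall>k. Ck_on n k S f)"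


section \<open>Smooth manifolds and smooth maps\<close>

text \<open>A chart is a pair of its domain and its coordinate map; only the values of the map on the
  domain matter.\<close>

type_synonym 'm chart = "'m set \<times> ('m \<Rightarrow> nat \<Rightarrow> real)"

definition is_chart :: "nat \<Rightarrow> 'm topology \<Rightarrow> 'm chart \<Rightarrow> bool" where
  "is_chart n T c \<longleftrightarrow> (case c of (U, \<phi>) \<Rightarrow>
     openin T U \<and> openin (Euclidean_space n) (\<phi> ` U) \<and>
     homeomorphic_map (subtopology T U) (subtopology (Euclidean_space n) (\<phi> ` U)) \<phi>)"

definition smooth_transition :: "nat \<Rightarrow> 'm chart \<Rightarrow> 'm chart \<Rightarrow> bool" where
  "smooth_transition n c d \<longleftrightarrow> (case (c, d) of ((U, \<phi>), (V, \<psi>)) \<Rightarrow>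
     \<forall>i<n. smooth_on n (\<phi> ` (U \<inter> V)) (\<lambda>x. \<psi> (inv_into U \<phi> x) i))"

record 'm manifold =
  mtop :: "'m topology"
  mdim :: nat
  matlas :: "'m chart set"

abbreviation mcarrier :: "'m manifold \<Rightarrow> 'm set" where
  "mcarrier M \<equiv> topspace (mtop M)"

definition smooth_manifold :: "'m manifold \<Rightarrow> bool" where
  "smooth_manifold M \<longleftrightarrow>
     Hausdorff_space (mtop M) \<and> second_countable (mtop M) \<and>
     (\<forall>c\<in>matlas M. is_chart (mdim M) (mtop M) c) \<and>
     (\<forall>p\<in>mcarrier M. \<exists>c\<in>matlas M. p \<in> fst c) \<and>
     (\<forall>c\<in>matlas M. \<forall>d\<in>matlas M. smooth_transition (mdim M) c d) \<and>
     (\<forall>c. is_chart (mdim M) (mtop M) c \<and>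
          (\<forall>d\<in>matlas M. smooth_transition (mdim M) c d \<and> smooth_transition (mdim M) d c)
          \<longrightarrow> c \<in> matlas M)"

text \<open>Smooth real functions on an open subset \<open>U\<close> of \<open>M\<close>; openness of \<open>U\<close> is part of the notion.\<close>

definition smooth_fun :: "'m manifold \<Rightarrow> 'm set \<Rightarrow> ('m \<Rightarrow> real) \<Rightarrow> bool" where
  "smooth_fun M U f \<longleftrightarrow> openin (mtop M) U \<and>
     (\<forall>(V, \<phi>)\<in>matlas M. smooth_on (mdim M) (\<phi> ` (U \<inter> V)) (f \<circ> inv_into V \<phi>))"

definition smooth_near :: "'m manifold \<Rightarrow> 'm \<Rightarrow> ('m \<Rightarrow> real) \<Rightarrow> bool" where
  "smooth_near M p f \<longleftrightarrow> (\<exists>U. p \<in> U \<and> smooth_fun M U f)"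

text \<open>Smoothness of maps is expressed by pulling back smooth functions; as \<^const>\<open>smooth_fun\<close>
  includes openness of the domain, this entails continuity.\<close>

definition smooth_map :: "'m manifold \<Rightarrow> 'n manifold \<Rightarrow> ('m \<Rightarrow> 'n) \<Rightarrow> bool" where
  "smooth_map M N F \<longleftrightarrow> F ` mcarrier M \<subseteq> mcarrier N \<and>
     (\<forall>U f. smooth_fun N U f \<longrightarrow> smooth_fun M {p \<in> mcarrier M. F p \<in> U} (f \<circ> F))"


section \<open>Tangent and cotangent vectors, vector fields and 1-forms\<close>

text \<open>
  Tangent vectors at \<open>p\<close> are the derivations at \<open>p\<close> of germs of smooth functions, realised on
  functions that are smooth near \<open>p\<close> and extended by 0 to all other functions. Two functions that
  agree near \<open>p\<close> are not distinguished: this follows from the Leibniz rule.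
\<close>

type_synonym 'm tvec = "('m \<Rightarrow> real) \<Rightarrow> real"

definition tangent_space :: "'m manifold \<Rightarrow> 'm \<Rightarrow> 'm tvec set" where
  "tangent_space M p = {v.
     (\<forall>f. \<not> smooth_near M p f \<longrightarrow> v f = 0) \<and>
     (\<forall>f g a b. smooth_near M p f \<and> smooth_near M p g \<longrightarrow>
        v (\<lambda>q. a * f q + b * g q) = a * v f + b * v g) \<and>
     (\<forall>f g. smooth_near M p f \<and> smooth_near M p g \<longrightarrow>
        v (\<lambda>q. f q * g q) = f p * v g + g p * v f)}"

text \<open>Cotangent vectors are the linear forms on the tangent space, extended by 0 outside it.\<close>

type_synonym 'm covec = "'m tvec \<Rightarrow> real"

definition cotangent_space :: "'m manifold \<Rightarrow> 'm \<Rightarrow> 'm covec set" where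
  "cotangent_space M p = {\<omega>.
     (\<forall>v. v \<notin> tangent_space M p \<longrightarrow> \<omega> v = 0) \<and>
     (\<forall>v\<in>tangent_space M p. \<forall>w\<in>tangent_space M p. \<forall>a b.
        \<omega> (\<lambda>f. a * v f + b * w f) = a * \<omega> v + b * \<omega> w)}"

definition pushforward ::
    "'m manifold \<Rightarrow> 'n manifold \<Rightarrow> ('m \<Rightarrow> 'n) \<Rightarrow> 'm \<Rightarrow> 'm tvec \<Rightarrow> 'n tvec" where
  "pushforward M N F p v = (\<lambda>f. if smooth_near N (F p) f then v (f \<circ> F) else 0)"

definition coord_vec :: "'m manifold \<Rightarrow> 'm chart \<Rightarrow> nat \<Rightarrow> 'm \<Rightarrow> 'm tvec" where
  "coord_vec M c i p = (case c of (U, \<phi>) \<Rightarrow>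
     (\<lambda>f. if smooth_near M p f then partial_deriv i (f \<circ> inv_into U \<phi>) (\<phi> p) else 0))"

definition differential :: "'m manifold \<Rightarrow> ('m \<Rightarrow> real) \<Rightarrow> 'm \<Rightarrow> 'm covec" where
  "differential M f p = (\<lambda>v. if v \<in> tangent_space M p then v f else 0)"

definition vector_field_on :: "'m manifold \<Rightarrow> 'm set \<Rightarrow> ('m \<Rightarrow> 'm tvec) \<Rightarrow> bool" where
  "vector_field_on M U X \<longleftrightarrow> openin (mtop M) U \<and> (\<forall>p\<in>U. X p \<in> tangent_space M p) \<and>
     (\<forall>V f. V \<subseteq> U \<and> smooth_fun M V f \<longrightarrow> smooth_fun M V (\<lambda>p. X p f))"

definition one_form_on :: "'m manifold \<Rightarrow> 'm set \<Rightarrow> ('m \<Rightarrow> 'm covec) \<Rightarrow> bool" where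
  "one_form_on M U \<alpha> \<longleftrightarrow> openin (mtop M) U \<and> (\<forall>p\<in>U. \<alpha> p \<in> cotangent_space M p) \<and>
     (\<forall>V X. V \<subseteq> U \<and> vector_field_on M V X \<longrightarrow> smooth_fun M V (\<lambda>p. \<alpha> p (X p)))"

definition lie_bracket ::
    "'m manifold \<Rightarrow> ('m \<Rightarrow> 'm tvec) \<Rightarrow> ('m \<Rightarrow> 'm tvec) \<Rightarrow> 'm \<Rightarrow> 'm tvec" where
  "lie_bracket M X Y p =
     (\<lambda>f. if smooth_near M p f then X p (\<lambda>q. Y q f) - Y p (\<lambda>q. X q f) else 0)"

text \<open>
  The exterior derivative of a 1-form and its Lie derivative, evaluated on tangent vectors at \<open>p\<close>
  via Koszul's formulas
  \<open>d\<alpha>(Y, W) = Y(\<alpha>(W)) - W(\<alpha>(Y)) - \<alpha>([Y, W])\<close> and \<open>(L\<^sub>X \<alpha>)(Y) = X(\<alpha>(Y)) - \<alpha>([X, Y])\<close>,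
  whose right-hand sides at \<open>p\<close> depend only on the values at \<open>p\<close> of the fields \<open>Y\<close>, \<open>W\<close> that
  extend the given vectors.
\<close>

definition ext_deriv :: "'m manifold \<Rightarrow> ('m \<Rightarrow> 'm covec) \<Rightarrow> 'm \<Rightarrow> 'm tvec \<Rightarrow> 'm tvec \<Rightarrow> real" where
  "ext_deriv M \<alpha> p v w = (THE c. \<forall>U Y W.
     p \<in> U \<and> vector_field_on M U Y \<and> vector_field_on M U W \<and> Y p = v \<and> W p = w \<longrightarrow>
     c = Y p (\<lambda>q. \<alpha> q (W q)) - W p (\<lambda>q. \<alpha> q (Y q)) - \<alpha> p (lie_bracket M Y W p))"

definition lie_deriv ::
    "'m manifold \<Rightarrow> ('m \<Rightarrow> 'm tvec) \<Rightarrow> ('m \<Rightarrow> 'm covec) \<Rightarrow> 'm \<Rightarrow> 'm covec" where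
  "lie_deriv M X \<alpha> p = (\<lambda>v. if v \<in> tangent_space M p then
     (THE c. \<forall>U Y. p \<in> U \<and> vector_field_on M U Y \<and> Y p = v \<longrightarrow>
        c = X p (\<lambda>q. \<alpha> q (Y q)) - \<alpha> p (lie_bracket M X Y p)) else 0)"

definition interior_ext_deriv ::
    "'m manifold \<Rightarrow> ('m \<Rightarrow> 'm tvec) \<Rightarrow> ('m \<Rightarrow> 'm covec) \<Rightarrow> 'm \<Rightarrow> 'm covec" where
  "interior_ext_deriv M X \<alpha> p =
     (\<lambda>v. if v \<in> tangent_space M p then ext_deriv M \<alpha> p (X p) v else 0)"


section \<open>Dirac structures\<close>

text \<open>Elements of the fibres of \<open>TM \<oplus> T\<^sup>*M\<close>.\<close>

type_synonym 'm gvec = "'m tvec \<times> 'm covec"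

definition gspace :: "'m manifold \<Rightarrow> 'm \<Rightarrow> 'm gvec set" where
  "gspace M p = tangent_space M p \<times> cotangent_space M p"

definition lincomb :: "nat \<Rightarrow> (nat \<Rightarrow> real) \<Rightarrow> (nat \<Rightarrow> 'm gvec) \<Rightarrow> 'm gvec" where
  "lincomb k c e = ((\<lambda>f. \<Sum>i<k. c i * fst (e i) f), (\<lambda>v. \<Sum>i<k. c i * snd (e i) v))"

definition linear_subspace :: "'m manifold \<Rightarrow> 'm \<Rightarrow> 'm gvec set \<Rightarrow> bool" where
  "linear_subspace M p W \<longleftrightarrow> W \<subseteq> gspace M p \<and>
     (\<forall>k c e. (\<forall>i<k. e i \<in> W) \<longrightarrow> lincomb k c e \<in> W)"

definition is_basis :: "'m gvec set \<Rightarrow> nat \<Rightarrow> (nat \<Rightarrow> 'm gvec) \<Rightarrow> bool" where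
  "is_basis W k e \<longleftrightarrow> (\<forall>i<k. e i \<in> W) \<and> (\<forall>w\<in>W. \<exists>c. w = lincomb k c e) \<and>
     (\<forall>c. lincomb k c e = ((\<lambda>f. 0), (\<lambda>v. 0)) \<longrightarrow> (\<forall>i<k. c i = 0))"

definition gsection_on :: "'m manifold \<Rightarrow> 'm set \<Rightarrow> ('m \<Rightarrow> 'm gvec) \<Rightarrow> bool" where
  "gsection_on M U \<sigma> \<longleftrightarrow> vector_field_on M U (fst \<circ> \<sigma>) \<and> one_form_on M U (snd \<circ> \<sigma>)"

definition smooth_subbundle :: "'m manifold \<Rightarrow> ('m \<Rightarrow> 'm gvec set) \<Rightarrow> bool" where
  "smooth_subbundle M L \<longleftrightarrow> (\<forall>p\<in>mcarrier M. linear_subspace M p (L p)) \<and>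
     (\<forall>p\<in>mcarrier M. \<exists>U k \<sigma>. p \<in> U \<and> openin (mtop M) U \<and> (\<forall>i<k. gsection_on M U (\<sigma> i)) \<and>
        (\<forall>q\<in>U. is_basis (L q) k (\<lambda>i. \<sigma> i q)))"

text \<open>Smooth sections over \<open>U\<close>; their values outside \<open>U\<close> are unconstrained.\<close>

definition sections :: "'m manifold \<Rightarrow> 'm set \<Rightarrow> ('m \<Rightarrow> 'm gvec set) \<Rightarrow> ('m \<Rightarrow> 'm gvec) set" where
  "sections M U L = {\<sigma>. gsection_on M U \<sigma> \<and> (\<forall>p\<in>U. \<sigma> p \<in> L p)}"

definition pairing :: "'m gvec \<Rightarrow> 'm gvec \<Rightarrow> real" where
  "pairing e e' = (snd e (fst e') + snd e' (fst e)) / 2"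

definition isotropic :: "'m gvec set \<Rightarrow> bool" where
  "isotropic W \<longleftrightarrow> (\<forall>e\<in>W. \<forall>e'\<in>W. pairing e e' = 0)"

definition maximal_isotropic :: "'m manifold \<Rightarrow> 'm \<Rightarrow> 'm gvec set \<Rightarrow> bool" where
  "maximal_isotropic M p W \<longleftrightarrow> linear_subspace M p W \<and> isotropic W \<and>
     (\<forall>W'. linear_subspace M p W' \<and> isotropic W' \<and> W \<subseteq> W' \<longrightarrow> W' = W)"

definition courant_bracket ::
    "'m manifold \<Rightarrow> ('m \<Rightarrow> 'm gvec) \<Rightarrow> ('m \<Rightarrow> 'm gvec) \<Rightarrow> 'm \<Rightarrow> 'm gvec" where
  "courant_bracket M \<sigma> \<tau> p =
     (lie_bracket M (fst \<circ> \<sigma>) (fst \<circ> \<tau>) p,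
      (\<lambda>v. lie_deriv M (fst \<circ> \<sigma>) (snd \<circ> \<tau>) p v - interior_ext_deriv M (fst \<circ> \<tau>) (snd \<circ> \<sigma>) p v))"

definition dirac_structure :: "'m manifold \<Rightarrow> ('m \<Rightarrow> 'm gvec set) \<Rightarrow> bool" where
  "dirac_structure M L \<longleftrightarrow> smooth_subbundle M L \<and>
     (\<forall>p\<in>mcarrier M. maximal_isotropic M p (L p)) \<and>
     (\<forall>\<sigma>\<in>sections M (mcarrier M) L. \<forall>\<tau>\<in>sections M (mcarrier M) L.
        courant_bracket M \<sigma> \<tau> \<in> sections M (mcarrier M) L)"

definition distribution :: "('m \<Rightarrow> 'm gvec set) \<Rightarrow> 'm \<Rightarrow> 'm tvec set" where
  "distribution L p = fst ` L p"


section \<open>Pre-symplectic leaves\<close>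

text \<open>An immersed submanifold is a subset with its own topology and smooth structure for which
  the inclusion is an immersion; its topology may be finer than the subspace topology.\<close>

definition immersed_submanifold :: "'m manifold \<Rightarrow> 'm manifold \<Rightarrow> bool" where
  "immersed_submanifold N M \<longleftrightarrow> smooth_manifold N \<and> mcarrier N \<subseteq> mcarrier M \<and>
     smooth_map N M (\<lambda>q. q) \<and>
     (\<forall>q\<in>mcarrier N. inj_on (pushforward N M (\<lambda>q. q) q) (tangent_space N q))"

definition integral_manifold ::
    "'m manifold \<Rightarrow> ('m \<Rightarrow> 'm gvec set) \<Rightarrow> 'm manifold \<Rightarrow> bool" where
  "integral_manifold M L N \<longleftrightarrow> immersed_submanifold N M \<and> connected_space (mtop N) \<and>
     (\<forall>q\<in>mcarrier N. pushforward N M (\<lambda>q. q) q ` tangent_space N q = distribution L q)"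

text \<open>The leaves of the singular foliation to which the distribution integrates are its maximal
  connected integral manifolds.\<close>

definition presymplectic_leaf ::
    "'m manifold \<Rightarrow> ('m \<Rightarrow> 'm gvec set) \<Rightarrow> 'm manifold \<Rightarrow> bool" where
  "presymplectic_leaf M L N \<longleftrightarrow> mcarrier N \<noteq> {} \<and> integral_manifold M L N \<and>
     (\<forall>N'. integral_manifold M L N' \<and> mcarrier N \<subseteq> mcarrier N' \<longrightarrow> mcarrier N' = mcarrier N)"

text \<open>The intersection of \<open>U\<close> with the leaf \<open>N\<close> near \<open>m\<close>: the connected component (plaque)
  containing \<open>m\<close> of \<open>U \<inter> N\<close> in the topology of the leaf. The full intersection of \<open>U\<close> with a
  non-embedded leaf may consist of many plaques, for every neighbourhood \<open>U\<close> of \<open>m\<close>.\<close>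

definition plaque :: "'m manifold \<Rightarrow> 'm set \<Rightarrow> 'm \<Rightarrow> 'm set" where
  "plaque N U m = connected_component_of_set (subtopology (mtop N) (U \<inter> mcarrier N)) m"

definition embedded :: "'m manifold \<Rightarrow> 'm manifold \<Rightarrow> bool" where
  "embedded N M \<longleftrightarrow> mtop N = subtopology (mtop M) (mcarrier N)"


section \<open>Spanning sets of sections\<close>

text \<open>The sections over \<open>U\<close> spanned by the family \<open>E\<close> over the ring of smooth functions on \<open>U\<close>.\<close>

definition spanned_sections ::
    "'m manifold \<Rightarrow> 'm set \<Rightarrow> ('m \<Rightarrow> 'm gvec) set \<Rightarrow> ('m \<Rightarrow> 'm gvec) set" where
  "spanned_sections M U E = {\<sigma>. \<exists>k a e. (\<forall>i<k. smooth_fun M U (a i) \<and> e i \<in> E) \<and>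
     (\<forall>p\<in>U. \<sigma> p = lincomb k (\<lambda>i. a i p) (\<lambda>i. e i p))}"

end

(*
  In a chart (x, y) in which the leaf through m0 is the slice y = 0, the projection of L at m0 to the
  tangent space is the span of the d/dx_i. A pair (X, alpha) has mixed coordinates dx_i(X) and
  alpha(d/dy_j); by maximality of L at m0 no nontrivial linear combination of them vanishes on L at
  m0. Elimination therefore gives sections of L near m0 that are dual to the mixed coordinates. They
  have the shape of the H_i and V_j, and since L is isotropic, pairing with them shows that an
  element of L is determined by its mixed coordinates, so they span.

  The adapted chart is obtained by exchanging the coordinates of the leaf one at a time for
  coordinates of M, which needs only a one-variable implicit function theorem, followed by a shear
  of M along the leaf.
*)

theory Submission
  imports Defs "HOL-Homology.Invariance_of_Domain"
begin

section \<open>Functions of class \<open>C\<^sup>k\<close> on open subsets of \<open>Euclidean_space\<close>\<close>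

text \<open>The rank of L is never computed: independence of the mixed coordinates as linear forms
  on \<open>L m0\<close> yields r + s local sections, and isotropy shows that these already
  generate. The vector parts of elements of L at m0 are combinations of the d/dx_i, so X_ik and
  Z_jk, the y_k-components of the frame, vanish at m0.

  Smoothness means iterated partial differentiability, so the calculus runs along single coordinate
  lines: the chain rule telescopes over coordinates, and the inverse of a coordinate exchange is
  differentiated implicitly, with invariance of domain making its image open. Tangent vectors are
  derivations of germs, so their coordinate expansion rests on Hadamard's lemma and on integrals
  with parameters.

  The leaf has its own topology, possibly finer than that of M, and may return to every
  neighbourhood of m0. The chart is therefore cut down to a cube, where the slice y = 0 is connected
  and clopen in the part of the leaf inside the cube, hence one whole plaque.\<close>

definition ecube :: "nat \<Rightarrow> (nat \<Rightarrow> real) \<Rightarrow> real \<Rightarrow> (nat \<Rightarrow> real) set" where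
  "ecube n a e = {x. (\<forall>i<n. \<bar>x i - a i\<bar> < e) \<and> (\<forall>i\<ge>n. x i = 0)}"

lemma openin_Euclidean_space_open:
  "openin (Euclidean_space n) S \<longleftrightarrow> (\<exists>T. open T \<and> S = T \<inter> {x. \<forall>i\<ge>n. x i = 0})"
  by (simp add: Euclidean_space_def openin_subtopology euclidean_product_topology)

lemma openin_ecube: "openin (Euclidean_space n) (ecube n a e)"
proof -
  have "open {x::nat\<Rightarrow>real. \<forall>i\<in>{..<n}. x (id i) \<in> ball (a i) e}"
    by (rule product_topology_basis') auto
  moreover have "ecube n a e = {x. \<forall>i\<in>{..<n}. x (id i) \<in> ball (a i) e} \<inter> {x. \<forall>i\<ge>n. x i = 0}"
    by (auto simp: ecube_def dist_real_def abs_minus_commute)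
  ultimately show ?thesis
    unfolding openin_Euclidean_space_open by blast
qed

lemma centre_in_ecube: "a \<in> topspace (Euclidean_space n) \<Longrightarrow> e > 0 \<Longrightarrow> a \<in> ecube n a e"
  by (simp add: ecube_def topspace_Euclidean_space)

text \<open>A basic open set of the product topology gives one radius per coordinate. Points of
  \<open>Euclidean_space n\<close> agree in all coordinates from \<open>n\<close> on, so only
  \<open>n\<close> of these radii count and their minimum is positive. Cubes are the working
  neighbourhoods because changing one coordinate within its interval never leaves them.\<close>

lemma open_contains_ecube:
  assumes "openin (Euclidean_space n) S" "x \<in> S"
  obtains e where "e > 0" "ecube n x e \<subseteq> S"
proof -
  obtain T where T: "open T" "S = T \<inter> {x. \<forall>i\<ge>n. x i = 0}"
    using iffD1[OF openin_Euclidean_space_open assms(1)] by (elim exE conjE)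
  obtain X where X: "x \<in> (\<Pi>\<^sub>E i\<in>UNIV. X i)" "\<And>i. open (X i)" "finite {i. X i \<noteq> UNIV}" "(\<Pi>\<^sub>E i\<in>UNIV. X i) \<subseteq> T"
  proof -
    have "openin (product_topology (\<lambda>i. euclidean) UNIV) T" "x \<in> T"
      using T assms(2) by (simp_all add: open_fun_def)
    from product_topology_open_contains_basis[OF this] show ?thesis
      using that by auto
  qed
  have "\<forall>i. \<exists>d>0. ball (x i) d \<subseteq> X i"
    using X(1,2) by (meson PiE_mem UNIV_I open_contains_ball)
  then obtain d where d: "\<And>i. d i > 0" "\<And>i. ball (x i) (d i) \<subseteq> X i"
    by metis
  \<comment> \<open>The extra 1 keeps the set nonempty when \<open>n = 0\<close>.\<close>
  define e where "e = Min (insert 1 (d ` {..<n}))"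
  have e: "e > 0" "\<And>i. i < n \<Longrightarrow> e \<le> d i"
    using d(1) by (auto simp: e_def)
  have "y \<in> S" if "y \<in> ecube n x e" for y
  proof -
    have "y i \<in> X i" for i
    proof (cases "i < n")
      case True
      then have "y i \<in> ball (x i) (d i)"
        using that e(2)[OF True] by (force simp: ecube_def dist_real_def abs_minus_commute)
      then show ?thesis using d(2) by blast
    next
      case False
      then have "y i = x i"
        using that assms(2) T(2) by (auto simp: ecube_def)
      then show ?thesis using X(1) by (auto simp: PiE_iff)
    qed
    then have "y \<in> T" using X(4) by (auto simp: PiE_iff)
    then show ?thesis using that T(2) by (auto simp: ecube_def)
  qed
  then show ?thesis using e(1) that by blast
qed

lemma open_in_Euclidean_space_zero:
  "openin (Euclidean_space n) S \<Longrightarrow> x \<in> S \<Longrightarrow> n \<le> i \<Longrightarrow> x i = 0"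
  using openin_subset[of "Euclidean_space n" S] by (auto simp: topspace_Euclidean_space)

lemma continuous_on_open_in_Euclidean_space:
  assumes "openin (Euclidean_space n) S" "continuous_on S f" "open T"
  shows "openin (Euclidean_space n) {x \<in> S. f x \<in> T}"
proof -
  have "openin (top_of_set S) (S \<inter> f -` T)"
    using assms(2,3) continuous_openin_preimage_gen by blast
  then obtain A where "open A" "S \<inter> f -` T = S \<inter> A"
    by (auto simp: openin_open)
  moreover obtain B where "open B" "S = B \<inter> {x. \<forall>i\<ge>n. x i = 0}"
    using iffD1[OF openin_Euclidean_space_open assms(1)] by (elim exE conjE)
  ultimately have "open (A \<inter> B)" "{x \<in> S. f x \<in> T} = (A \<inter> B) \<inter> {x. \<forall>i\<ge>n. x i = 0}"
    by auto
  then show ?thesis unfolding openin_Euclidean_space_open by blast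
qed

lemma continuous_near_in_ecube:
  fixes f :: "(nat \<Rightarrow> real) \<Rightarrow> real"
  assumes "openin (Euclidean_space n) S" "continuous_on S f" "x \<in> S" "e > 0"
  obtains d where "d > 0" "ecube n x d \<subseteq> S" "\<And>y. y \<in> ecube n x d \<Longrightarrow> \<bar>f y - f x\<bar> < e"
proof -
  have "openin (Euclidean_space n) {y \<in> S. f y \<in> ball (f x) e}"
    by (rule continuous_on_open_in_Euclidean_space[OF assms(1,2)]) simp
  moreover have "x \<in> {y \<in> S. f y \<in> ball (f x) e}" using assms by simp
  ultimately obtain d where "d > 0" "ecube n x d \<subseteq> {y \<in> S. f y \<in> ball (f x) e}"
    using open_contains_ecube by metis
  then show ?thesis
    by (intro that[of d]) (auto simp: dist_real_def abs_minus_commute)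
qed

lemma eventually_in_ecube:
  assumes "\<And>i. i < n \<Longrightarrow> ((\<lambda>t. y t i) \<longlongrightarrow> a i) F" "\<And>i t. n \<le> i \<Longrightarrow> y t i = 0" "e > 0"
  shows "\<forall>\<^sub>F t in F. y t \<in> ecube n a e"
proof -
  have "\<forall>\<^sub>F t in F. \<forall>i\<in>{..<n}. dist (y t i) (a i) < e"
    using assms(1,3) by (intro eventually_ball_finite) (auto intro: tendstoD)
  then show ?thesis
    by eventually_elim (use assms(2) in \<open>auto simp: ecube_def dist_real_def\<close>)
qed

text \<open>A point moved slightly along a coordinate line stays in the open set. This is what makes
  partial derivatives local: at points of \<open>S\<close> they depend only on the values on
  \<open>S\<close>.\<close>

lemma eventually_upd_in_open:
  assumes "openin (Euclidean_space n) S" "x \<in> S" "i < n"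
  shows "\<forall>\<^sub>F t in nhds (x i). x(i := t) \<in> S"
proof -
  obtain e where e: "e > 0" "ecube n x e \<subseteq> S"
    using open_contains_ecube assms by metis
  have "\<forall>\<^sub>F t in nhds (x i). x(i := t) \<in> ecube n x e"
  proof (rule eventually_in_ecube)
    show "((\<lambda>t. (x(i := t)) j) \<longlongrightarrow> x j) (nhds (x i))" for j
      by (cases "j = i") (auto simp: filterlim_ident)
  qed (use assms e open_in_Euclidean_space_zero in auto)
  then show ?thesis using e(2) by (auto elim: eventually_mono)
qed

section \<open>Locality and arithmetic of the classes \<open>Ck_on\<close>\<close>

lemma Ck_continuous: "Ck_on n k S f \<Longrightarrow> continuous_on S f"
  by (cases k) auto

lemma Ck_on_SucD: "Ck_on n (Suc k) S f \<Longrightarrow> Ck_on n k S f"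
  by (induction k arbitrary: f) auto

lemma Ck_on_le: "Ck_on n k S f \<Longrightarrow> j \<le> k \<Longrightarrow> Ck_on n j S f"
proof (induction k)
  case (Suc k)
  then show ?case using Ck_on_SucD le_Suc_eq by metis
qed simp

lemma Ck_on_subset: "Ck_on n k S f \<Longrightarrow> T \<subseteq> S \<Longrightarrow> Ck_on n k T f"
  by (induction k arbitrary: f) (auto intro: continuous_on_subset)

lemma partial_deriv_eqI:
  "((\<lambda>t. f (x(i := t))) has_real_derivative D) (at (x i)) \<Longrightarrow> partial_deriv i f x = D"
  unfolding partial_deriv_def by (rule DERIV_imp_deriv)

lemma Ck_on_partial_DERIV:
  assumes "Ck_on n (Suc k) S f" "i < n" "x \<in> S"
  shows "((\<lambda>t. f (x(i := t))) has_real_derivative partial_deriv i f x) (at (x i))"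
  using assms unfolding partial_deriv_def DERIV_deriv_iff_real_differentiable by simp

lemma Ck_on_line_DERIV:
  assumes "Ck_on n (Suc k) S f" "i < n" "x(i := u) \<in> S"
  shows "((\<lambda>t. f (x(i := t))) has_real_derivative partial_deriv i f (x(i := u))) (at u)"
  using Ck_on_partial_DERIV[OF assms] by (simp only: fun_upd_upd fun_upd_same)

lemma Ck_on_partial: "Ck_on n (Suc k) S f \<Longrightarrow> i < n \<Longrightarrow> Ck_on n k S (partial_deriv i f)"
  by simp

lemma partial_deriv_cong:
  assumes "openin (Euclidean_space n) S" "x \<in> S" "i < n" "\<And>y. y \<in> S \<Longrightarrow> f y = g y"
  shows "partial_deriv i f x = partial_deriv i g x"
  unfolding partial_deriv_def
proof (rule deriv_cong_ev)
  show "\<forall>\<^sub>F t in nhds (x i). f (x(i := t)) = g (x(i := t))"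
    using eventually_upd_in_open[OF assms(1-3)] by eventually_elim (rule assms(4))
qed simp

lemma Ck_on_cong:
  assumes "openin (Euclidean_space n) S" "\<And>y. y \<in> S \<Longrightarrow> f y = g y"
  shows "Ck_on n k S f \<longleftrightarrow> Ck_on n k S g"
  using assms(2)
proof (induction k arbitrary: f g)
  case 0
  then show ?case by (simp cong: continuous_on_cong)
next
  case (Suc k)
  have "(\<lambda>t. f (x(i := t))) differentiable at (x i) \<longleftrightarrow> (\<lambda>t. g (x(i := t))) differentiable at (x i)"
    if "i < n" "x \<in> S" for i x
  proof -
    have "\<forall>\<^sub>F t in nhds (x i). f (x(i := t)) = g (x(i := t))"
      using eventually_upd_in_open[OF assms(1) that(2,1)] by eventually_elim (rule Suc.prems)
    then show ?thesis
      unfolding real_differentiable_def by (intro ex_cong1 DERIV_cong_ev) auto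
  qed
  moreover have "Ck_on n k S (partial_deriv i f) \<longleftrightarrow> Ck_on n k S (partial_deriv i g)" if "i < n" for i
    by (rule Suc.IH) (rule partial_deriv_cong[OF assms(1) _ that Suc.prems])
  moreover have "continuous_on S f \<longleftrightarrow> continuous_on S g"
    using Suc.prems by (simp cong: continuous_on_cong)
  ultimately show ?case by simp
qed

text \<open>Lets the partial derivatives be given by any formula that is right on \<open>S\<close>.
  The function \<open>partial_deriv i f\<close> may differ from the formula off \<open>S\<close>,
  which is harmless because \<open>S\<close> is open.\<close>

lemma Ck_on_SucI:
  assumes "openin (Euclidean_space n) S" "continuous_on S f"
    and "\<And>i x. i < n \<Longrightarrow> x \<in> S \<Longrightarrow> ((\<lambda>t. f (x(i := t))) has_real_derivative D i x) (at (x i))"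
    and "\<And>i. i < n \<Longrightarrow> Ck_on n k S (D i)"
  shows "Ck_on n (Suc k) S f"
proof -
  have "Ck_on n k S (partial_deriv i f)" if "i < n" for i
    using Ck_on_cong[OF assms(1), of "partial_deriv i f" "D i" k] assms(3,4) that
    by (simp add: partial_deriv_eqI)
  moreover have "(\<lambda>t. f (x(i := t))) differentiable at (x i)" if "i < n" "x \<in> S" for i x
    using assms(3)[OF that] real_differentiable_def by blast
  ultimately show ?thesis using assms(2) by simp
qed

lemma Ck_on_const: "Ck_on n k S (\<lambda>x. c)"
proof (induction k arbitrary: c)
  case (Suc k)
  have "partial_deriv i (\<lambda>x. c) = (\<lambda>x. 0)" for i
    by (rule ext, rule partial_deriv_eqI) simp
  then show ?case using Suc by simp
qed simp

lemma Ck_on_coord: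
  assumes "openin (Euclidean_space n) S" shows "Ck_on n k S (\<lambda>x. x j)"
proof (cases k)
  case 0
  then show ?thesis
    using continuous_on_product_then_coordinatewise[OF continuous_on_id, of S j] by simp
next
  case (Suc k')
  show ?thesis unfolding Suc
  proof (rule Ck_on_SucI[OF assms, where D = "\<lambda>i x. if i = j then 1 else 0"])
    fix i x
    show "((\<lambda>t. (x(i := t)) j) has_real_derivative (if i = j then 1 else 0)) (at (x i))"
      by (cases "i = j") auto
    show "Ck_on n k' S (\<lambda>x. if i = j then 1 else 0)"
      by (rule Ck_on_const)
  qed (rule continuous_on_product_then_coordinatewise[OF continuous_on_id])
qed

lemma Ck_on_add:
  assumes S: "openin (Euclidean_space n) S"
  shows "Ck_on n k S f \<Longrightarrow> Ck_on n k S g \<Longrightarrow> Ck_on n k S (\<lambda>x. f x + g x)"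
proof (induction k arbitrary: f g)
  case 0
  then show ?case by (simp add: continuous_on_add)
next
  case (Suc k)
  show ?case
  proof (rule Ck_on_SucI[OF S, where D = "\<lambda>i x. partial_deriv i f x + partial_deriv i g x"])
    show "continuous_on S (\<lambda>x. f x + g x)"
      using Suc.prems by (simp add: continuous_on_add)
    show "((\<lambda>t. f (x(i := t)) + g (x(i := t))) has_real_derivative
      partial_deriv i f x + partial_deriv i g x) (at (x i))" if "i < n" "x \<in> S" for i x
      by (rule DERIV_add[OF Ck_on_partial_DERIV[OF Suc.prems(1) that] Ck_on_partial_DERIV[OF Suc.prems(2) that]])
    show "Ck_on n k S (\<lambda>x. partial_deriv i f x + partial_deriv i g x)" if "i < n" for i
      using Suc.prems that by (intro Suc.IH) simp_all
  qed
qed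

lemma Ck_on_mult:
  assumes S: "openin (Euclidean_space n) S"
  shows "Ck_on n k S f \<Longrightarrow> Ck_on n k S g \<Longrightarrow> Ck_on n k S (\<lambda>x. f x * g x)"
proof (induction k arbitrary: f g)
  case 0
  then show ?case by (simp add: continuous_on_mult)
next
  case (Suc k)
  show ?case
  proof (rule Ck_on_SucI[OF S, where D = "\<lambda>i x. partial_deriv i f x * g x + f x * partial_deriv i g x"])
    show "continuous_on S (\<lambda>x. f x * g x)"
      using Suc.prems by (simp add: continuous_on_mult)
    show "((\<lambda>t. f (x(i := t)) * g (x(i := t))) has_real_derivative
      partial_deriv i f x * g x + f x * partial_deriv i g x) (at (x i))" if "i < n" "x \<in> S" for i x
      using DERIV_mult[OF Ck_on_partial_DERIV[OF Suc.prems(1) that] Ck_on_partial_DERIV[OF Suc.prems(2) that]]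
      by (simp only: fun_upd_triv ac_simps)
    show "Ck_on n k S (\<lambda>x. partial_deriv i f x * g x + f x * partial_deriv i g x)" if "i < n" for i
      using Suc.prems that
      by (intro Ck_on_add[OF S] Suc.IH) (use Ck_on_SucD in \<open>simp_all\<close>)
  qed
qed

lemma Ck_on_sum:
  assumes S: "openin (Euclidean_space n) S"
  shows "(\<And>i. i \<in> I \<Longrightarrow> Ck_on n k S (f i)) \<Longrightarrow> Ck_on n k S (\<lambda>x. \<Sum>i\<in>I. f i x)"
  by (induction I rule: infinite_finite_induct) (auto intro: Ck_on_add[OF S] Ck_on_const)

text \<open>The derivative - (1/f) f' (1/f) contains 1/f only as a function of the previous class,
  so the induction closes with the product rule.\<close>

lemma Ck_on_inverse:
  assumes S: "openin (Euclidean_space n) S" and nz: "\<And>x. x \<in> S \<Longrightarrow> f x \<noteq> 0"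
  shows "Ck_on n k S f \<Longrightarrow> Ck_on n k S (\<lambda>x. inverse (f x))"
proof (induction k)
  case 0
  then show ?case using nz by (simp add: continuous_on_inverse)
next
  case (Suc k)
  have 1: "Ck_on n k S (\<lambda>x. inverse (f x))"
    using Suc Ck_on_SucD by blast
  show ?case
  proof (rule Ck_on_SucI[OF S, where D = "\<lambda>i x. (- 1) * (inverse (f x) * (partial_deriv i f x * inverse (f x)))"])
    show "continuous_on S (\<lambda>x. inverse (f x))"
      using 1 Ck_continuous by blast
    show "((\<lambda>t. inverse (f (x(i := t)))) has_real_derivative
      (- 1) * (inverse (f x) * (partial_deriv i f x * inverse (f x)))) (at (x i))" if "i < n" "x \<in> S" for i x
      using DERIV_inverse'[OF Ck_on_partial_DERIV[OF Suc.prems that]] nz[OF that(2)]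
      by (simp only: fun_upd_triv mult_minus1 mult.assoc simp_thms)
    show "Ck_on n k S (\<lambda>x. (- 1) * (inverse (f x) * (partial_deriv i f x * inverse (f x))))" if "i < n" for i
      using Suc.prems that 1
      by (intro Ck_on_mult[OF S] Ck_on_const) simp_all
  qed
qed

section \<open>Chain rule, Hadamard lemma and exchange of a coordinate\<close>

lemma mvt_coordinate:
  fixes f :: "(nat \<Rightarrow> real) \<Rightarrow> real"
  assumes f: "Ck_on n (Suc k) S f" and "m < n"
    and S: "\<And>w. w \<in> closed_segment u v \<Longrightarrow> y(m := w) \<in> S"
  obtains w where "w \<in> closed_segment u v"
    "f (y(m := u)) - f (y(m := v)) = partial_deriv m f (y(m := w)) * (u - v)"
proof -
  have *: "\<exists>w. w \<in> closed_segment a b \<and> f (y(m := b)) - f (y(m := a)) = partial_deriv m f (y(m := w)) * (b - a)"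
    if "a < b" "\<And>w. w \<in> {a..b} \<Longrightarrow> y(m := w) \<in> S" for a b
  proof -
    have "\<exists>w. a < w \<and> w < b \<and> f (y(m := b)) - f (y(m := a)) = (b - a) * partial_deriv m f (y(m := w))"
    proof (rule MVT2[OF that(1)])
      fix w assume "a \<le> w" "w \<le> b"
      then show "((\<lambda>w. f (y(m := w))) has_real_derivative partial_deriv m f (y(m := w))) (at w)"
        by (intro Ck_on_line_DERIV[OF f \<open>m < n\<close>] that(2)) simp
    qed
    then obtain w where "a < w" "w < b" "f (y(m := b)) - f (y(m := a)) = (b - a) * partial_deriv m f (y(m := w))"
      by blast
    then show ?thesis
      using that(1) by (intro exI[of _ w]) (simp add: closed_segment_eq_real_ivl mult.commute)
  qed
  consider "u = v" | "u < v" | "v < u" by linarith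
  then show ?thesis
  proof cases
    case 1
    then show ?thesis using that by simp
  next
    case 2
    then obtain w where "w \<in> closed_segment u v" "f (y(m := v)) - f (y(m := u)) = partial_deriv m f (y(m := w)) * (v - u)"
      using *[of u v] S by (auto simp: closed_segment_eq_real_ivl)
    then show ?thesis using that by (metis minus_diff_eq mult_minus_right)
  next
    case 3
    then show ?thesis
      using *[of v u] S that by (auto simp: closed_segment_eq_real_ivl closed_segment_commute)
  qed
qed

text \<open>By the mean value theorem in coordinate \<open>m\<close>, the quotient
  \<open>c t\<close> is a partial derivative at a point of the segment, and that point tends to
  \<open>a\<close>. The remaining coordinates \<open>y t\<close> may move as well; both the chain
  rule and the implicit differentiation below need this freedom.\<close>

lemma partial_increment:
  fixes f :: "(nat \<Rightarrow> real) \<Rightarrow> real"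
  assumes S: "openin (Euclidean_space n) S" and f: "Ck_on n (Suc 0) S f" and a: "a \<in> S" and m: "m < n"
    and y: "\<And>i. i < n \<Longrightarrow> i \<noteq> m \<Longrightarrow> ((\<lambda>t. y t i) \<longlongrightarrow> a i) F" "\<And>i t. n \<le> i \<Longrightarrow> y t i = 0"
    and u: "(u \<longlongrightarrow> a m) F" and v: "(v \<longlongrightarrow> a m) F"
  obtains c where "(c \<longlongrightarrow> partial_deriv m f a) F"
    "\<forall>\<^sub>F t in F. f ((y t)(m := u t)) - f ((y t)(m := v t)) = c t * (u t - v t)"
proof -
  define Q where "Q t = (f ((y t)(m := u t)) - f ((y t)(m := v t))) / (u t - v t)" for t
  \<comment> \<open>Where the quotient would be 0/0 the limit value is taken, so that the increment
    formula and the convergence hold there too.\<close>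
  define c where "c t = (if u t = v t then partial_deriv m f a else Q t)" for t
  have cont: "continuous_on S (partial_deriv m f)"
    using Ck_on_partial[OF f m] by simp
  have near: "\<forall>\<^sub>F t in F. (y t)(m := u t) \<in> ecube n a d \<and> (y t)(m := v t) \<in> ecube n a d" if "d > 0" for d
  proof (rule eventually_conj)
    show "\<forall>\<^sub>F t in F. (y t)(m := u t) \<in> ecube n a d"
    proof (rule eventually_in_ecube[OF _ _ that])
      show "((\<lambda>t. ((y t)(m := u t)) i) \<longlongrightarrow> a i) F" if "i < n" for i
        using y(1)[OF that] u by (cases "i = m") auto
    qed (use y(2) m in auto)
    show "\<forall>\<^sub>F t in F. (y t)(m := v t) \<in> ecube n a d"
    proof (rule eventually_in_ecube[OF _ _ that])
      show "((\<lambda>t. ((y t)(m := v t)) i) \<longlongrightarrow> a i) F" if "i < n" for i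
        using y(1)[OF that] v by (cases "i = m") auto
    qed (use y(2) m in auto)
  qed
  have seg: "(y t)(m := w) \<in> ecube n a d"
    if "(y t)(m := u t) \<in> ecube n a d" "(y t)(m := v t) \<in> ecube n a d" "w \<in> closed_segment (u t) (v t)" for t w d
    unfolding ecube_def
  proof (intro CollectI conjI allI impI)
    show "\<bar>((y t)(m := w)) i - a i\<bar> < d" if "i < n" for i
    proof (cases "i = m")
      case True
      have "\<bar>u t - a m\<bar> < d" "\<bar>v t - a m\<bar> < d"
        using \<open>(y t)(m := u t) \<in> _\<close> \<open>(y t)(m := v t) \<in> _\<close> m by (auto simp: ecube_def split: if_splits)
      then show ?thesis
        using \<open>w \<in> _\<close> True by (auto simp: closed_segment_eq_real_ivl split: if_splits)
    next
      case False
      then show ?thesis using \<open>(y t)(m := u t) \<in> _\<close> that by (auto simp: ecube_def split: if_splits)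
    qed
    show "((y t)(m := w)) i = 0" if "n \<le> i" for i
      using that m y(2) by auto
  qed
  have "(c \<longlongrightarrow> partial_deriv m f a) F"
  proof (rule tendstoI)
    fix e :: real assume "e > 0"
    then obtain d where d: "d > 0" "ecube n a d \<subseteq> S"
      "\<And>z. z \<in> ecube n a d \<Longrightarrow> \<bar>partial_deriv m f z - partial_deriv m f a\<bar> < e"
      using continuous_near_in_ecube[OF S cont a] by metis
    from near[OF d(1)] show "\<forall>\<^sub>F t in F. dist (c t) (partial_deriv m f a) < e"
    proof eventually_elim
      case (elim t)
      show ?case
      proof (cases "u t = v t")
        case True
        then show ?thesis using \<open>e > 0\<close> by (simp add: c_def)
      next
        case False
        have "\<And>w. w \<in> closed_segment (u t) (v t) \<Longrightarrow> (y t)(m := w) \<in> S"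
          using seg elim d(2) by blast
        from mvt_coordinate[OF f m this] obtain w where w: "w \<in> closed_segment (u t) (v t)"
          "f ((y t)(m := u t)) - f ((y t)(m := v t)) = partial_deriv m f ((y t)(m := w)) * (u t - v t)"
          by metis
        then have "c t = partial_deriv m f ((y t)(m := w))"
          using False by (simp add: c_def Q_def)
        then show ?thesis
          using d(3) seg elim w(1) by (simp add: dist_real_def)
      qed
    qed
  qed
  moreover have "\<forall>\<^sub>F t in F. f ((y t)(m := u t)) - f ((y t)(m := v t)) = c t * (u t - v t)"
    by (rule always_eventually) (simp add: c_def Q_def)
  ultimately show ?thesis using that by blast
qed

text \<open>Caratheodory's form of differentiability: the difference quotient of \<open>h\<close> is
  \<open>c\<close> times that of \<open>g\<close>, also where \<open>g t = g t0\<close>, so nothing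
  is divided by an increment of \<open>g\<close>.\<close>

lemma DERIV_of_increment:
  fixes h g :: "real \<Rightarrow> real"
  assumes "(c \<longlongrightarrow> c0) (at t0)" "(g has_real_derivative g') (at t0)"
    and "\<forall>\<^sub>F t in at t0. h t - h t0 = c t * (g t - g t0)"
  shows "(h has_real_derivative c0 * g') (at t0)"
proof -
  have "((\<lambda>t. c t * ((g t - g t0) / (t - t0))) \<longlongrightarrow> c0 * g') (at t0)"
    using assms(1,2) unfolding has_field_derivative_iff by (rule tendsto_mult)
  moreover have "\<forall>\<^sub>F t in at t0. c t * ((g t - g t0) / (t - t0)) = (h t - h t0) / (t - t0)"
    using assms(3) by eventually_elim simp
  ultimately show ?thesis
    unfolding has_field_derivative_iff by (rule Lim_transform_eventually)
qed

text \<open>The increment of \<open>f\<close> along the curve is telescoped by moving one coordinate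
  after the other from time \<open>t0\<close> to time \<open>t\<close>. Each move is an increment in
  a single coordinate over a moving base point.\<close>

lemma DERIV_partial_chain:
  fixes f :: "(nat \<Rightarrow> real) \<Rightarrow> real" and t0 :: real
  assumes S: "openin (Euclidean_space n) S" and f: "Ck_on n (Suc 0) S f"
    and y0: "y t0 \<in> S" and y: "\<And>i t. n \<le> i \<Longrightarrow> y t i = 0"
    and dy: "\<And>i. i < n \<Longrightarrow> ((\<lambda>t. y t i) has_real_derivative y' i) (at t0)"
  shows "((\<lambda>t. f (y t)) has_real_derivative (\<Sum>i<n. partial_deriv i f (y t0) * y' i)) (at t0)"
proof -
  \<comment> \<open>The first \<open>m\<close> coordinates already follow the curve, the others
    still wait at \<open>t0\<close>.\<close>
  define W where "W m t = (\<lambda>i. if i < m then y t i else y t0 i)" for m t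
  have lim: "((\<lambda>t. y t i) \<longlongrightarrow> y t0 i) (at t0)" if "i < n" for i
    using DERIV_isCont[OF dy[OF that]] by (simp add: isCont_def)
  have "((\<lambda>t. f (W m t)) has_real_derivative (\<Sum>i<m. partial_deriv i f (y t0) * y' i)) (at t0)" if "m \<le> n" for m
    using that
  proof (induction m)
    case 0
    then show ?case by (simp add: W_def)
  next
    case (Suc m)
    have W: "W (Suc m) t = (W m t)(m := y t m)" "W m t = (W m t)(m := y t0 m)" for t
      by (auto simp: W_def less_Suc_eq)
    obtain c where c: "(c \<longlongrightarrow> partial_deriv m f (y t0)) (at t0)"
      "\<forall>\<^sub>F t in at t0. f ((W m t)(m := y t m)) - f ((W m t)(m := y t0 m)) = c t * (y t m - y t0 m)"
    proof (rule partial_increment[OF S f y0])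
      show "m < n" using Suc.prems by simp
      show "((\<lambda>t. W m t i) \<longlongrightarrow> y t0 i) (at t0)" if "i < n" for i
        using lim[OF that] by (cases "i < m") (simp_all add: W_def)
      show "((\<lambda>t. y t m) \<longlongrightarrow> y t0 m) (at t0)" using lim Suc.prems by simp
    qed (auto simp: W_def y)
    have "((\<lambda>t. f (W (Suc m) t) - f (W m t)) has_real_derivative partial_deriv m f (y t0) * y' m) (at t0)"
    proof (rule DERIV_of_increment[OF c(1)])
      show "((\<lambda>t. y t m) has_real_derivative y' m) (at t0)" using dy Suc.prems by simp
      have "W (Suc m) t0 = W m t0" by (auto simp: W_def)
      then show "\<forall>\<^sub>F t in at t0. f (W (Suc m) t) - f (W m t) - (f (W (Suc m) t0) - f (W m t0)) = c t * (y t m - y t0 m)"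
        using c(2) W by simp
    qed
    from DERIV_add[OF Suc.IH this] Suc.prems show ?case
      by simp
  qed
  moreover have "W n = y"
    using y by (auto simp: W_def fun_eq_iff)
  ultimately show ?thesis by (metis order_refl)
qed

text \<open>Induction on \<open>k\<close>: the chain rule writes a partial derivative of the
  composite as a sum of products of the partial derivatives of \<open>f\<close>, composed with
  \<open>G\<close>, and those of \<open>G\<close>. All of them are of the lower class, so the
  induction hypothesis applies.\<close>

lemma Ck_on_compose:
  assumes S: "openin (Euclidean_space n) S" and T: "openin (Euclidean_space m) T"
    and G: "\<And>x. x \<in> S \<Longrightarrow> G x \<in> T"
  shows "Ck_on m k T f \<Longrightarrow> (\<And>i. i < m \<Longrightarrow> Ck_on n k S (\<lambda>x. G x i)) \<Longrightarrow> Ck_on n k S (\<lambda>x. f (G x))"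
proof (induction k arbitrary: f)
  case 0
  have "continuous_on S (\<lambda>x. G x i)" for i
  proof (cases "i < m")
    case False
    then have "G x i = 0" if "x \<in> S" for x
      using open_in_Euclidean_space_zero[OF T G[OF that]] by simp
    then show ?thesis by (simp cong: continuous_on_cong)
  qed (use 0 in simp)
  then have "continuous_on S G"
    by (rule continuous_on_coordinatewise_then_product)
  then show ?case
    using 0(1) G continuous_on_compose2[of T f S G] by auto
next
  case (Suc k)
  show ?case
  proof (rule Ck_on_SucI[OF S, where D = "\<lambda>j x. \<Sum>i<m. partial_deriv i f (G x) * partial_deriv j (\<lambda>x. G x i) x"])
    have IH: "Ck_on n k S (\<lambda>x. g (G x))" if "Ck_on m k T g" for g
      using Suc.IH[OF that] Suc.prems(2) Ck_on_SucD by blast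
    show "continuous_on S (\<lambda>x. f (G x))"
      using IH[OF Ck_on_SucD[OF Suc.prems(1)]] by (rule Ck_continuous)
    show "Ck_on n k S (\<lambda>x. \<Sum>i<m. partial_deriv i f (G x) * partial_deriv j (\<lambda>x. G x i) x)" if "j < n" for j
      using that Suc.prems by (intro Ck_on_sum[OF S] Ck_on_mult[OF S] IH Ck_on_partial) auto
    show "((\<lambda>t. f (G (x(j := t)))) has_real_derivative
        (\<Sum>i<m. partial_deriv i f (G x) * partial_deriv j (\<lambda>x. G x i) x)) (at (x j))"
      if "j < n" "x \<in> S" for j x
    proof -
      \<comment> \<open>The chain rule asks for a curve that stays in
        \<open>Euclidean_space m\<close> for all \<open>t\<close>, whereas \<open>G\<close> is only
        controlled on \<open>S\<close>. Truncating to the first \<open>m\<close> coordinates changes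
        nothing for \<open>t\<close> near \<open>x j\<close>.\<close>
      define y where "y t = (\<lambda>i. if i < m then G (x(j := t)) i else 0)" for t
      have yG: "y t = G (x(j := t))" if "x(j := t) \<in> S" for t
        using open_in_Euclidean_space_zero[OF T G[OF that]] by (auto simp: y_def fun_eq_iff)
      have y0: "y (x j) = G x" using yG[of "x j"] that by simp
      have "((\<lambda>t. f (y t)) has_real_derivative
        (\<Sum>i<m. partial_deriv i f (y (x j)) * partial_deriv j (\<lambda>x. G x i) x)) (at (x j))"
      proof (rule DERIV_partial_chain[OF T])
        show "Ck_on m (Suc 0) T f" using Suc.prems(1) by (rule Ck_on_le) simp
        show "y (x j) \<in> T" using y0 G that by simp
        show "((\<lambda>t. y t i) has_real_derivative partial_deriv j (\<lambda>x. G x i) x) (at (x j))" if "i < m" for i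
          using Ck_on_partial_DERIV[OF Suc.prems(2)[OF that] \<open>j < n\<close> \<open>x \<in> S\<close>] that by (simp only: y_def if_True)
      qed (simp add: y_def)
      moreover have "\<forall>\<^sub>F t in nhds (x j). f (y t) = f (G (x(j := t)))"
        using eventually_upd_in_open[OF S that(2,1)] by eventually_elim (simp only: yG)
      ultimately show ?thesis
        unfolding y0 by (rule DERIV_cong_ev[THEN iffD1, OF refl _ refl, rotated])
    qed
  qed
qed

lemma Ck_on_upd_compose:
  assumes S: "openin (Euclidean_space n) S" and T: "openin (Euclidean_space n) T"
    and i: "i < n" and G: "\<And>x. x \<in> S \<Longrightarrow> x(i := g x) \<in> T"
    and f: "Ck_on n k T f" and g: "Ck_on n k S g"
  shows "Ck_on n k S (\<lambda>x. f (x(i := g x)))"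
proof (rule Ck_on_compose[OF S T G f])
  show "Ck_on n k S (\<lambda>x. (x(i := g x)) j)" for j
    using g Ck_on_coord[OF S] by (cases "j = i") simp_all
qed


lemma smooth_onD: "smooth_on n S f \<Longrightarrow> Ck_on n k S f"
  by (simp add: smooth_on_def)


section \<open>Parameter integrals and Hadamard's lemma\<close>

lemma ecube_shrink:
  assumes "i < n" "x \<in> ecube n a e" "0 \<le> t" "t \<le> 1"
  shows "x(i := a i + t * (x i - a i)) \<in> ecube n a e"
proof -
  have "\<bar>t * (x i - a i)\<bar> \<le> 1 * \<bar>x i - a i\<bar>"
    unfolding abs_mult using assms by (intro mult_right_mono) auto
  then show ?thesis using assms by (auto simp: ecube_def)
qed

lemma line_integrand_continuous:
  fixes h :: "(nat \<Rightarrow> real) \<Rightarrow> real"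
  assumes i: "i < n" and h: "continuous_on (ecube n a e) h"
  shows "continuous_on (ecube n a e \<times> cbox 0 1) (\<lambda>(x, t). t ^ m * h (x(i := a i + t * (x i - a i))))"
proof -
  have coord: "continuous_on A (\<lambda>z. fst z l)" for l and A :: "((nat \<Rightarrow> real) \<times> real) set"
    by (rule continuous_on_product_then_coordinatewise) (intro continuous_intros)
  have "continuous_on (ecube n a e \<times> cbox 0 1) (\<lambda>z. (fst z)(i := a i + snd z * (fst z i - a i)))"
  proof (rule continuous_on_coordinatewise_then_product)
    show "continuous_on (ecube n a e \<times> cbox 0 1) (\<lambda>z. ((fst z)(i := a i + snd z * (fst z i - a i))) l)" for l
      by (cases "l = i") (auto intro!: continuous_intros coord)
  qed
  then have "continuous_on (ecube n a e \<times> cbox 0 1) (\<lambda>z. h ((fst z)(i := a i + snd z * (fst z i - a i))))"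
    by (rule continuous_on_compose2[OF h]) (use ecube_shrink[OF i] in \<open>auto simp del: fun_upd_apply\<close>)
  then show ?thesis
    unfolding split_beta by (intro continuous_intros)
qed

lemma line_integral_continuous:
  fixes h :: "(nat \<Rightarrow> real) \<Rightarrow> real"
  assumes "i < n" "continuous_on (ecube n a e) h"
  shows "continuous_on (ecube n a e) (\<lambda>x. integral (cbox 0 1) (\<lambda>t. t ^ m * h (x(i := a i + t * (x i - a i)))))"
  by (rule integral_continuous_on_param) (rule line_integrand_continuous[OF assms])

text \<open>Differentiation under the integral sign. In direction \<open>i\<close> the evaluation
  point moves with speed \<open>t\<close>, which brings out another factor \<open>t\<close>; in
  other directions none appears. The weight \<open>t ^ m\<close> is carried along so that the
  induction hypothesis covers the derivatives.\<close>

lemma Ck_on_line_integral: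
  assumes i: "i < n"
  shows "Ck_on n k (ecube n a e) h \<Longrightarrow>
    Ck_on n k (ecube n a e) (\<lambda>x. integral (cbox 0 1) (\<lambda>t::real. t ^ m * h (x(i := a i + t * (x i - a i)))))"
proof (induction k arbitrary: h m)
  case 0
  then show ?case
    unfolding Ck_on.simps by (rule line_integral_continuous[OF i])
next
  case (Suc k)
  let ?C = "ecube n a e"
  let ?R = "\<lambda>x t::real. x(i := a i + t * (x i - a i))"
  define p where "p j = (if j = i then Suc m else m)" for j
  show ?case
  proof (rule Ck_on_SucI[OF openin_ecube,
      where D = "\<lambda>j x. integral (cbox 0 1) (\<lambda>t. t ^ p j * partial_deriv j h (?R x t))"])
    show "continuous_on ?C (\<lambda>x. integral (cbox 0 1) (\<lambda>t. t ^ m * h (?R x t)))"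
      using line_integral_continuous[OF i Ck_continuous[OF Suc.prems]] .
    show "Ck_on n k ?C (\<lambda>x. integral (cbox 0 1) (\<lambda>t. t ^ p j * partial_deriv j h (?R x t)))" if "j < n" for j
      using Suc.prems that by (intro Suc.IH Ck_on_partial)
    show "((\<lambda>s. integral (cbox 0 1) (\<lambda>t. t ^ m * h (?R (x(j := s)) t)))
        has_real_derivative integral (cbox 0 1) (\<lambda>t. t ^ p j * partial_deriv j h (?R x t))) (at (x j))"
      if j: "j < n" and x: "x \<in> ?C" for j x
    proof -
      \<comment> \<open>The Leibniz rule gives a derivative within \<open>U\<close>. As
        \<open>U\<close> is an open interval around \<open>x j\<close>, this is the full
        derivative.\<close>
      define U where "U = {a j - e<..<a j + e}"
      have xU: "x j \<in> U" using x j by (auto simp: U_def ecube_def abs_less_iff)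
      have C: "x(j := s) \<in> ?C" if "s \<in> U" for s
        using that x j by (auto simp: U_def ecube_def abs_less_iff)
      have RC: "?R y t \<in> ?C" if "y \<in> ?C" "t \<in> cbox 0 1" for y t
        by (rule ecube_shrink[OF i that(1)]) (use that(2) in auto)
      have cont1: "continuous_on ?C (partial_deriv j h)"
        using Ck_on_partial[OF Suc.prems j] by (rule Ck_continuous)
      have "((\<lambda>s. integral (cbox 0 1) (\<lambda>t. t ^ m * h (?R (x(j := s)) t)))
        has_real_derivative integral (cbox 0 1) (\<lambda>t. t ^ p j * partial_deriv j h (?R (x(j := x j)) t))) (at (x j) within U)"
      proof (rule leibniz_rule_field_derivative[OF _ _ _ xU])
        show "convex U" by (simp add: U_def)
        show "(\<lambda>t. t ^ m * h (?R (x(j := s)) t)) integrable_on cbox 0 1" if "s \<in> U" for s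
        proof (rule integrable_continuous)
          have "continuous_on (cbox 0 1) (\<lambda>t::real. (x(j := s), t))"
            by (intro continuous_intros)
          from continuous_on_compose2[OF line_integrand_continuous[OF i Ck_continuous[OF Suc.prems], of m] this] C[OF that]
          show "continuous_on (cbox 0 1) (\<lambda>t. t ^ m * h (?R (x(j := s)) t))"
            by (simp only: split_conv image_subset_iff mem_Times_iff fst_conv snd_conv simp_thms Ball_def)
        qed
        have "continuous_on U (\<lambda>s. x(j := s))"
        proof (rule continuous_on_coordinatewise_then_product)
          show "continuous_on U (\<lambda>s. (x(j := s)) l)" for l
            by (cases "l = j") auto
        qed
        then have "continuous_on (U \<times> cbox 0 1) (\<lambda>z. (x(j := fst z), snd z))"
          by (intro continuous_on_Pair continuous_on_compose2[of U "\<lambda>s. x(j := s)" "U \<times> cbox 0 1" fst]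
              continuous_on_fst continuous_on_snd continuous_on_id) auto
        moreover have "(\<lambda>z. (x(j := fst z), snd z)) ` (U \<times> cbox 0 1) \<subseteq> ?C \<times> cbox 0 1"
          by (auto simp del: fun_upd_apply intro: C)
        ultimately have "continuous_on (U \<times> cbox 0 1) (\<lambda>z. case (x(j := fst z), snd z) of (x, t) \<Rightarrow> t ^ p j * partial_deriv j h (?R x t))"
          by (rule continuous_on_compose2[OF line_integrand_continuous[OF i cont1, of "p j"]])
        then
        show "continuous_on (U \<times> cbox 0 1) (\<lambda>(s, t). t ^ p j * partial_deriv j h (?R (x(j := s)) t))"
          by (simp only: case_prod_beta' fst_conv snd_conv)
        show "((\<lambda>s. t ^ m * h (?R (x(j := s)) t)) has_real_derivative t ^ p j * partial_deriv j h (?R (x(j := s)) t)) (at s within U)"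
          if s: "s \<in> U" and t: "t \<in> cbox 0 1" for s t
        proof (cases "j = i")
          case True
          have R: "?R (x(j := s)) t = x(i := a i + t * (s - a i))" for s
            using True by simp
          have "((\<lambda>u. h (x(i := u))) has_real_derivative partial_deriv i h (x(i := a i + t * (s - a i)))) (at (a i + t * (s - a i)))"
            using RC[OF C[OF s] t] unfolding R by (rule Ck_on_line_DERIV[OF Suc.prems i])
          moreover have "((\<lambda>s. a i + t * (s - a i)) has_real_derivative t) (at s)"
            by (auto intro!: derivative_eq_intros)
          ultimately have "((\<lambda>s. h (x(i := a i + t * (s - a i)))) has_real_derivative
              partial_deriv i h (x(i := a i + t * (s - a i))) * t) (at s)"
            by (rule DERIV_chain2)
          from DERIV_cmult[OF this, of "t ^ m"] show ?thesis
            unfolding R p_def using True by (auto simp: ac_simps intro: has_field_derivative_at_within)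
        next
          case False
          have R: "?R (x(j := s)) t = (?R x t)(j := s)" for s
            using False by (auto simp: fun_eq_iff)
          have "((\<lambda>s. h ((?R x t)(j := s))) has_real_derivative partial_deriv j h ((?R x t)(j := s))) (at s)"
            using RC[OF C[OF s] t] unfolding R by (rule Ck_on_line_DERIV[OF Suc.prems j])
          from DERIV_cmult[OF this, of "t ^ m"] show ?thesis
            unfolding R p_def if_not_P[OF False] by (rule has_field_derivative_at_within)
        qed
      qed
      moreover have "open U" by (simp add: U_def)
      ultimately show ?thesis
        using at_within_open[OF xU] by (simp only: fun_upd_triv)
    qed
  qed
qed

text \<open>The fundamental theorem of calculus along the segment from \<open>x(i := a i)\<close> to
  \<open>x\<close>. The function \<open>g\<close> is the mean of the partial derivative over this
  segment, so it is smooth as a parameter integral; for \<open>x = a\<close> the segment is a single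
  point.\<close>

lemma hadamard_coordinate:
  assumes i: "i < n" and a: "a \<in> ecube n a e" and f: "smooth_on n (ecube n a e) f"
  obtains g where "smooth_on n (ecube n a e) g" "g a = partial_deriv i f a"
    "\<And>x. x \<in> ecube n a e \<Longrightarrow> f x = f (x(i := a i)) + (x i - a i) * g x"
proof
  let ?R = "\<lambda>x t::real. x(i := a i + t * (x i - a i))"
  \<comment> \<open>The factor \<open>t ^ 0\<close> makes this literally the case
    \<open>m = 0\<close> of the weighted integral.\<close>
  define g where "g x = integral (cbox 0 1) (\<lambda>t::real. t ^ 0 * partial_deriv i f (?R x t))" for x
  show "smooth_on n (ecube n a e) g"
    unfolding smooth_on_def g_def
    by (intro allI Ck_on_line_integral[OF i] Ck_on_partial[OF _ i] smooth_onD[OF f])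
  show "g a = partial_deriv i f a"
    by (simp add: g_def)
  show "f x = f (x(i := a i)) + (x i - a i) * g x" if x: "x \<in> ecube n a e" for x
  proof -
    have "((\<lambda>t. (x i - a i) * partial_deriv i f (?R x t)) has_integral (f (?R x 1) - f (?R x 0))) {0..1}"
    proof (rule fundamental_theorem_of_calculus)
      fix t :: real assume "t \<in> {0..1}"
      then have "?R x t \<in> ecube n a e"
        using ecube_shrink[OF i x] by simp
      then have "((\<lambda>u. f (x(i := u))) has_real_derivative partial_deriv i f (?R x t)) (at (a i + t * (x i - a i)))"
        by (rule Ck_on_line_DERIV[OF smooth_onD[OF f] i])
      moreover have "((\<lambda>t. a i + t * (x i - a i)) has_real_derivative (x i - a i)) (at t)"
        by (auto intro!: derivative_eq_intros)
      ultimately have "((\<lambda>t. f (?R x t)) has_real_derivative partial_deriv i f (?R x t) * (x i - a i)) (at t)"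
        by (rule DERIV_chain2)
      from has_field_derivative_at_within[OF this]
      show "((\<lambda>t. f (?R x t)) has_vector_derivative (x i - a i) * partial_deriv i f (?R x t)) (at t within {0..1})"
        unfolding has_real_derivative_iff_has_vector_derivative[symmetric] by (subst mult.commute)
    qed simp
    from integral_unique[OF this] show ?thesis
      by (simp add: g_def)
  qed
qed


section \<open>Exchange of one coordinate for a function\<close>

lemma coordinate_replacement_openin:
  assumes i: "i < n" and V: "openin (Euclidean_space n) V" and f: "continuous_on V f"
    and inj: "inj_on (\<lambda>x. x(i := f x)) V"
  shows "openin (Euclidean_space n) ((\<lambda>x. x(i := f x)) ` V)"
proof (rule invariance_of_domain_Euclidean_space[OF V _ inj])
  have "continuous_on V (\<lambda>x. x(i := f x))"
  proof (rule continuous_on_coordinatewise_then_product)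
    show "continuous_on V (\<lambda>x. (x(i := f x)) j)" for j
      using f continuous_on_product_then_coordinatewise[OF continuous_on_id, of V j] by (cases "j = i") simp_all
  qed
  moreover have "V \<subseteq> topspace (Euclidean_space n)"
    by (rule openin_subset[OF V])
  ultimately show "continuous_map (subtopology (Euclidean_space n) V) (Euclidean_space n) (\<lambda>x. x(i := f x))"
    using i by (auto simp: cm_Euclidean_space_iff_continuous_on topspace_Euclidean_space Int_absorb1)
qed

text \<open>Openness of the image comes from invariance of domain, so that only a one-variable
  implicit function argument is left.\<close>

lemma coordinate_replacement:
  fixes f :: "(nat \<Rightarrow> real) \<Rightarrow> real"
  assumes S: "openin (Euclidean_space n) S" and f: "smooth_on n S f" and a: "a \<in> S" and i: "i < n"
    and nz: "partial_deriv i f a \<noteq> 0"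
  obtains V g where "openin (Euclidean_space n) V" "a \<in> V" "V \<subseteq> S" "inj_on (\<lambda>x. x(i := f x)) V"
    "openin (Euclidean_space n) ((\<lambda>x. x(i := f x)) ` V)"
    "smooth_on n ((\<lambda>x. x(i := f x)) ` V) g" "\<And>x. x \<in> V \<Longrightarrow> g (x(i := f x)) = x i"
proof -
  let ?\<Phi> = "\<lambda>x. x(i := f x)"
  have "continuous_on S (partial_deriv i f)"
    using Ck_on_partial[OF smooth_onD[OF f] i, of 0] by simp
  \<comment> \<open>On this cube the derivative differs from its value at \<open>a\<close> by less
    than the absolute value of the latter, so it has no zero there.\<close>
  then obtain e where e: "e > 0" "ecube n a e \<subseteq> S"
    "\<And>y. y \<in> ecube n a e \<Longrightarrow> \<bar>partial_deriv i f y - partial_deriv i f a\<bar> < \<bar>partial_deriv i f a\<bar>"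
    using continuous_near_in_ecube[OF S _ a, of "partial_deriv i f" "\<bar>partial_deriv i f a\<bar>"] nz by auto
  define V where "V = ecube n a e"
  define W where "W = ?\<Phi> ` V"
  have V: "openin (Euclidean_space n) V" by (simp add: V_def openin_ecube)
  have aV: "a \<in> V"
    using centre_in_ecube[OF _ e(1)] openin_subset[OF S] a by (auto simp: V_def)
  have VS: "V \<subseteq> S" using e by (simp add: V_def)
  have fV: "Ck_on n k V f" for k
    using Ck_on_subset[OF smooth_onD[OF f] VS] .
  have nzV: "partial_deriv i f y \<noteq> 0" if "y \<in> V" for y
    using e(3)[of y] that by (auto simp: V_def)
  \<comment> \<open>Points with the same image differ at most in coordinate \<open>i\<close> and
    have the same value of \<open>f\<close>. The segment between them stays in the cube, so the mean
    value theorem and the nonvanishing derivative force them to coincide.\<close>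
  have inj: "inj_on ?\<Phi> V"
  proof (rule inj_onI)
    fix x y assume x: "x \<in> V" and y: "y \<in> V" and eq: "x(i := f x) = y(i := f y)"
    have yx: "y = x(i := y i)"
      using eq by (metis fun_upd_triv fun_upd_upd)
    have feq: "f x = f y" using eq by (metis fun_upd_same)
    have xi: "\<bar>x i - a i\<bar> < e" and yi: "\<bar>y i - a i\<bar> < e"
      using x y i by (auto simp: V_def ecube_def)
    have "x(i := w) \<in> V" if "w \<in> closed_segment (x i) (y i)" for w
    proof -
      have "\<bar>w - a i\<bar> < e"
        using that xi yi by (auto simp: closed_segment_eq_real_ivl split: if_splits)
      then show ?thesis using x i by (auto simp: V_def ecube_def)
    qed
    from mvt_coordinate[OF fV[of "Suc 0"] i this] obtain w where w: "w \<in> closed_segment (x i) (y i)"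
        "x(i := w) \<in> V" "f (x(i := x i)) - f (x(i := y i)) = partial_deriv i f (x(i := w)) * (x i - y i)"
      using \<open>\<And>w. w \<in> closed_segment (x i) (y i) \<Longrightarrow> x(i := w) \<in> V\<close> by metis
    then have "x i = y i"
      using feq yx nzV[OF w(2)] by (metis fun_upd_triv diff_self eq_iff_diff_eq_0 mult_eq_0_iff)
    then show "x = y" using yx by (metis fun_upd_triv)
  qed
  have oW: "openin (Euclidean_space n) (?\<Phi> ` A)" if "openin (Euclidean_space n) A" "A \<subseteq> V" for A
    using coordinate_replacement_openin[OF i that(1)] Ck_continuous[OF fV[of 0]] inj that(2)
    by (meson continuous_on_subset inj_on_subset)
  have W: "openin (Euclidean_space n) W"
    unfolding W_def by (rule oW[OF V subset_refl])
  define g where "g y = inv_into V ?\<Phi> y i" for y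
  have g: "g (x(i := f x)) = x i" if "x \<in> V" for x
    unfolding g_def using inv_into_f_f[OF inj that] by simp
  have gV: "y(i := g y) \<in> V" "f (y(i := g y)) = y i" if "y \<in> W" for y
  proof -
    obtain x where x: "x \<in> V" "y = x(i := f x)" using \<open>y \<in> W\<close> unfolding W_def by (elim imageE)
    then have "y(i := g y) = x" using g[OF x(1)] by simp
    then show "y(i := g y) \<in> V" "f (y(i := g y)) = y i" using x by simp_all
  qed
  \<comment> \<open>The image of a small cube around the preimage of \<open>y\<close> is open by
    invariance of domain. Points of \<open>W\<close> near \<open>y\<close> thus have their preimages
    in that cube, and \<open>g\<close> reads off a coordinate of the preimage.\<close>
  have gcont: "continuous_on W g"
    unfolding continuous_on_def
  proof (intro ballI tendstoI)
    fix y and d :: real assume y: "y \<in> W" and d: "d > 0"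
    let ?x = "y(i := g y)"
    have op: "openin (Euclidean_space n) (?\<Phi> ` (ecube n ?x d \<inter> V))"
      by (intro oW openin_Int openin_ecube V) simp
    have "?x \<in> ecube n ?x d \<inter> V"
      using gV[OF y] openin_subset[OF V] d by (intro IntI centre_in_ecube) auto
    then have yin: "y \<in> ?\<Phi> ` (ecube n ?x d \<inter> V)"
      using gV(2)[OF y] by (intro rev_image_eqI[of ?x]) (simp_all only: fun_upd_upd fun_upd_triv)
    obtain T where T: "open T" "?\<Phi> ` (ecube n ?x d \<inter> V) = T \<inter> {x. \<forall>i\<ge>n. x i = 0}"
      using iffD1[OF openin_Euclidean_space_open op] by (elim exE conjE)
    have "dist (g z) (g y) < d" if "z \<in> T" "z \<in> W" for z
    proof -
      have "z \<in> ?\<Phi> ` (ecube n ?x d \<inter> V)"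
        using that open_in_Euclidean_space_zero[OF W] by (simp add: T(2))
      then obtain x where "x \<in> ecube n ?x d" "x \<in> V" "z = x(i := f x)" by auto
      then show ?thesis using g[of x] i by (auto simp: ecube_def dist_real_def)
    qed
    then show "\<forall>\<^sub>F z in at y within W. dist (g z) (g y) < d"
      unfolding eventually_at_topological using T yin by blast
  qed
  \<comment> \<open>The result of differentiating the identity \<open>f (y(i := g y)) = y i\<close>
    implicitly in direction \<open>j\<close>.\<close>
  define D where "D j y = inverse (partial_deriv i f (y(i := g y))) *
    (if j = i then 1 else - 1 * partial_deriv j f (y(i := g y)))" for j y
  have Dg: "((\<lambda>t. g (y(j := t))) has_real_derivative D j y) (at (y j))" if y: "y \<in> W" and j: "j < n" for j y
  proof -
    define x where "x = y(i := g y)"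
    \<comment> \<open>The defect of the identity \<open>f (y(i := g y)) = y i\<close> when
      \<open>y j\<close> is changed to \<open>t\<close> while the old value \<open>g y\<close> is
      kept. It vanishes at \<open>t = y j\<close>, and near there it equals \<open>c t\<close> times
      the increment of \<open>g\<close>; dividing by \<open>c t\<close> gives the derivative of
      \<open>g\<close>.\<close>
    define q where "q t = (y(j := t)) i - f (y(j := t, i := g y))" for t
    have x: "x \<in> V" "f x = y i" using gV[OF y] by (simp_all add: x_def)
    have evW: "\<forall>\<^sub>F t in at (y j). y(j := t) \<in> W"
      using eventually_upd_in_open[OF W y j] by (simp add: eventually_nhds_conv_at)
    have cg: "((\<lambda>t. g (y(j := t))) \<longlongrightarrow> g y) (at (y j))"
    proof (rule tendstoI)
      fix d :: real assume "d > 0"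
      have "y \<in> {z \<in> W. g z \<in> ball (g y) d}" using y \<open>d > 0\<close> by simp
      from eventually_upd_in_open[OF continuous_on_open_in_Euclidean_space[OF W gcont open_ball] this j]
      show "\<forall>\<^sub>F t in at (y j). dist (g (y(j := t))) (g y) < d"
        unfolding eventually_nhds_conv_at by (elim conjE eventually_mono) (simp add: dist_commute)
    qed
    obtain c where c: "(c \<longlongrightarrow> partial_deriv i f x) (at (y j))"
      "\<forall>\<^sub>F t in at (y j). f (y(j := t, i := g (y(j := t)))) - f (y(j := t, i := g y)) = c t * (g (y(j := t)) - g y)"
    proof (rule partial_increment[OF V fV x(1) i, where F = "at (y j)" and y = "\<lambda>t. y(j := t)"
          and u = "\<lambda>t. g (y(j := t))" and v = "\<lambda>t. g y"])
      show "((\<lambda>t. (y(j := t)) l) \<longlongrightarrow> x l) (at (y j))" if "l \<noteq> i" for l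
        using that by (cases "l = j") (auto simp: x_def)
      show "(y(j := t)) l = 0" if "n \<le> l" for l t
        using that j open_in_Euclidean_space_zero[OF W y] by simp
    qed (use cg in \<open>simp_all add: x_def\<close>)
    have q: "(q has_real_derivative (if j = i then 1 else - 1 * partial_deriv j f x)) (at (y j))"
    proof (cases "j = i")
      case True
      have "q = (\<lambda>t. t - f x)" using True by (simp add: q_def x_def fun_eq_iff)
      then show ?thesis using True by (auto intro!: derivative_eq_intros)
    next
      case False
      have q: "q = (\<lambda>t. y i - f (x(j := t)))"
        using False by (auto simp: q_def x_def fun_upd_twist)
      have "x j = y j" using False by (simp add: x_def)
      then have "((\<lambda>t. f (x(j := t))) has_real_derivative partial_deriv j f x) (at (y j))"
        using Ck_on_partial_DERIV[OF fV j x(1)] by metis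
      then show ?thesis unfolding q using False by (auto intro!: derivative_eq_intros)
    qed
    have nz: "partial_deriv i f x \<noteq> 0" by (rule nzV[OF x(1)])
    have "((\<lambda>t. g (y(j := t))) has_real_derivative
       inverse (partial_deriv i f x) * (if j = i then 1 else - 1 * partial_deriv j f x)) (at (y j))"
    proof (rule DERIV_of_increment[OF tendsto_inverse[OF c(1) nz] q])
      have q0: "q (y j) = 0" using x by (simp add: q_def flip: x_def)
      have "\<forall>\<^sub>F t in at (y j). c t \<noteq> 0"
        using tendsto_imp_eventually_ne[OF c(1) nz] .
      then show "\<forall>\<^sub>F t in at (y j). g (y(j := t)) - g (y(j := y j)) = inverse (c t) * (q t - q (y j))"
        using c(2) evW
      proof eventually_elim
        case (elim t)
        then show ?case
          using gV(2)[of "y(j := t)"] q0 by (simp add: q_def field_simps)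
      qed
    qed
    then show ?thesis by (simp only: D_def x_def)
  qed
  \<comment> \<open>Bootstrapping: \<open>D\<close> contains \<open>g\<close> itself but no
    derivative of \<open>g\<close>, so class \<open>k\<close> of \<open>g\<close> gives class
    \<open>k\<close> of its derivatives.\<close>
  have "Ck_on n k W g" for k
  proof (induction k)
    case 0
    then show ?case using gcont by simp
  next
    case (Suc k)
    have comp: "Ck_on n k W (\<lambda>y. h (y(i := g y)))" if "Ck_on n k V h" for h
      by (rule Ck_on_upd_compose[OF W V i gV(1) that Suc.IH])
    show ?case
    proof (rule Ck_on_SucI[OF W gcont Dg])
      show "Ck_on n k W (D j)" if "j < n" for j
        unfolding D_def
      proof (rule Ck_on_mult[OF W])
        show "Ck_on n k W (\<lambda>y. inverse (partial_deriv i f (y(i := g y))))"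
          by (rule Ck_on_inverse[OF W nzV[OF gV(1)] comp[OF Ck_on_partial[OF fV i]]])
        show "Ck_on n k W (\<lambda>y. if j = i then 1 else - 1 * partial_deriv j f (y(i := g y)))"
        proof (cases "j = i")
          case False
          show ?thesis
            unfolding if_not_P[OF False]
            by (rule Ck_on_mult[OF W Ck_on_const comp[OF Ck_on_partial[OF fV that]]])
        qed (simp add: Ck_on_const)
      qed
    qed
  qed
  then have "smooth_on n W g" by (simp add: smooth_on_def)
  then show ?thesis
    using that[OF V aV VS inj _ _ g] W by (simp add: W_def)
qed

section \<open>Smooth functions and charts\<close>

lemma smooth_on_subset: "smooth_on n S f \<Longrightarrow> T \<subseteq> S \<Longrightarrow> smooth_on n T f"
  unfolding smooth_on_def using Ck_on_subset by blast

lemma smooth_on_cong: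
  assumes "openin (Euclidean_space n) S" "\<And>x. x \<in> S \<Longrightarrow> f x = g x"
  shows "smooth_on n S f \<longleftrightarrow> smooth_on n S g"
  unfolding smooth_on_def using Ck_on_cong[OF assms(1), of f g] assms(2) by simp

lemma smooth_on_compose:
  assumes "openin (Euclidean_space n) S" "openin (Euclidean_space m) T"
    and "\<And>x. x \<in> S \<Longrightarrow> G x \<in> T" "smooth_on m T f"
    and "\<And>i. i < m \<Longrightarrow> smooth_on n S (\<lambda>x. G x i)"
  shows "smooth_on n S (\<lambda>x. f (G x))"
  using assms unfolding smooth_on_def by (auto intro: Ck_on_compose[of n S m T G])

lemma smooth_on_add:
  "openin (Euclidean_space n) S \<Longrightarrow> smooth_on n S f \<Longrightarrow> smooth_on n S g \<Longrightarrow> smooth_on n S (\<lambda>x. f x + g x)"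
  unfolding smooth_on_def using Ck_on_add by blast

lemma smooth_on_mult:
  "openin (Euclidean_space n) S \<Longrightarrow> smooth_on n S f \<Longrightarrow> smooth_on n S g \<Longrightarrow> smooth_on n S (\<lambda>x. f x * g x)"
  unfolding smooth_on_def using Ck_on_mult by blast

lemma smooth_on_inverse:
  "openin (Euclidean_space n) S \<Longrightarrow> smooth_on n S f \<Longrightarrow> (\<And>x. x \<in> S \<Longrightarrow> f x \<noteq> 0) \<Longrightarrow> smooth_on n S (\<lambda>x. inverse (f x))"
  unfolding smooth_on_def using Ck_on_inverse by blast

lemma smooth_on_const: "smooth_on n S (\<lambda>x. c)"
  unfolding smooth_on_def using Ck_on_const by blast

lemma smooth_on_coord: "openin (Euclidean_space n) S \<Longrightarrow> smooth_on n S (\<lambda>x. x i)"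
  unfolding smooth_on_def using Ck_on_coord by blast

lemma smooth_on_partial: "smooth_on n S f \<Longrightarrow> i < n \<Longrightarrow> smooth_on n S (partial_deriv i f)"
  unfolding smooth_on_def using Ck_on_partial by blast

lemma smooth_on_continuous: "smooth_on n S f \<Longrightarrow> continuous_on S f"
  using smooth_onD Ck_continuous by blast

lemma continuous_map_Euclidean_space_smooth:
  assumes S: "openin (Euclidean_space n) S" and G: "\<And>x. x \<in> S \<Longrightarrow> G x \<in> topspace (Euclidean_space m)"
    and sm: "\<And>i. i < m \<Longrightarrow> smooth_on n S (\<lambda>x. G x i)"
  shows "continuous_map (subtopology (Euclidean_space n) S) (Euclidean_space m) G"
proof -
  have "continuous_on S (\<lambda>x. G x i)" for i
  proof (cases "i < m")
    case False
    then show ?thesis using G by (simp add: topspace_Euclidean_space cong: continuous_on_cong)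
  qed (use sm smooth_on_continuous in blast)
  then have "continuous_on S G"
    by (rule continuous_on_coordinatewise_then_product)
  then show ?thesis
    using G openin_subset[OF S] by (auto simp: cm_Euclidean_space_iff_continuous_on Int_absorb1)
qed

section \<open>Charts and smooth functions of a fixed manifold\<close>

locale smooth_mfd =
  fixes M :: "'m manifold"
  assumes M: "smooth_manifold M"
begin

lemma smooth_manifoldD:
  shows "\<forall>c\<in>matlas M. is_chart (mdim M) (mtop M) c"
    and "\<forall>p\<in>mcarrier M. \<exists>c\<in>matlas M. p \<in> fst c"
    and "\<forall>c\<in>matlas M. \<forall>d\<in>matlas M. smooth_transition (mdim M) c d"
    and "is_chart (mdim M) (mtop M) c \<Longrightarrow>
      (\<And>d. d \<in> matlas M \<Longrightarrow> smooth_transition (mdim M) c d \<and> smooth_transition (mdim M) d c) \<Longrightarrow> c \<in> matlas M"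
proof -
  note * = M[unfolded smooth_manifold_def]
  show "\<forall>c\<in>matlas M. is_chart (mdim M) (mtop M) c"
    using * by (elim conjE)
  show "\<forall>p\<in>mcarrier M. \<exists>c\<in>matlas M. p \<in> fst c"
    using * by (elim conjE)
  show "\<forall>c\<in>matlas M. \<forall>d\<in>matlas M. smooth_transition (mdim M) c d"
    using * by (elim conjE)
  show "c \<in> matlas M" if "is_chart (mdim M) (mtop M) c"
    "\<And>d. d \<in> matlas M \<Longrightarrow> smooth_transition (mdim M) c d \<and> smooth_transition (mdim M) d c"
    using *[THEN conjunct2, THEN conjunct2, THEN conjunct2, THEN conjunct2, THEN conjunct2, THEN spec, THEN mp] that
    by blast
qed

lemma chart_is_chart: "(U, \<phi>) \<in> matlas M \<Longrightarrow> is_chart (mdim M) (mtop M) (U, \<phi>)"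
  using smooth_manifoldD(1) by (rule bspec)

lemma chart_open: "(U, \<phi>) \<in> matlas M \<Longrightarrow> openin (mtop M) U"
  using chart_is_chart by (auto simp: is_chart_def)

lemma chart_subset: "(U, \<phi>) \<in> matlas M \<Longrightarrow> U \<subseteq> mcarrier M"
  using chart_open openin_subset by blast

lemma chart_image_open: "(U, \<phi>) \<in> matlas M \<Longrightarrow> openin (Euclidean_space (mdim M)) (\<phi> ` U)"
  using chart_is_chart by (auto simp: is_chart_def)

lemma chart_homeomorphic:
  "(U, \<phi>) \<in> matlas M \<Longrightarrow>
    homeomorphic_map (subtopology (mtop M) U) (subtopology (Euclidean_space (mdim M)) (\<phi> ` U)) \<phi>"
  using chart_is_chart by (auto simp: is_chart_def)

lemma chart_inj:
  assumes "(U, \<phi>) \<in> matlas M" shows "inj_on \<phi> U"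
  using homeomorphic_imp_injective_map[OF chart_homeomorphic[OF assms]] chart_subset[OF assms]
  by (simp add: Int_absorb1)

lemma chart_inv: "(U, \<phi>) \<in> matlas M \<Longrightarrow> p \<in> U \<Longrightarrow> inv_into U \<phi> (\<phi> p) = p"
  using chart_inj inv_into_f_f by metis

lemma chart_range: "(U, \<phi>) \<in> matlas M \<Longrightarrow> p \<in> U \<Longrightarrow> \<phi> p \<in> topspace (Euclidean_space (mdim M))"
  using chart_image_open openin_subset by blast

lemma chart_image_subset_open:
  assumes "(U, \<phi>) \<in> matlas M" "openin (mtop M) W" "W \<subseteq> U"
  shows "openin (Euclidean_space (mdim M)) (\<phi> ` W)"
proof -
  have "openin (subtopology (mtop M) U) W"
    using assms chart_open[OF assms(1)] by (simp add: openin_open_subtopology)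
  then have "openin (subtopology (Euclidean_space (mdim M)) (\<phi> ` U)) (\<phi> ` W)"
    using homeomorphic_imp_open_map[OF chart_homeomorphic[OF assms(1)]] by (simp add: open_map_def)
  then show ?thesis
    using chart_image_open[OF assms(1)] by (simp add: openin_open_subtopology)
qed

lemma chart_vimage_open:
  assumes "(U, \<phi>) \<in> matlas M" "openin (Euclidean_space (mdim M)) T"
  shows "openin (mtop M) {p \<in> U. \<phi> p \<in> T}"
proof -
  have "continuous_map (subtopology (mtop M) U) (Euclidean_space (mdim M)) \<phi>"
    using homeomorphic_imp_continuous_map[OF chart_homeomorphic[OF assms(1)]]
    by (simp add: continuous_map_in_subtopology)
  from openin_continuous_map_preimage[OF this assms(2)] chart_subset[OF assms(1)]
  have "openin (subtopology (mtop M) U) {p \<in> U. \<phi> p \<in> T}"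
    by (simp add: Int_absorb1)
  then show ?thesis
    using chart_open[OF assms(1)] by (simp add: openin_open_subtopology)
qed

lemma chart_transition_smooth:
  assumes "(U, \<phi>) \<in> matlas M" "(V, \<psi>) \<in> matlas M" "i < mdim M"
  shows "smooth_on (mdim M) (\<phi> ` (U \<inter> V)) (\<lambda>x. \<psi> (inv_into U \<phi> x) i)"
proof -
  have "smooth_transition (mdim M) (U, \<phi>) (V, \<psi>)"
    using smooth_manifoldD(3) assms(1,2) by (metis bspec)
  then show ?thesis using assms(3) by (simp add: smooth_transition_def)
qed

lemma smooth_fun_open: "smooth_fun M W f \<Longrightarrow> openin (mtop M) W"
  by (simp add: smooth_fun_def)

lemma smooth_fun_chartD:
  assumes "smooth_fun M W f" "(U, \<phi>) \<in> matlas M" "W \<subseteq> U"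
  shows "smooth_on (mdim M) (\<phi> ` W) (f \<circ> inv_into U \<phi>)"
proof -
  have "smooth_on (mdim M) (\<phi> ` (W \<inter> U)) (f \<circ> inv_into U \<phi>)"
    using assms by (auto simp: smooth_fun_def)
  then show ?thesis using assms(3) by (simp add: Int_absorb2)
qed

lemma smooth_fun_subset:
  assumes "smooth_fun M W f" "openin (mtop M) W'" "W' \<subseteq> W"
  shows "smooth_fun M W' f"
  unfolding smooth_fun_def
proof (intro conjI assms(2) ballI, clarify)
  fix V \<psi> assume "(V, \<psi>) \<in> matlas M"
  then have "smooth_on (mdim M) (\<psi> ` (W \<inter> V)) (f \<circ> inv_into V \<psi>)"
    using assms(1) by (auto simp: smooth_fun_def)
  then show "smooth_on (mdim M) (\<psi> ` (W' \<inter> V)) (f \<circ> inv_into V \<psi>)"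
    by (rule smooth_on_subset) (use assms(3) in auto)
qed

lemma chart_cap_open:
  "(U, \<phi>) \<in> matlas M \<Longrightarrow> openin (mtop M) W \<Longrightarrow> openin (Euclidean_space (mdim M)) (\<phi> ` (W \<inter> U))"
  by (rule chart_image_subset_open) (auto dest: chart_open)

lemma smooth_fun_compose:
  assumes W: "openin (mtop M) W" and T: "openin (Euclidean_space m) T" and F: "smooth_on m T F"
    and g: "\<And>i. i < m \<Longrightarrow> smooth_fun M W (\<lambda>p. G p i)" and G: "\<And>p. p \<in> W \<Longrightarrow> G p \<in> T"
  shows "smooth_fun M W (\<lambda>p. F (G p))"
  unfolding smooth_fun_def
proof (intro conjI W ballI, clarify)
  fix V \<psi> assume V: "(V, \<psi>) \<in> matlas M"
  have "smooth_on (mdim M) (\<psi> ` (W \<inter> V)) (\<lambda>x. F (G (inv_into V \<psi> x)))"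
  proof (rule smooth_on_compose[OF chart_cap_open[OF V W] T _ F])
    show "G (inv_into V \<psi> x) \<in> T" if "x \<in> \<psi> ` (W \<inter> V)" for x
      using that G chart_inv[OF V] by auto
    show "smooth_on (mdim M) (\<psi> ` (W \<inter> V)) (\<lambda>x. G (inv_into V \<psi> x) i)" if "i < m" for i
      using g[OF that] V by (auto simp: smooth_fun_def o_def)
  qed
  then show "smooth_on (mdim M) (\<psi> ` (W \<inter> V)) ((\<lambda>p. F (G p)) \<circ> inv_into V \<psi>)"
    by (simp add: o_def)
qed

lemma smooth_fun_cong:
  assumes "\<And>p. p \<in> W \<Longrightarrow> f p = g p"
  shows "smooth_fun M W f \<longleftrightarrow> smooth_fun M W g"
proof -
  have "smooth_on (mdim M) (\<psi> ` (W \<inter> V)) (f \<circ> inv_into V \<psi>) \<longleftrightarrow> smooth_on (mdim M) (\<psi> ` (W \<inter> V)) (g \<circ> inv_into V \<psi>)"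
    if V: "(V, \<psi>) \<in> matlas M" and W: "openin (mtop M) W" for V \<psi>
    by (rule smooth_on_cong[OF chart_cap_open[OF V W]]) (use assms chart_inv[OF V] in auto)
  then show ?thesis
    unfolding smooth_fun_def by (auto; blast)
qed

lemma smooth_fun_const: "openin (mtop M) W \<Longrightarrow> smooth_fun M W (\<lambda>p. c)"
  by (auto simp: smooth_fun_def o_def smooth_on_const)

lemma smooth_fun_add: "smooth_fun M W f \<Longrightarrow> smooth_fun M W g \<Longrightarrow> smooth_fun M W (\<lambda>p. f p + g p)"
  unfolding smooth_fun_def by (auto simp: o_def intro!: smooth_on_add chart_cap_open)

lemma smooth_fun_mult: "smooth_fun M W f \<Longrightarrow> smooth_fun M W g \<Longrightarrow> smooth_fun M W (\<lambda>p. f p * g p)"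
  unfolding smooth_fun_def by (auto simp: o_def intro!: smooth_on_mult chart_cap_open)

lemma smooth_fun_sum:
  assumes "openin (mtop M) W"
  shows "(\<And>i. i \<in> I \<Longrightarrow> smooth_fun M W (f i)) \<Longrightarrow> smooth_fun M W (\<lambda>p. \<Sum>i\<in>I. f i p)"
  by (induction I rule: infinite_finite_induct) (auto intro: smooth_fun_add smooth_fun_const[OF assms])

lemma smooth_fun_inverse:
  "smooth_fun M W f \<Longrightarrow> (\<And>p. p \<in> W \<Longrightarrow> f p \<noteq> 0) \<Longrightarrow> smooth_fun M W (\<lambda>p. inverse (f p))"
  unfolding smooth_fun_def
  by (auto simp: o_def chart_inv intro!: smooth_on_inverse chart_cap_open)

lemma smooth_fun_coord:
  assumes U: "(U, \<phi>) \<in> matlas M"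
  shows "smooth_fun M U (\<lambda>p. \<phi> p i)"
proof (cases "i < mdim M")
  case True
  then show ?thesis
    using chart_transition_smooth[OF _ U] chart_open[OF U]
    by (auto simp: smooth_fun_def o_def Int_commute)
next
  case False
  then have "\<phi> p i = 0" if "p \<in> U" for p
    using chart_range[OF U that] by (simp add: topspace_Euclidean_space)
  then show ?thesis
    using smooth_fun_cong[of U "\<lambda>p. \<phi> p i" "\<lambda>p. 0"] smooth_fun_const[OF chart_open[OF U]] by simp
qed

lemma smooth_fun_chartI:
  assumes U: "(U, \<phi>) \<in> matlas M" and W: "openin (mtop M) W" "W \<subseteq> U"
    and T: "openin (Euclidean_space (mdim M)) T" "smooth_on (mdim M) T F" "\<phi> ` W \<subseteq> T"
  shows "smooth_fun M W (\<lambda>p. F (\<phi> p))"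
  using smooth_fun_compose[OF W(1) T(1,2), of \<phi>] smooth_fun_subset[OF smooth_fun_coord[OF U] W] T(3)
  by blast

text \<open>A single chart need not cover \<open>W\<close>, so openness is proved near each point,
  inside a chart around it.\<close>

lemma smooth_fun_continuous_open:
  assumes f: "smooth_fun M W f" and T: "open T"
  shows "openin (mtop M) {p \<in> W. f p \<in> T}"
proof (subst openin_subopen, intro ballI)
  fix p assume p: "p \<in> {p \<in> W. f p \<in> T}"
  then have "p \<in> mcarrier M" using openin_subset[OF smooth_fun_open[OF f]] by auto
  then obtain V \<psi> where V: "(V, \<psi>) \<in> matlas M" "p \<in> V"
    using smooth_manifoldD(2) by (metis bspec prod.collapse)
  have W: "openin (mtop M) W" by (rule smooth_fun_open[OF f])
  let ?S = "\<psi> ` (W \<inter> V)"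
  have "openin (Euclidean_space (mdim M)) {x \<in> ?S. (f \<circ> inv_into V \<psi>) x \<in> T}"
  proof (rule continuous_on_open_in_Euclidean_space[OF chart_cap_open[OF V(1) W] _ T])
    have "smooth_on (mdim M) ?S (f \<circ> inv_into V \<psi>)"
      using f V(1) by (auto simp: smooth_fun_def)
    then show "continuous_on ?S (f \<circ> inv_into V \<psi>)"
      by (rule smooth_on_continuous)
  qed
  from chart_vimage_open[OF V(1) this]
  have "openin (mtop M) {q \<in> V. \<psi> q \<in> {x \<in> ?S. (f \<circ> inv_into V \<psi>) x \<in> T}}" .
  moreover have "{q \<in> V. \<psi> q \<in> {x \<in> ?S. (f \<circ> inv_into V \<psi>) x \<in> T}} = {q \<in> W \<inter> V. f q \<in> T}"
    using chart_inv[OF V(1)] by (auto; metis)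
  ultimately have "openin (mtop M) {q \<in> W \<inter> V. f q \<in> T}" by simp
  then show "\<exists>A. openin (mtop M) A \<and> p \<in> A \<and> A \<subseteq> {p \<in> W. f p \<in> T}"
    using p V(2) by blast
qed

text \<open>Maximality of the atlas: the composite is a homeomorphism onto an open set and has
  smooth transitions in both directions with every chart, so it belongs to the atlas. The inverse
  \<open>\<Psi>\<close> is given explicitly, so its smoothness is a hypothesis and not a consequence
  of an inverse function theorem.\<close>

lemma chart_compose:
  assumes U: "(U, \<phi>) \<in> matlas M" and S: "openin (Euclidean_space (mdim M)) S" "S \<subseteq> \<phi> ` U"
    and \<Phi>: "\<And>i. i < mdim M \<Longrightarrow> smooth_on (mdim M) S (\<lambda>x. \<Phi> x i)"
    and \<Phi>S: "openin (Euclidean_space (mdim M)) (\<Phi> ` S)"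
    and \<Psi>: "\<And>i. i < mdim M \<Longrightarrow> smooth_on (mdim M) (\<Phi> ` S) (\<lambda>x. \<Psi> x i)"
    and \<Psi>\<Phi>: "\<And>x. x \<in> S \<Longrightarrow> \<Psi> (\<Phi> x) = x"
  shows "({p \<in> U. \<phi> p \<in> S}, \<lambda>p. \<Phi> (\<phi> p)) \<in> matlas M"
proof -
  let ?n = "mdim M" and ?O = "{p \<in> U. \<phi> p \<in> S}"
  let ?E = "Euclidean_space (mdim M)"
  have O: "openin (mtop M) ?O" by (rule chart_vimage_open[OF U S(1)])
  have im: "\<phi> ` ?O = S" using S(2) by auto
  have im': "(\<lambda>p. \<Phi> (\<phi> p)) ` ?O = \<Phi> ` S" using im by (simp add: image_image[symmetric])
  have inv: "inv_into ?O (\<lambda>p. \<Phi> (\<phi> p)) (\<Phi> (\<phi> p)) = p" if "p \<in> ?O" for p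
  proof (rule inv_into_f_f[OF _ that])
    show "inj_on (\<lambda>p. \<Phi> (\<phi> p)) ?O"
      using \<Psi>\<Phi> chart_inj[OF U] by (auto simp: inj_on_def) metis
  qed
  have "homeomorphic_map (subtopology (mtop M) ?O) (subtopology ?E S) \<phi>"
  proof -
    have "homeomorphic_map (subtopology (subtopology (mtop M) U) ?O) (subtopology (subtopology ?E (\<phi> ` U)) S) \<phi>"
      by (rule homeomorphic_map_subtopologies[OF chart_homeomorphic[OF U]])
        (use im S(2) chart_subset[OF U] openin_subset[OF chart_image_open[OF U]] in auto)
    then show ?thesis
      using S(2) by (simp add: subtopology_subtopology Int_absorb1 subset_iff Int_def conj_commute cong: conj_cong)
  qed
  moreover have contPsi: "continuous_map (subtopology ?E (\<Phi> ` S)) ?E \<Psi>"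
    by (rule continuous_map_Euclidean_space_smooth[OF \<Phi>S _ \<Psi>]) (use openin_subset[OF S(1)] \<Psi>\<Phi> in auto)
  moreover have "homeomorphic_maps (subtopology ?E S) (subtopology ?E (\<Phi> ` S)) \<Phi> \<Psi>"
    unfolding homeomorphic_maps_def
  proof (intro conjI ballI)
    show "continuous_map (subtopology ?E S) (subtopology ?E (\<Phi> ` S)) \<Phi>"
      unfolding continuous_map_in_subtopology
      using continuous_map_Euclidean_space_smooth[OF S(1), of \<Phi> "mdim M"] \<Phi> openin_subset[OF \<Phi>S] by auto
    show "continuous_map (subtopology ?E (\<Phi> ` S)) (subtopology ?E S) \<Psi>"
      unfolding continuous_map_in_subtopology
      using contPsi \<Psi>\<Phi> by auto
  qed (use \<Psi>\<Phi> in auto)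
  ultimately have "homeomorphic_map (subtopology (mtop M) ?O) (subtopology ?E (\<Phi> ` S)) (\<Phi> \<circ> \<phi>)"
    using homeomorphic_map_compose homeomorphic_maps_map by blast
  then have chart: "is_chart ?n (mtop M) (?O, \<lambda>p. \<Phi> (\<phi> p))"
    using O \<Phi>S by (simp add: is_chart_def im' o_def del: mem_Collect_eq)
  \<comment> \<open>This transition map is \<open>\<Psi>\<close> followed by the transition from the
    old chart.\<close>
  have to: "smooth_transition ?n (?O, \<lambda>p. \<Phi> (\<phi> p)) (V, \<psi>)" if V: "(V, \<psi>) \<in> matlas M" for V \<psi>
    unfolding smooth_transition_def split_conv
  proof (intro allI impI)
    fix i assume i: "i < ?n"
    let ?A = "(\<lambda>p. \<Phi> (\<phi> p)) ` (?O \<inter> V)"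
    have A: "?A = \<Phi> ` (\<phi> ` (?O \<inter> V))" by (simp add: image_image)
    have oB: "openin ?E (\<phi> ` (?O \<inter> V))"
      by (rule chart_image_subset_open[OF U]) (use O chart_open[OF V] in auto)
    have BS: "\<phi> ` (?O \<inter> V) \<subseteq> S" by auto
    have "{y \<in> \<Phi> ` S. \<Psi> y \<in> \<phi> ` (?O \<inter> V)} = ?A"
      using \<Psi>\<Phi> BS unfolding A by force
    moreover have "openin (subtopology ?E (\<Phi> ` S)) {y \<in> \<Phi> ` S. \<Psi> y \<in> \<phi> ` (?O \<inter> V)}"
      using openin_continuous_map_preimage[OF contPsi oB] openin_subset[OF \<Phi>S] by (simp add: Int_absorb1)
    ultimately have oA: "openin ?E ?A"
      using \<Phi>S by (simp add: openin_open_subtopology)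
    have "smooth_on ?n ?A (\<lambda>x. \<psi> (inv_into U \<phi> (\<Psi> x)) i)"
    proof (rule smooth_on_compose[OF oA oB, where f = "\<lambda>x. \<psi> (inv_into U \<phi> x) i" and G = \<Psi>])
      show "\<Psi> x \<in> \<phi> ` (?O \<inter> V)" if "x \<in> ?A" for x using that \<Psi>\<Phi> by auto
      show "smooth_on ?n (\<phi> ` (?O \<inter> V)) (\<lambda>x. \<psi> (inv_into U \<phi> x) i)"
        by (rule smooth_on_subset[OF chart_transition_smooth[OF U V i]]) auto
      show "smooth_on ?n ?A (\<lambda>x. \<Psi> x j)" if "j < ?n" for j
        by (rule smooth_on_subset[OF \<Psi>[OF that]]) auto
    qed
    then show "smooth_on ?n ?A (\<lambda>x. \<psi> (inv_into ?O (\<lambda>p. \<Phi> (\<phi> p)) x) i)"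
      by (subst smooth_on_cong[OF oA]) (use inv \<Psi>\<Phi> chart_inv[OF U] in auto)
  qed
  \<comment> \<open>In this direction it suffices that the new coordinates are smooth functions on
    the manifold.\<close>
  have "smooth_transition ?n (V, \<psi>) (?O, \<lambda>p. \<Phi> (\<phi> p))" if V: "(V, \<psi>) \<in> matlas M" for V \<psi>
    unfolding smooth_transition_def split_conv
  proof (intro allI impI)
    fix i assume i: "i < ?n"
    have "smooth_fun M ?O (\<lambda>p. \<Phi> (\<phi> p) i)"
      by (rule smooth_fun_chartI[OF U O _ S(1) \<Phi>[OF i]]) auto
    then show "smooth_on ?n (\<psi> ` (V \<inter> ?O)) (\<lambda>x. \<Phi> (\<phi> (inv_into V \<psi> x)) i)"
      using V by (auto simp: smooth_fun_def o_def Int_commute)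
  qed
  note from_atlas = this
  show ?thesis
  proof (rule smooth_manifoldD(4)[OF chart])
    fix d assume "d \<in> matlas M"
    moreover obtain V \<psi> where "d = (V, \<psi>)" by (cases d)
    ultimately show "smooth_transition ?n (?O, \<lambda>p. \<Phi> (\<phi> p)) d \<and> smooth_transition ?n d (?O, \<lambda>p. \<Phi> (\<phi> p))"
      using to[of V \<psi>] from_atlas[of V \<psi>] by simp
  qed
qed

text \<open>The case of the identity map on the smaller coordinate image.\<close>

lemma chart_restrict:
  assumes U: "(U, \<phi>) \<in> matlas M" and W: "openin (mtop M) W" "W \<subseteq> U"
  shows "(W, \<phi>) \<in> matlas M"
proof -
  have S: "openin (Euclidean_space (mdim M)) (\<phi> ` W)"
    by (rule chart_image_subset_open[OF U W])
  have "{p \<in> U. \<phi> p \<in> \<phi> ` W} = W"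
    using chart_inj[OF U] W(2) by (auto simp: inj_on_def)
  then show ?thesis
    using chart_compose[OF U S, of "\<lambda>x. x" "\<lambda>x. x"] S smooth_on_coord[OF S] W(2) by (auto simp: image_mono)
qed

end

section \<open>Tangent and cotangent vectors in coordinates\<close>

context smooth_mfd
begin

section \<open>Germs of smooth functions\<close>

lemma smooth_nearI: "smooth_fun M W f \<Longrightarrow> p \<in> W \<Longrightarrow> smooth_near M p f"
  by (auto simp: smooth_near_def)

lemma smooth_near_carrier: "smooth_near M p f \<Longrightarrow> p \<in> mcarrier M"
  unfolding smooth_near_def using smooth_fun_open openin_subset by blast

lemma smooth_near_const: "p \<in> mcarrier M \<Longrightarrow> smooth_near M p (\<lambda>q. c)"
  using smooth_nearI[OF smooth_fun_const] openin_topspace by blast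

lemma smooth_near_common:
  assumes "smooth_near M p f" "smooth_near M p g"
  obtains W where "p \<in> W" "smooth_fun M W f" "smooth_fun M W g"
proof -
  obtain V W where "p \<in> V" "smooth_fun M V f" "p \<in> W" "smooth_fun M W g"
    using assms by (auto simp: smooth_near_def)
  then show ?thesis
    using that[of "V \<inter> W"] smooth_fun_subset[of V f "V \<inter> W"] smooth_fun_subset[of W g "V \<inter> W"] smooth_fun_open
    by (simp add: openin_Int)
qed

lemma smooth_near_add: "smooth_near M p f \<Longrightarrow> smooth_near M p g \<Longrightarrow> smooth_near M p (\<lambda>q. f q + g q)"
  by (metis smooth_near_common smooth_fun_add smooth_nearI)

lemma smooth_near_mult: "smooth_near M p f \<Longrightarrow> smooth_near M p g \<Longrightarrow> smooth_near M p (\<lambda>q. f q * g q)"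
  by (metis smooth_near_common smooth_fun_mult smooth_nearI)

lemma smooth_near_coord: "(U, \<phi>) \<in> matlas M \<Longrightarrow> p \<in> U \<Longrightarrow> smooth_near M p (\<lambda>q. \<phi> q i)"
  by (metis smooth_fun_coord smooth_nearI)

lemma smooth_near_cong:
  assumes f: "smooth_near M p f" and W: "openin (mtop M) W" "p \<in> W" and fg: "\<And>q. q \<in> W \<Longrightarrow> f q = g q"
  shows "smooth_near M p g"
proof -
  obtain V where "p \<in> V" "smooth_fun M V f"
    using f by (auto simp: smooth_near_def)
  then have "smooth_fun M (V \<inter> W) f" "p \<in> V \<inter> W"
    using W smooth_fun_subset[of V f "V \<inter> W"] smooth_fun_open by (auto simp: openin_Int)
  then show ?thesis
    using smooth_fun_cong[of "V \<inter> W" f g] fg by (auto intro: smooth_nearI)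
qed

section \<open>Derivations and their coordinates\<close>

lemma tangent_not_near: "v \<in> tangent_space M p \<Longrightarrow> \<not> smooth_near M p f \<Longrightarrow> v f = 0"
  by (simp add: tangent_space_def)

lemma tangent_linear:
  "v \<in> tangent_space M p \<Longrightarrow> smooth_near M p f \<Longrightarrow> smooth_near M p g \<Longrightarrow>
    v (\<lambda>q. a * f q + b * g q) = a * v f + b * v g"
  by (simp add: tangent_space_def)

lemma tangent_leibniz:
  "v \<in> tangent_space M p \<Longrightarrow> smooth_near M p f \<Longrightarrow> smooth_near M p g \<Longrightarrow>
    v (\<lambda>q. f q * g q) = f p * v g + g p * v f"
  by (simp add: tangent_space_def)

lemma tangent_add:
  "v \<in> tangent_space M p \<Longrightarrow> smooth_near M p f \<Longrightarrow> smooth_near M p g \<Longrightarrow>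
    v (\<lambda>q. f q + g q) = v f + v g"
  using tangent_linear[of v p f g 1 1] by simp

text \<open>The Leibniz rule for 1 = 1 * 1 gives v(1) = 2 v(1). Outside the carrier no function is
  smooth near \<open>p\<close>, so \<open>v\<close> vanishes identically.\<close>

lemma tangent_const:
  assumes v: "v \<in> tangent_space M p" shows "v (\<lambda>q. c) = 0"
proof (cases "p \<in> mcarrier M")
  case True
  have "v (\<lambda>q. 1 * 1) = 1 * v (\<lambda>q. 1) + 1 * v (\<lambda>q. 1)"
    by (rule tangent_leibniz[OF v]) (use smooth_near_const[OF True] in auto)
  then have "v (\<lambda>q. 1) = 0" by simp
  then show ?thesis
    using tangent_linear[OF v, of "\<lambda>q. 1" "\<lambda>q. 1" c 0] smooth_near_const[OF True] by simp
next
  case False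
  then show ?thesis using tangent_not_near[OF v] smooth_near_carrier by blast
qed

text \<open>Multiplying by the indicator function of the neighbourhood, which is smooth near \<open>p\<close>,
  makes bump functions unnecessary.\<close>

lemma tangent_local:
  assumes v: "v \<in> tangent_space M p" and f: "smooth_near M p f"
    and W: "openin (mtop M) W" "p \<in> W" and fg: "\<And>q. q \<in> W \<Longrightarrow> f q = g q"
  shows "v f = v g"
proof -
  have g: "smooth_near M p g" by (rule smooth_near_cong[OF f W fg])
  have pM: "p \<in> mcarrier M" using f by (rule smooth_near_carrier)
  define u where "u q = (if q \<in> W then 1 else 0 :: real)" for q
  have u: "smooth_near M p u"
    by (rule smooth_near_cong[OF smooth_near_const[OF pM, of 1] W]) (simp add: u_def)
  define h where "h q = 1 * f q + (- 1) * g q" for q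
  have h: "smooth_near M p h"
    unfolding h_def by (intro smooth_near_add smooth_near_mult f g smooth_near_const[OF pM])
  have "(\<lambda>q. u q * h q) = (\<lambda>q. 0)" by (auto simp: u_def h_def fg)
  then have "u p * v h + h p * v u = 0"
    using tangent_leibniz[OF v u h] tangent_const[OF v, of 0] by simp
  then have "v h = 0" using W fg by (simp add: u_def h_def)
  then show ?thesis
    using tangent_linear[OF v f g, of 1 "- 1"] by (simp add: h_def[abs_def])
qed

lemma smooth_near_chart_compose:
  assumes U: "(U, \<phi>) \<in> matlas M" and p: "p \<in> U"
    and T: "openin (Euclidean_space (mdim M)) T" "smooth_on (mdim M) T F" "\<phi> p \<in> T"
  shows "smooth_near M p (\<lambda>q. F (\<phi> q))"
proof -
  have "smooth_fun M {q \<in> U. \<phi> q \<in> T} (\<lambda>q. F (\<phi> q))"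
    by (rule smooth_fun_chartI[OF U chart_vimage_open[OF U T(1)] _ T(1,2)]) auto
  then show ?thesis using p T(3) by (auto intro: smooth_nearI)
qed

text \<open>The coordinates of the argument are frozen at those of \<open>p\<close> one at a time.
  Hadamard's lemma writes each change as (x_m - a_m) G, on which a derivation only sees G(a), the
  partial derivative; what remains in the end is a constant.\<close>

lemma tangent_coordinates:
  assumes U: "(U, \<phi>) \<in> matlas M" and p: "p \<in> U" and v: "v \<in> tangent_space M p" and f: "smooth_near M p f"
  shows "v f = (\<Sum>i<mdim M. v (\<lambda>q. \<phi> q i) * partial_deriv i (f \<circ> inv_into U \<phi>) (\<phi> p))"
proof -
  let ?n = "mdim M" and ?a = "\<phi> p" and ?F = "f \<circ> inv_into U \<phi>"
  obtain W where W: "p \<in> W" "smooth_fun M W f" using f by (auto simp: smooth_near_def)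
  then have oW: "openin (mtop M) (W \<inter> U)" and WU: "smooth_fun M (W \<inter> U) f"
    using smooth_fun_open[OF W(2)] chart_open[OF U] smooth_fun_subset[OF W(2), of "W \<inter> U"] by (auto simp: openin_Int)
  obtain e where e: "e > 0" "ecube ?n ?a e \<subseteq> \<phi> ` (W \<inter> U)"
    using open_contains_ecube[OF chart_image_subset_open[OF U oW], of ?a] W(1) p by auto
  let ?C = "ecube ?n ?a e"
  have aC: "?a \<in> ?C" by (rule centre_in_ecube[OF chart_range[OF U p] e(1)])
  have FC: "smooth_on ?n ?C ?F"
    by (rule smooth_on_subset[OF smooth_fun_chartD[OF WU U] e(2)]) auto
  have oC: "openin (mtop M) {q \<in> U. \<phi> q \<in> ?C}" by (rule chart_vimage_open[OF U openin_ecube])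
  have pC: "p \<in> {q \<in> U. \<phi> q \<in> ?C}" using p aC by simp
  \<comment> \<open>\<open>R m\<close> freezes the first \<open>m\<close> coordinates at those of
    \<open>p\<close>.\<close>
  define R where "R m x = (\<lambda>i. if i < m then ?a i else x i)" for m and x :: "nat \<Rightarrow> real"
  define Fm where "Fm m x = ?F (R m x)" for m x
  have RS: "R (Suc m) x = R m (x(m := ?a m))" for m x by (auto simp: R_def)
  have Fm: "smooth_on ?n ?C (Fm m)" if "m \<le> ?n" for m
    using that
  proof (induction m)
    case 0
    have "Fm 0 = ?F" by (simp add: Fm_def R_def fun_eq_iff)
    then show ?case using FC by (simp only:)
  next
    case (Suc m)
    have "Ck_on ?n k ?C (\<lambda>x. Fm m (x(m := ?a m)))" for k
    proof (rule Ck_on_upd_compose[OF openin_ecube openin_ecube])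
      show "m < ?n" using Suc.prems by simp
      show "x(m := ?a m) \<in> ?C" if "x \<in> ?C" for x
        using that e(1) Suc.prems by (auto simp: ecube_def)
      show "Ck_on ?n k ?C (Fm m)" using Suc by (simp add: smooth_onD)
    qed (rule Ck_on_const)
    then show ?case by (simp add: smooth_on_def Fm_def RS)
  qed
  have near: "smooth_near M p (\<lambda>q. Fm m (\<phi> q))" if "m \<le> ?n" for m
    by (rule smooth_near_chart_compose[OF U p openin_ecube Fm[OF that] aC])
  have main: "v f = (\<Sum>i<m. v (\<lambda>q. \<phi> q i) * partial_deriv i ?F ?a) + v (\<lambda>q. Fm m (\<phi> q))" if "m \<le> ?n" for m
    using that
  proof (induction m)
    case 0
    have "v f = v (\<lambda>q. Fm 0 (\<phi> q))"
      by (rule tangent_local[OF v f chart_open[OF U] p]) (simp add: Fm_def R_def chart_inv[OF U])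
    then show ?case by simp
  next
    case (Suc m)
    then have m: "m < ?n" by simp
    obtain G where G: "smooth_on ?n ?C G" "G ?a = partial_deriv m (Fm m) ?a"
      "\<And>x. x \<in> ?C \<Longrightarrow> Fm m x = Fm m (x(m := ?a m)) + (x m - ?a m) * G x"
      using hadamard_coordinate[OF m aC Fm] m by (metis less_imp_le)
    have nG: "smooth_near M p (\<lambda>q. G (\<phi> q))"
      by (rule smooth_near_chart_compose[OF U p openin_ecube G(1) aC])
    have pM: "p \<in> mcarrier M" using chart_subset[OF U] p by blast
    have nc: "smooth_near M p (\<lambda>q. \<phi> q m)" by (rule smooth_near_coord[OF U p])
    have nd: "smooth_near M p (\<lambda>q. \<phi> q m - ?a m)"
      using smooth_near_add[OF nc smooth_near_const[OF pM, of "- ?a m"]] by simp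
    have vd: "v (\<lambda>q. \<phi> q m - ?a m) = v (\<lambda>q. \<phi> q m)"
      using tangent_add[OF v nc smooth_near_const[OF pM, of "- ?a m"]] tangent_const[OF v] by simp
    have "v (\<lambda>q. Fm m (\<phi> q)) = v (\<lambda>q. Fm (Suc m) (\<phi> q) + (\<phi> q m - ?a m) * G (\<phi> q))"
    proof (rule tangent_local[OF v near oC pC])
      show "m \<le> ?n" using m by simp
      show "Fm m (\<phi> q) = Fm (Suc m) (\<phi> q) + (\<phi> q m - ?a m) * G (\<phi> q)" if "q \<in> {q \<in> U. \<phi> q \<in> ?C}" for q
        using G(3)[of "\<phi> q"] that by (simp add: Fm_def RS)
    qed
    also have "\<dots> = v (\<lambda>q. Fm (Suc m) (\<phi> q)) + v (\<lambda>q. (\<phi> q m - ?a m) * G (\<phi> q))"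
      by (rule tangent_add[OF v near[OF Suc.prems] smooth_near_mult[OF nd nG]])
    also have "v (\<lambda>q. (\<phi> q m - ?a m) * G (\<phi> q)) = G ?a * v (\<lambda>q. \<phi> q m)"
      using tangent_leibniz[OF v nd nG] vd by simp
    \<comment> \<open>On the line through \<open>?a\<close> in direction \<open>m\<close> the
      coordinates below \<open>m\<close> already have their frozen values, so \<open>Fm m\<close>
      and the original function have the same derivative there.\<close>
    also have "G ?a = partial_deriv m ?F ?a"
    proof -
      have "R m (?a(m := t)) = ?a(m := t)" for t by (auto simp: R_def)
      then show ?thesis unfolding G(2) partial_deriv_def Fm_def by simp
    qed
    finally show ?case using Suc by (simp add: mult.commute o_def)
  qed
  have "v (\<lambda>q. Fm ?n (\<phi> q)) = v (\<lambda>q. ?F ?a)"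
  proof (rule tangent_local[OF v near chart_open[OF U] p])
    fix q assume "q \<in> U"
    then have "R ?n (\<phi> q) = ?a"
      using chart_range[OF U] p by (fastforce simp: R_def topspace_Euclidean_space)
    then show "Fm ?n (\<phi> q) = ?F ?a" by (simp add: Fm_def)
  qed simp
  then show ?thesis using main[of ?n] tangent_const[OF v] by (simp add: o_def)
qed

lemma coord_vec_eq:
  "smooth_near M p f \<Longrightarrow> coord_vec M (U, \<phi>) i p f = partial_deriv i (f \<circ> inv_into U \<phi>) (\<phi> p)"
  by (simp add: coord_vec_def)

text \<open>An equality of functions on all arguments: on those not smooth near \<open>p\<close>
  both sides are 0 by convention.\<close>

lemma tangent_expand:
  assumes U: "(U, \<phi>) \<in> matlas M" "p \<in> U" and v: "v \<in> tangent_space M p"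
  shows "v = (\<lambda>f. \<Sum>i<mdim M. v (\<lambda>q. \<phi> q i) * coord_vec M (U, \<phi>) i p f)"
proof
  fix f
  show "v f = (\<Sum>i<mdim M. v (\<lambda>q. \<phi> q i) * coord_vec M (U, \<phi>) i p f)"
  proof (cases "smooth_near M p f")
    case True
    then show ?thesis using tangent_coordinates[OF U v True] by (simp add: coord_vec_eq)
  next
    case False
    then show ?thesis using tangent_not_near[OF v] by (simp add: coord_vec_def)
  qed
qed

lemma tangent_eqI:
  assumes "(U, \<phi>) \<in> matlas M" "p \<in> U" "v \<in> tangent_space M p" "w \<in> tangent_space M p"
    and "\<And>i. i < mdim M \<Longrightarrow> v (\<lambda>q. \<phi> q i) = w (\<lambda>q. \<phi> q i)"
  shows "v = w"
  using tangent_expand[OF assms(1,2,3)] tangent_expand[OF assms(1,2,4)] assms(5) by simp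

lemma smooth_near_chartD:
  assumes U: "(U, \<phi>) \<in> matlas M" "p \<in> U" and f: "smooth_near M p f"
  obtains S where "openin (Euclidean_space (mdim M)) S" "\<phi> p \<in> S" "S \<subseteq> \<phi> ` U"
    "smooth_on (mdim M) S (f \<circ> inv_into U \<phi>)"
proof -
  obtain W where W: "p \<in> W" "smooth_fun M W f" using f by (auto simp: smooth_near_def)
  have o: "openin (mtop M) (W \<inter> U)" using W(2) smooth_fun_open chart_open[OF U(1)] by blast
  show ?thesis
    using that[OF chart_image_subset_open[OF U(1) o]] smooth_fun_chartD[OF smooth_fun_subset[OF W(2) o] U(1)] W(1) U(2)
    by (simp add: image_mono)
qed

lemma coord_vec_tangent:
  assumes U: "(U, \<phi>) \<in> matlas M" "p \<in> U" and i: "i < mdim M"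
  shows "coord_vec M (U, \<phi>) i p \<in> tangent_space M p"
proof -
  let ?a = "\<phi> p"
  have D: "((\<lambda>t. (f \<circ> inv_into U \<phi>) (?a(i := t))) has_real_derivative partial_deriv i (f \<circ> inv_into U \<phi>) ?a) (at (?a i))"
    if f: "smooth_near M p f" for f
    using smooth_near_chartD[OF U f] Ck_on_partial_DERIV[OF smooth_onD i] by metis
  have inv: "inv_into U \<phi> (?a(i := ?a i)) = p" using chart_inv[OF U] by simp
  show ?thesis
    unfolding tangent_space_def
  proof (intro CollectI conjI allI impI; (elim conjE)?)
    fix f assume "\<not> smooth_near M p f"
    then show "coord_vec M (U, \<phi>) i p f = 0" by (simp add: coord_vec_def)
  next
    fix f g and a b :: real assume f: "smooth_near M p f" and g: "smooth_near M p g"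
    have pM: "p \<in> mcarrier M" using f by (rule smooth_near_carrier)
    have "smooth_near M p (\<lambda>q. a * f q + b * g q)"
      by (intro smooth_near_add smooth_near_mult f g smooth_near_const[OF pM])
    moreover have "partial_deriv i ((\<lambda>q. a * f q + b * g q) \<circ> inv_into U \<phi>) ?a =
        a * partial_deriv i (f \<circ> inv_into U \<phi>) ?a + b * partial_deriv i (g \<circ> inv_into U \<phi>) ?a"
      using DERIV_add[OF DERIV_cmult[OF D[OF f]] DERIV_cmult[OF D[OF g]]]
      by (intro partial_deriv_eqI) (simp only: o_def)
    ultimately show "coord_vec M (U, \<phi>) i p (\<lambda>q. a * f q + b * g q) =
        a * coord_vec M (U, \<phi>) i p f + b * coord_vec M (U, \<phi>) i p g"
      by (simp add: coord_vec_eq f g)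
  next
    fix f g assume f: "smooth_near M p f" and g: "smooth_near M p g"
    have "partial_deriv i ((\<lambda>q. f q * g q) \<circ> inv_into U \<phi>) ?a =
        f p * partial_deriv i (g \<circ> inv_into U \<phi>) ?a + g p * partial_deriv i (f \<circ> inv_into U \<phi>) ?a"
      using DERIV_mult[OF D[OF f] D[OF g]] inv
      by (intro partial_deriv_eqI) (simp only: o_def mult.commute add.commute)
    then show "coord_vec M (U, \<phi>) i p (\<lambda>q. f q * g q) = f p * coord_vec M (U, \<phi>) i p g + g p * coord_vec M (U, \<phi>) i p f"
      by (simp add: coord_vec_eq f g smooth_near_mult)
  qed
qed

lemma coord_vec_coord:
  assumes U: "(U, \<phi>) \<in> matlas M" "p \<in> U" and i: "i < mdim M"
  shows "coord_vec M (U, \<phi>) i p (\<lambda>q. \<phi> q j) = (if i = j then 1 else 0)"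
proof -
  have "partial_deriv i ((\<lambda>q. \<phi> q j) \<circ> inv_into U \<phi>) (\<phi> p) = partial_deriv i (\<lambda>x. x j) (\<phi> p)"
    by (rule partial_deriv_cong[OF chart_image_open[OF U(1)] _ i]) (use U chart_inv in auto)
  also have "\<dots> = (if i = j then 1 else 0)"
    by (rule partial_deriv_eqI) (cases "i = j"; auto)
  finally show ?thesis by (simp add: coord_vec_eq smooth_near_coord[OF U])
qed

text \<open>The domain of a chart enters \<open>coord_vec\<close> through \<open>inv_into\<close>,
  so a smaller domain changes the defining term. Both vectors are tangent at \<open>p\<close> and
  take the same values on the coordinate functions, hence they agree.\<close>

lemma coord_vec_restrict:
  assumes U: "(U, \<phi>) \<in> matlas M" and W: "openin (mtop M) W" "W \<subseteq> U" "p \<in> W" and i: "i < mdim M"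
  shows "coord_vec M (W, \<phi>) i p = coord_vec M (U, \<phi>) i p"
proof (rule tangent_eqI[OF U _ coord_vec_tangent coord_vec_tangent])
  show "(W, \<phi>) \<in> matlas M" by (rule chart_restrict[OF U W(1,2)])
  then show "coord_vec M (W, \<phi>) i p (\<lambda>q. \<phi> q j) = coord_vec M (U, \<phi>) i p (\<lambda>q. \<phi> q j)" for j
    using coord_vec_coord[OF _ W(3) i] coord_vec_coord[OF U _ i] W(2,3) by (metis subsetD)
qed (use assms in auto)

section \<open>Linear forms on tangent spaces\<close>

lemma tangent_sum:
  assumes "p \<in> mcarrier M"
  shows "(\<And>i. i \<in> I \<Longrightarrow> e i \<in> tangent_space M p) \<Longrightarrow> (\<lambda>f. \<Sum>i\<in>I. c i * e i f) \<in> tangent_space M p"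
  unfolding tangent_space_def
  by (auto simp: sum_distrib_left sum.distrib[symmetric] algebra_simps intro!: sum.cong)

lemma cotangent_outside: "\<omega> \<in> cotangent_space M p \<Longrightarrow> v \<notin> tangent_space M p \<Longrightarrow> \<omega> v = 0"
  by (simp add: cotangent_space_def)

lemma cotangent_linear:
  "\<omega> \<in> cotangent_space M p \<Longrightarrow> v \<in> tangent_space M p \<Longrightarrow> w \<in> tangent_space M p \<Longrightarrow>
    \<omega> (\<lambda>f. a * v f + b * w f) = a * \<omega> v + b * \<omega> w"
  by (simp add: cotangent_space_def)

lemma zero_tangent: "(\<lambda>f. 0) \<in> tangent_space M p"
  by (simp add: tangent_space_def)

lemma cotangent_sum:
  assumes p: "p \<in> mcarrier M" and w: "\<omega> \<in> cotangent_space M p" and I: "finite I"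
  shows "(\<And>i. i \<in> I \<Longrightarrow> e i \<in> tangent_space M p) \<Longrightarrow> \<omega> (\<lambda>f. \<Sum>i\<in>I. c i * e i f) = (\<Sum>i\<in>I. c i * \<omega> (e i))"
  using I
proof (induction I rule: finite_induct)
  case empty
  show ?case using cotangent_linear[OF w zero_tangent zero_tangent, of 0 0] by simp
next
  case (insert j I)
  then show ?case
    using cotangent_linear[OF w, of "e j" "\<lambda>f. \<Sum>i\<in>I. c i * e i f" "c j" 1] tangent_sum[OF p, of I e c] by simp
qed

lemma differential_cotangent:
  "smooth_near M p f \<Longrightarrow> differential M f p \<in> cotangent_space M p"
  unfolding cotangent_space_def differential_def
  using tangent_sum[of p "{0::nat, 1}"] smooth_near_carrier[of p f]
  by (auto simp: tangent_space_def algebra_simps)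

lemma cotangent_combination:
  "(\<And>i. i \<in> I \<Longrightarrow> e i \<in> cotangent_space M p) \<Longrightarrow> (\<lambda>v. \<Sum>i\<in>I. c i * e i v) \<in> cotangent_space M p"
  unfolding cotangent_space_def
  by (auto simp: sum_distrib_left sum.distrib[symmetric] algebra_simps intro!: sum.cong)

lemma cotangent_expand:
  assumes U: "(U, \<phi>) \<in> matlas M" "p \<in> U" and w: "\<omega> \<in> cotangent_space M p"
  shows "\<omega> = (\<lambda>v. \<Sum>i<mdim M. \<omega> (coord_vec M (U, \<phi>) i p) * differential M (\<lambda>q. \<phi> q i) p v)"
proof
  fix v
  show "\<omega> v = (\<Sum>i<mdim M. \<omega> (coord_vec M (U, \<phi>) i p) * differential M (\<lambda>q. \<phi> q i) p v)"
  proof (cases "v \<in> tangent_space M p")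
    case True
    have pM: "p \<in> mcarrier M" using U chart_subset by blast
    have "\<omega> v = \<omega> (\<lambda>f. \<Sum>i<mdim M. v (\<lambda>q. \<phi> q i) * coord_vec M (U, \<phi>) i p f)"
      using tangent_expand[OF U True] by simp
    also have "\<dots> = (\<Sum>i<mdim M. v (\<lambda>q. \<phi> q i) * \<omega> (coord_vec M (U, \<phi>) i p))"
      by (rule cotangent_sum[OF pM w]) (use coord_vec_tangent[OF U] in auto)
    finally show ?thesis using True by (simp add: differential_def mult.commute)
  next
    case False
    then show ?thesis using cotangent_outside[OF w] by (simp add: differential_def)
  qed
qed

section \<open>Local vector fields, 1-forms and sections\<close>

lemma vector_field_subset:
  "vector_field_on M W X \<Longrightarrow> openin (mtop M) V \<Longrightarrow> V \<subseteq> W \<Longrightarrow> vector_field_on M V X"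
  unfolding vector_field_on_def by blast

lemma one_form_subset:
  "one_form_on M W \<alpha> \<Longrightarrow> openin (mtop M) V \<Longrightarrow> V \<subseteq> W \<Longrightarrow> one_form_on M V \<alpha>"
  unfolding one_form_on_def by (metis subset_iff subset_trans)

lemma gsection_subset:
  "gsection_on M W \<sigma> \<Longrightarrow> openin (mtop M) V \<Longrightarrow> V \<subseteq> W \<Longrightarrow> gsection_on M V \<sigma>"
  unfolding gsection_on_def using vector_field_subset one_form_subset by blast

lemma coord_vec_field:
  assumes U: "(U, \<phi>) \<in> matlas M" and i: "i < mdim M"
  shows "vector_field_on M U (coord_vec M (U, \<phi>) i)"
  unfolding vector_field_on_def
proof (intro conjI ballI allI impI chart_open[OF U] coord_vec_tangent[OF U _ i]; (elim conjE)?)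
  fix V f assume V: "V \<subseteq> U" and f: "smooth_fun M V f"
  have "smooth_fun M V (\<lambda>p. partial_deriv i (f \<circ> inv_into U \<phi>) (\<phi> p))"
    by (rule smooth_fun_chartI[OF U smooth_fun_open[OF f] V chart_image_subset_open[OF U smooth_fun_open[OF f] V]
        smooth_on_partial[OF smooth_fun_chartD[OF f U V] i]]) simp
  then show "smooth_fun M V (\<lambda>p. coord_vec M (U, \<phi>) i p f)"
    by (rule smooth_fun_cong[THEN iffD1, rotated]) (simp add: coord_vec_eq smooth_nearI[OF f])
qed

lemma gsection_combination:
  assumes W: "openin (mtop M) W" and a: "\<And>i. i < k \<Longrightarrow> smooth_fun M W (a i)"
    and s: "\<And>i. i < k \<Longrightarrow> gsection_on M W (\<sigma> i)"
  shows "gsection_on M W (\<lambda>p. lincomb k (\<lambda>i. a i p) (\<lambda>i. \<sigma> i p))"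
proof -
  have X: "vector_field_on M W (fst \<circ> \<sigma> i)" and A: "one_form_on M W (snd \<circ> \<sigma> i)" if "i < k" for i
    using s[OF that] by (auto simp: gsection_on_def)
  have "vector_field_on M W (\<lambda>p f. \<Sum>i<k. a i p * fst (\<sigma> i p) f)"
    unfolding vector_field_on_def
  proof (intro conjI ballI allI impI W; (elim conjE)?)
    show "(\<lambda>f. \<Sum>i<k. a i p * fst (\<sigma> i p) f) \<in> tangent_space M p" if "p \<in> W" for p
      by (rule tangent_sum) (use that X openin_subset[OF W] in \<open>auto simp: vector_field_on_def\<close>)
    fix V f assume V: "V \<subseteq> W" and f: "smooth_fun M V f"
    note oV = smooth_fun_open[OF f]
    have "smooth_fun M V (\<lambda>p. fst (\<sigma> i p) f)" if "i < k" for i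
      using X[OF that] V f by (auto simp: vector_field_on_def)
    then show "smooth_fun M V (\<lambda>p. \<Sum>i<k. a i p * fst (\<sigma> i p) f)"
      by (intro smooth_fun_sum[OF oV] smooth_fun_mult smooth_fun_subset[OF a oV V]) auto
  qed
  moreover have "one_form_on M W (\<lambda>p v. \<Sum>i<k. a i p * snd (\<sigma> i p) v)"
    unfolding one_form_on_def
  proof (intro conjI ballI allI impI W; (elim conjE)?)
    show "(\<lambda>v. \<Sum>i<k. a i p * snd (\<sigma> i p) v) \<in> cotangent_space M p" if "p \<in> W" for p
      by (rule cotangent_combination) (use that A in \<open>auto simp: one_form_on_def\<close>)
    fix V Y assume V: "V \<subseteq> W" and Y: "vector_field_on M V Y"
    then have oV: "openin (mtop M) V" by (simp add: vector_field_on_def)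
    have "smooth_fun M V (\<lambda>p. snd (\<sigma> i p) (Y p))" if "i < k" for i
      using A[OF that] V Y by (auto simp: one_form_on_def)
    then show "smooth_fun M V (\<lambda>p. \<Sum>i<k. a i p * snd (\<sigma> i p) (Y p))"
      by (intro smooth_fun_sum[OF oV] smooth_fun_mult smooth_fun_subset[OF a oV V]) auto
  qed
  ultimately show ?thesis by (simp add: gsection_on_def lincomb_def o_def)
qed

lemma gsection_cong:
  assumes s: "gsection_on M W \<sigma>" and eq: "\<And>p. p \<in> W \<Longrightarrow> \<sigma> p = \<tau> p"
  shows "gsection_on M W \<tau>"
proof -
  have "smooth_fun M V (\<lambda>p. fst (\<tau> p) f)" if "V \<subseteq> W" "smooth_fun M V (\<lambda>p. fst (\<sigma> p) f)" for V f
    using that(2) by (rule smooth_fun_cong[THEN iffD1, rotated]) (use that(1) eq in auto)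
  moreover have "smooth_fun M V (\<lambda>p. snd (\<tau> p) (Y p))" if "V \<subseteq> W" "smooth_fun M V (\<lambda>p. snd (\<sigma> p) (Y p))" for V Y
    using that(2) by (rule smooth_fun_cong[THEN iffD1, rotated]) (use that(1) eq in auto)
  ultimately show ?thesis
    using s eq unfolding gsection_on_def vector_field_on_def one_form_on_def by simp
qed

end

section \<open>Frames dual to mixed coordinates\<close>

text \<open>The coordinates \<open>dx\<^sub>i(X)\<close> for \<open>i < r\<close> and \<open>\<alpha>(\<partial>\<^sub>i)\<close> for \<open>i \<ge> r\<close> of a pair \<open>(X, \<alpha>)\<close>.\<close>

definition mixed_coord ::
    "'m manifold \<Rightarrow> 'm chart \<Rightarrow> nat \<Rightarrow> nat \<Rightarrow> 'm \<Rightarrow> 'm gvec \<Rightarrow> real" where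
  "mixed_coord M c r i p w = (if i < r then fst w (\<lambda>q. snd c q i) else snd w (coord_vec M c i p))"

lemma mixed_coord_lincomb:
  "mixed_coord M c r i p (lincomb k a e) = (\<Sum>j<k. a j * mixed_coord M c r i p (e j))"
  by (simp add: mixed_coord_def lincomb_def)

lemma sum_lessThan_add: "(\<Sum>k<r + s. f k) = (\<Sum>k<r. f k) + (\<Sum>k<s. f (r + k :: nat) :: real)"
  by (induction s) simp_all

lemma lincomb_in_subspace:
  "linear_subspace M p W \<Longrightarrow> (\<And>i. i < k \<Longrightarrow> e i \<in> W) \<Longrightarrow> lincomb k c e \<in> W"
  by (simp add: linear_subspace_def)

lemma linear_subspaceD:
  assumes "linear_subspace M p W" "w \<in> W"
  shows "fst w \<in> tangent_space M p" "snd w \<in> cotangent_space M p"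
proof -
  have "W \<subseteq> gspace M p" using assms(1) unfolding linear_subspace_def by (elim conjE)
  then have "w \<in> gspace M p" using assms(2) by (rule subsetD)
  then show "fst w \<in> tangent_space M p" "snd w \<in> cotangent_space M p"
    by (simp_all add: gspace_def mem_Times_iff)
qed

lemma maximal_isotropicD:
  assumes "maximal_isotropic M p W"
  shows "linear_subspace M p W" "isotropic W"
  using assms by (simp_all add: maximal_isotropic_def)

context smooth_mfd
begin

section \<open>Linear algebra of a maximal isotropic fibre\<close>

lemma gspace_lincomb:
  "p \<in> mcarrier M \<Longrightarrow> (\<And>i. i < k \<Longrightarrow> e i \<in> gspace M p) \<Longrightarrow> lincomb k c e \<in> gspace M p"
  unfolding gspace_def lincomb_def
  by (auto simp: mem_Times_iff intro!: tangent_sum cotangent_combination)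

text \<open>Since \<open>e\<close> is null and orthogonal to \<open>W\<close>, the sum of
  \<open>W\<close> and the line through \<open>e\<close> is again an isotropic subspace; maximality
  leaves no room for enlargement.\<close>

lemma maximal_isotropicI:
  assumes W: "maximal_isotropic M p W" and p: "p \<in> mcarrier M" and e: "e \<in> gspace M p"
    and ee: "pairing e e = 0" and we: "\<And>w. w \<in> W \<Longrightarrow> pairing w e = 0"
  shows "e \<in> W"
proof -
  define add where "add w t = ((\<lambda>f. fst w f + t * fst e f), (\<lambda>v. snd w v + t * snd e v))" for w t
  define W' where "W' = {add w t | w t. w \<in> W}"
  have addI: "add w t \<in> W'" if "w \<in> W" for w t
    unfolding W'_def using that by blast
  have lin: "linear_subspace M p W" and iso: "isotropic W"
    using maximal_isotropicD[OF W] .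
  have WG: "W \<subseteq> gspace M p" using lin by (simp add: linear_subspace_def)
  have add2: "add w t = lincomb 2 (\<lambda>i. if i = 0 then 1 else t) (\<lambda>i. if i = 0 then w else e)" for w t
    by (simp add: add_def lincomb_def numeral_2_eq_2)
  have pair_expand: "snd w (fst (add w' t)) = snd w (fst w') + t * snd w (fst e)"
    if "w \<in> gspace M p" "w' \<in> gspace M p" for w w' t
    using cotangent_linear[of "snd w" p "fst w'" "fst e" 1 t] that e
    by (auto simp: gspace_def add_def mem_Times_iff)
  have "linear_subspace M p W'"
    unfolding linear_subspace_def
  proof (intro conjI allI impI)
    show "W' \<subseteq> gspace M p"
    proof
      fix x assume "x \<in> W'"
      then obtain w t where "x = add w t" "w \<in> W" by (auto simp: W'_def)
      then show "x \<in> gspace M p"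
        unfolding add2 using WG e by (auto intro!: gspace_lincomb[OF p] split: if_splits)
    qed
    fix k :: nat and c x assume "\<forall>i<k. x i \<in> W'"
    then have "\<forall>i. \<exists>w t. i < k \<longrightarrow> x i = add w t \<and> w \<in> W" by (auto simp: W'_def)
    then obtain w t where wt: "\<And>i. i < k \<Longrightarrow> x i = add (w i) (t i)" "\<And>i. i < k \<Longrightarrow> w i \<in> W"
      by metis
    have "lincomb k c x = add (lincomb k c w) (\<Sum>i<k. c i * t i)"
      by (simp add: lincomb_def add_def wt(1) distrib_left sum.distrib sum_distrib_right mult.assoc)
    then show "lincomb k c x \<in> W'"
      using addI[OF lincomb_in_subspace[OF lin wt(2)]] by simp
  qed
  moreover have "isotropic W'"
    unfolding isotropic_def
  proof (intro ballI)
    fix x y assume "x \<in> W'" "y \<in> W'"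
    then obtain w t w' t' where x: "x = add w t" "w \<in> W" and y: "y = add w' t'" "w' \<in> W"
      by (auto simp: W'_def)
    have g: "w \<in> gspace M p" "w' \<in> gspace M p" using x y WG by auto
    have "snd x (fst y) = snd w (fst y) + t * snd e (fst y)"
      "snd y (fst x) = snd w' (fst x) + t' * snd e (fst x)"
      unfolding x y by (simp_all add: add_def)
    then have "snd x (fst y) + snd y (fst x) =
        (snd w (fst w') + snd w' (fst w)) + t' * (snd w (fst e) + snd e (fst w))
        + t * (snd w' (fst e) + snd e (fst w')) + t * t' * (snd e (fst e) + snd e (fst e))"
      unfolding x(1) y(1) by (simp add: pair_expand g e algebra_simps)
    moreover have "pairing w w' = 0" using iso x y by (auto simp: isotropic_def)
    ultimately show "pairing x y = 0"
      using we[OF x(2)] we[OF y(2)] ee by (simp add: pairing_def)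
  qed
  moreover have "W \<subseteq> W'"
  proof
    fix w assume "w \<in> W"
    moreover have "add w 0 = w" by (simp add: add_def)
    ultimately show "w \<in> W'" using addI[of w 0] by simp
  qed
  ultimately have "W' = W" using W unfolding maximal_isotropic_def by blast
  \<comment> \<open>The zero vector enters as the empty linear combination, and \<open>e\<close> is
    0 + 1 * \<open>e\<close>.\<close>
  moreover have "add (lincomb 0 (\<lambda>i. 0) (\<lambda>i. e)) 1 = e" by (simp add: add_def lincomb_def)
  moreover have "lincomb 0 (\<lambda>i. 0) (\<lambda>i. e) \<in> W" by (rule lincomb_in_subspace[OF lin]) simp
  ultimately show "e \<in> W" using addI[of "lincomb 0 (\<lambda>i. 0) (\<lambda>i. e)" 1] by simp
qed

lemma cotangent_apply_coords:
  assumes U: "(U, \<phi>) \<in> matlas M" "p \<in> U" and w: "\<omega> \<in> cotangent_space M p" and v: "v \<in> tangent_space M p"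
  shows "\<omega> v = (\<Sum>k<mdim M. v (\<lambda>q. \<phi> q k) * \<omega> (coord_vec M (U, \<phi>) k p))"
  using fun_cong[OF cotangent_expand[OF U w], of v] v by (simp add: differential_def mult.commute)

text \<open>The relation \<open>c\<close> is represented by an element of the fibre: the
  coefficients from \<open>r\<close> on form a vector \<open>Y\<close>, those below \<open>r\<close>
  a covector \<open>\<beta>\<close>, and pairing with (\<open>Y\<close>, \<open>\<beta>\<close>) is
  half the given combination of mixed coordinates. This pair is null because the two index ranges
  are disjoint, and it is orthogonal to \<open>W\<close>, so it lies in \<open>W\<close> by
  maximality. Then \<open>Y\<close> lies in the projection of \<open>W\<close>, whose elements have
  no components from \<open>r\<close> on, so those coefficients vanish.\<close>

lemma mixed_coord_independent:
  assumes U: "(U, \<phi>) \<in> matlas M" "p \<in> U" and n: "mdim M = r + s"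
    and W: "maximal_isotropic M p W"
    and D: "fst ` W = {v \<in> tangent_space M p. \<forall>j<s. v (\<lambda>q. \<phi> q (r + j)) = 0}"
    and c: "\<And>w. w \<in> W \<Longrightarrow> (\<Sum>i<r + s. c i * mixed_coord M (U, \<phi>) r i p w) = 0"
    and i: "i < r + s"
  shows "c i = 0"
proof -
  let ?d = "\<lambda>i. coord_vec M (U, \<phi>) i p"
  have pM: "p \<in> mcarrier M" using U chart_subset by blast
  define b where "b k = (if k < r then c k else 0)" for k
  define d where "d k = (if k < r then 0 else c k)" for k
  define Y where "Y = (\<lambda>f. \<Sum>k<r + s. d k * ?d k f)"
  define \<beta> where "\<beta> = (\<lambda>v. \<Sum>k<r + s. b k * differential M (\<lambda>q. \<phi> q k) p v)"
  have Y: "Y \<in> tangent_space M p"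
    unfolding Y_def by (rule tangent_sum[OF pM]) (use coord_vec_tangent[OF U] n in auto)
  have \<beta>: "\<beta> \<in> cotangent_space M p"
    unfolding \<beta>_def by (intro cotangent_combination differential_cotangent smooth_near_coord[OF U])
  have Yk: "Y (\<lambda>q. \<phi> q k) = d k" if "k < r + s" for k
  proof -
    have "Y (\<lambda>q. \<phi> q k) = (\<Sum>l<r + s. d l * (if l = k then 1 else 0))"
      unfolding Y_def by (intro sum.cong) (use coord_vec_coord[OF U] n in auto)
    also have "\<dots> = d k" using that by (simp add: if_distrib[of "\<lambda>x. d _ * x"] cong: if_cong)
    finally show ?thesis .
  qed
  have \<beta>v: "\<beta> v = (\<Sum>k<r + s. b k * v (\<lambda>q. \<phi> q k))" if "v \<in> tangent_space M p" for v
    using that by (simp add: \<beta>_def differential_def)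
  have WG: "fst w \<in> tangent_space M p" "snd w \<in> cotangent_space M p" if "w \<in> W" for w
    using linear_subspaceD[OF maximal_isotropicD(1)[OF W] that] .
  have \<alpha>Y: "\<alpha> Y = (\<Sum>k<r + s. d k * \<alpha> (?d k))" if "\<alpha> \<in> cotangent_space M p" for \<alpha>
    using cotangent_apply_coords[OF U that Y] Yk n by simp
  have inW: "(Y, \<beta>) \<in> W"
  proof (rule maximal_isotropicI[OF W pM])
    show "(Y, \<beta>) \<in> gspace M p" using Y \<beta> by (simp add: gspace_def)
    have "\<beta> Y = (\<Sum>k<r + s. b k * d k)" using \<beta>v[OF Y] Yk by simp
    also have "\<dots> = 0" by (intro sum.neutral) (simp add: b_def d_def)
    finally show "pairing (Y, \<beta>) (Y, \<beta>) = 0" by (simp add: pairing_def)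
    show "pairing w (Y, \<beta>) = 0" if w: "w \<in> W" for w
    proof -
      have "snd w Y + \<beta> (fst w) = (\<Sum>k<r + s. c k * mixed_coord M (U, \<phi>) r k p w)"
        unfolding \<alpha>Y[OF WG(2)[OF w]] \<beta>v[OF WG(1)[OF w]] sum.distrib[symmetric]
        by (intro sum.cong) (auto simp: b_def d_def mixed_coord_def)
      then show ?thesis using c[OF w] by (simp add: pairing_def)
    qed
  qed
  then have "Y \<in> fst ` W" by force
  then have c2: "c k = 0" if "r \<le> k" "k < r + s" for k
    using Yk[OF that(2)] that unfolding D by (auto simp: d_def dest: spec[of _ "k - r"])
  then have d0: "d k = 0" if "k < r + s" for k using that by (simp add: d_def)
  show ?thesis
  proof (cases "i < r")
    case True
    have iT: "?d i \<in> tangent_space M p" using coord_vec_tangent[OF U] i n by simp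
    \<comment> \<open>The d/dx_i with \<open>i < r\<close> is the vector part of some
      \<open>w\<close> in \<open>W\<close>. As \<open>Y\<close> has no components left, the pairing
      of \<open>w\<close> with (\<open>Y\<close>, \<open>\<beta>\<close>) reduces to half of
      \<open>c i\<close>, and isotropy makes it 0.\<close>
    have "?d i \<in> fst ` W"
      unfolding D using iT coord_vec_coord[OF U, of i] i n True by simp
    then obtain w where w: "w \<in> W" "fst w = ?d i" by auto
    have "pairing w (Y, \<beta>) = 0" using maximal_isotropicD(2)[OF W] w inW by (simp add: isotropic_def)
    moreover have "snd w Y = 0"
      unfolding \<alpha>Y[OF WG(2)[OF w(1)]] using d0 by (intro sum.neutral) simp
    moreover have "\<beta> (?d i) = (\<Sum>k<r + s. b k * (if i = k then 1 else 0))"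
      unfolding \<beta>v[OF iT] using coord_vec_coord[OF U, of i] i n by simp
    ultimately show ?thesis
      using w(2) i True by (simp add: pairing_def b_def if_distrib[of "\<lambda>x. (if _ < r then c _ else 0) * x"] cong: if_cong)
  qed (use c2 i in simp)
qed

section \<open>Local sections and elimination\<close>

lemma mixed_coord_smooth:
  assumes U: "(U, \<phi>) \<in> matlas M" and WU: "W \<subseteq> U" and s: "gsection_on M W \<sigma>" and i: "i < mdim M"
  shows "smooth_fun M W (\<lambda>p. mixed_coord M (U, \<phi>) r i p (\<sigma> p))"
proof -
  have W: "openin (mtop M) W" using s by (auto simp: gsection_on_def vector_field_on_def)
  show ?thesis
  proof (cases "i < r")
    case True
    have "smooth_fun M W (\<lambda>p. (fst \<circ> \<sigma>) p (\<lambda>q. \<phi> q i))"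
      using s smooth_fun_subset[OF smooth_fun_coord[OF U] W WU]
      unfolding gsection_on_def vector_field_on_def by blast
    then show ?thesis using True by (simp add: mixed_coord_def)
  next
    case False
    have "smooth_fun M W (\<lambda>p. (snd \<circ> \<sigma>) p (coord_vec M (U, \<phi>) i p))"
      using s vector_field_subset[OF coord_vec_field[OF U i] W WU]
      unfolding gsection_on_def one_form_on_def by blast
    then show ?thesis using False by (simp add: mixed_coord_def)
  qed
qed

lemma sections_open: "\<sigma> \<in> sections M W L \<Longrightarrow> openin (mtop M) W"
  by (simp add: sections_def gsection_on_def vector_field_on_def)

lemma sections_subset:
  "\<sigma> \<in> sections M W L \<Longrightarrow> openin (mtop M) V \<Longrightarrow> V \<subseteq> W \<Longrightarrow> \<sigma> \<in> sections M V L"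
  using gsection_subset by (auto simp: sections_def)

lemma sections_combination:
  assumes L: "smooth_subbundle M L" and W: "openin (mtop M) W"
    and a: "\<And>i. i < k \<Longrightarrow> smooth_fun M W (a i)" and s: "\<And>i. i < k \<Longrightarrow> \<sigma> i \<in> sections M W L"
  shows "(\<lambda>p. lincomb k (\<lambda>i. a i p) (\<lambda>i. \<sigma> i p)) \<in> sections M W L"
proof -
  have "lincomb k (\<lambda>i. a i p) (\<lambda>i. \<sigma> i p) \<in> L p" if "p \<in> W" for p
  proof (rule lincomb_in_subspace)
    show "linear_subspace M p (L p)"
      using L that openin_subset[OF W] by (auto simp: smooth_subbundle_def)
  qed (use s that in \<open>auto simp: sections_def\<close>)
  then show ?thesis
    using gsection_combination[OF W a] s by (simp add: sections_def)
qed

text \<open>The coefficients of \<open>w\<close> in a local basis are kept constant.\<close>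

lemma local_section_through:
  assumes L: "smooth_subbundle M L" and p: "p \<in> mcarrier M" and w: "w \<in> L p"
  obtains W \<sigma> where "p \<in> W" "\<sigma> \<in> sections M W L" "\<sigma> p = w"
proof -
  have "\<exists>W k \<sigma>. p \<in> W \<and> openin (mtop M) W \<and> (\<forall>i<k. gsection_on M W (\<sigma> i)) \<and>
      (\<forall>q\<in>W. is_basis (L q) k (\<lambda>i. \<sigma> i q))"
    using conjunct2[OF L[unfolded smooth_subbundle_def]] p by (rule bspec)
  then obtain W k \<sigma> where *: "p \<in> W \<and> openin (mtop M) W \<and> (\<forall>i<k. gsection_on M W (\<sigma> i)) \<and>
      (\<forall>q\<in>W. is_basis (L q) k (\<lambda>i. \<sigma> i q))"
    by (elim exE)
  then have W: "p \<in> W" "openin (mtop M) W" and s: "\<And>i. i < k \<Longrightarrow> gsection_on M W (\<sigma> i)"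
    and basis: "\<And>q. q \<in> W \<Longrightarrow> is_basis (L q) k (\<lambda>i. \<sigma> i q)"
    by simp_all
  obtain c where c: "w = lincomb k c (\<lambda>i. \<sigma> i p)"
    using basis[OF W(1)] w by (auto simp: is_basis_def)
  have "(\<lambda>q. lincomb k (\<lambda>i. c i) (\<lambda>i. \<sigma> i q)) \<in> sections M W L"
  proof (rule sections_combination[OF L W(2)])
    show "\<sigma> i \<in> sections M W L" if "i < k" for i
      using s[OF that] basis that by (auto simp: sections_def is_basis_def)
  qed (rule smooth_fun_const[OF W(2)])
  then show ?thesis using that W(1) c by simp
qed

text \<open>Gauss-Jordan elimination with smooth coefficients. Independence at \<open>m0\<close>
  alone provides a nonzero pivot there; the pivot is a smooth function, so it stays nonzero on a
  smaller neighbourhood.\<close>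

lemma dual_frame:
  assumes U: "(U, \<phi>) \<in> matlas M" "m0 \<in> U" and n: "mdim M = r + s"
    and L: "smooth_subbundle M L" and max: "maximal_isotropic M m0 (L m0)"
    and D: "fst ` L m0 = {v \<in> tangent_space M m0. \<forall>j<s. v (\<lambda>q. \<phi> q (r + j)) = 0}"
    and m: "m \<le> r + s"
  shows "\<exists>W \<tau>. openin (mtop M) W \<and> m0 \<in> W \<and> W \<subseteq> U \<and> (\<forall>j<m. \<tau> j \<in> sections M W L) \<and>
    (\<forall>i<m. \<forall>j<m. \<forall>p\<in>W. mixed_coord M (U, \<phi>) r i p (\<tau> j p) = (if i = j then 1 else 0))"
  using m
proof (induction m)
  case 0
  then show ?case using chart_open[OF U(1)] U(2) by auto
next
  case (Suc m)
  let ?m = "mixed_coord M (U, \<phi>) r"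
  have "m \<le> r + s" using Suc.prems by simp
  from Suc.IH[OF this] obtain W \<tau> where IH: "openin (mtop M) W \<and> m0 \<in> W \<and> W \<subseteq> U \<and>
      (\<forall>j<m. \<tau> j \<in> sections M W L) \<and>
      (\<forall>i<m. \<forall>j<m. \<forall>p\<in>W. ?m i p (\<tau> j p) = (if i = j then 1 else 0))"
    by (elim exE)
  have W: "openin (mtop M) W" "m0 \<in> W" "W \<subseteq> U"
    and \<tau>: "\<And>j. j < m \<Longrightarrow> \<tau> j \<in> sections M W L"
    and dual: "\<And>i j p. i < m \<Longrightarrow> j < m \<Longrightarrow> p \<in> W \<Longrightarrow> ?m i p (\<tau> j p) = (if i = j then 1 else 0)"
    using IH by blast+
  have pM: "m0 \<in> mcarrier M" using W(1,2) openin_subset by blast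
  \<comment> \<open>On an element \<open>w\<close> this combination is the \<open>m\<close>-th mixed
    coordinate left after the components along the earlier \<open>\<tau>\<close> have been
    subtracted. It is nontrivial because \<open>c m = 1\<close>, so some \<open>w\<close> in the
    fibre gives it a nonzero value.\<close>
  define c where "c i = (if i < m then - ?m m m0 (\<tau> i m0) else if i = m then 1 else 0)" for i
  have "\<exists>w\<in>L m0. (\<Sum>i<r + s. c i * ?m i m0 w) \<noteq> 0"
  proof (rule ccontr)
    assume "\<not> ?thesis"
    then have "c m = 0"
      using mixed_coord_independent[OF U n max D, of c m] Suc.prems by auto
    then show False by (simp add: c_def)
  qed
  then obtain w where w: "w \<in> L m0" "(\<Sum>i<r + s. c i * ?m i m0 w) \<noteq> 0" by blast
  obtain W1 \<sigma> where W1: "m0 \<in> W1" "\<sigma> \<in> sections M W1 L" "\<sigma> m0 = w"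
    using local_section_through[OF L pM w(1)] .
  define V where "V = W \<inter> W1"
  have V: "openin (mtop M) V" "m0 \<in> V" "V \<subseteq> U" "V \<subseteq> W"
    using W W1 sections_open[OF W1(2)] by (auto simp: V_def)
  have \<sigma>V: "\<sigma> \<in> sections M V L" by (rule sections_subset[OF W1(2) V(1)]) (simp add: V_def)
  have \<tau>V: "\<tau> j \<in> sections M V L" if "j < m" for j
    by (rule sections_subset[OF \<tau>[OF that] V(1,4)])
  have smooth: "smooth_fun M V' (\<lambda>p. ?m i p (\<rho> p))" if "\<rho> \<in> sections M V' L" "i < r + s" "V' \<subseteq> U" for i \<rho> V'
    using mixed_coord_smooth[OF U(1) that(3)] that(1,2) n by (simp add: sections_def)
  \<comment> \<open>Subtracting the earlier sections clears the mixed coordinates below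
    \<open>m\<close>.\<close>
  define \<sigma>' where "\<sigma>' p = lincomb (Suc m) (\<lambda>i. if i < m then - 1 * ?m i p (\<sigma> p) else 1)
    (\<lambda>i. if i < m then \<tau> i p else \<sigma> p)" for p
  have \<mu>\<sigma>': "?m i p (\<sigma>' p) = ?m i p (\<sigma> p) - (\<Sum>j<m. ?m j p (\<sigma> p) * ?m i p (\<tau> j p))" for i p
    unfolding \<sigma>'_def mixed_coord_lincomb by (simp add: sum_negf)
  have \<sigma>': "\<sigma>' \<in> sections M V L"
  proof -
    have "(\<lambda>p. lincomb (Suc m) (\<lambda>i. (if i < m then \<lambda>p. - 1 * ?m i p (\<sigma> p) else (\<lambda>p. 1)) p)
      (\<lambda>i. (if i < m then \<tau> i else \<sigma>) p)) \<in> sections M V L"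
    proof (rule sections_combination[OF L V(1)])
      fix i assume "i < Suc m"
      show "smooth_fun M V (if i < m then \<lambda>p. - 1 * ?m i p (\<sigma> p) else (\<lambda>p. 1))"
        using smooth_fun_mult[OF smooth_fun_const[OF V(1), of "- 1"] smooth[OF \<sigma>V _ V(3), of i]]
          smooth_fun_const[OF V(1), of 1] Suc.prems by simp
      show "(if i < m then \<tau> i else \<sigma>) \<in> sections M V L" using \<tau>V \<sigma>V by simp
    qed
    moreover have "\<sigma>' = (\<lambda>p. lincomb (Suc m) (\<lambda>i. (if i < m then \<lambda>p. - 1 * ?m i p (\<sigma> p) else (\<lambda>p. 1)) p)
      (\<lambda>i. (if i < m then \<tau> i else \<sigma>) p))"
      by (simp add: \<sigma>'_def lincomb_def fun_eq_iff)
    ultimately show ?thesis by simp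
  qed
  have zero: "?m i p (\<sigma>' p) = 0" if "i < m" "p \<in> V" for i p
  proof -
    have "(\<Sum>j<m. ?m j p (\<sigma> p) * ?m i p (\<tau> j p)) = (\<Sum>j<m. ?m j p (\<sigma> p) * (if i = j then 1 else 0))"
      using dual that V(4) by (intro sum.cong) auto
    then show ?thesis using that by (simp add: \<mu>\<sigma>' if_distrib[of "\<lambda>x. _ * x"] cong: if_cong)
  qed
  \<comment> \<open>The pivot, nonzero at \<open>m0\<close> by the choice of
    \<open>w\<close>.\<close>
  define g where "g p = ?m m p (\<sigma>' p)" for p
  have g: "smooth_fun M V g"
    unfolding g_def by (rule smooth[OF \<sigma>' _ V(3)]) (use Suc.prems in simp)
  have "g m0 = (\<Sum>i<Suc m. c i * ?m i m0 w)"
    by (simp add: g_def \<mu>\<sigma>' W1(3) c_def sum_negf mult.commute)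
  also have "\<dots> = (\<Sum>i<r + s. c i * ?m i m0 w)"
    by (rule sum.mono_neutral_left) (use Suc.prems in \<open>auto simp: c_def\<close>)
  finally have g0: "g m0 \<noteq> 0" using w(2) by simp
  define V' where "V' = {p \<in> V. g p \<in> - {0}}"
  have V': "openin (mtop M) V'" "m0 \<in> V'" "V' \<subseteq> V" "\<And>p. p \<in> V' \<Longrightarrow> g p \<noteq> 0"
    using smooth_fun_continuous_open[OF g, of "- {0}"] V(2) g0 by (auto simp: V'_def)
  define \<rho> where "\<rho> p = lincomb 1 (\<lambda>i. inverse (g p)) (\<lambda>i. \<sigma>' p)" for p
  have \<rho>: "\<rho> \<in> sections M V' L"
    unfolding \<rho>_def
    by (rule sections_combination[OF L V'(1)])
      (use smooth_fun_inverse[OF smooth_fun_subset[OF g V'(1,3)] V'(4)] sections_subset[OF \<sigma>' V'(1,3)] in auto)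
  have \<mu>\<rho>: "?m i p (\<rho> p) = (if i = m then 1 else 0)" if "i < Suc m" "p \<in> V'" for i p
    using that zero[of i p] V'(3,4) by (auto simp: \<rho>_def mixed_coord_lincomb less_Suc_eq simp flip: g_def)
  \<comment> \<open>Back substitution: a multiple of the normalized section \<open>\<rho>\<close>
    clears the \<open>m\<close>-th coordinate of the earlier sections and leaves their coordinates
    below \<open>m\<close> unchanged.\<close>
  define \<tau>' where "\<tau>' j = (if j < m then
    (\<lambda>p. lincomb 2 (\<lambda>i. (if i = 0 then \<lambda>p. 1 else (\<lambda>p. - 1 * ?m m p (\<tau> j p))) p)
      (\<lambda>i. (if i = 0 then \<tau> j else \<rho>) p)) else \<rho>)" for j
  have "\<tau>' j \<in> sections M V' L" for j
  proof (cases "j < m")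
    case True
    have \<tau>j: "\<tau> j \<in> sections M V' L" by (rule sections_subset[OF \<tau>V[OF True] V'(1,3)])
    have "smooth_fun M V' (\<lambda>p. - 1 * ?m m p (\<tau> j p))"
      by (rule smooth_fun_mult[OF smooth_fun_const[OF V'(1)] smooth[OF \<tau>j]]) (use Suc.prems V'(3) V(3) in auto)
    then show ?thesis
      unfolding \<tau>'_def if_P[OF True]
      by (intro sections_combination[OF L V'(1)]) (use \<rho> \<tau>j smooth_fun_const[OF V'(1)] in \<open>auto split: if_splits\<close>)
  qed (use \<rho> in \<open>simp add: \<tau>'_def\<close>)
  moreover have "?m i p (\<tau>' j p) = (if i = j then 1 else 0)" if "i < Suc m" "j < Suc m" "p \<in> V'" for i j p
  proof (cases "j < m")
    case True
    have "?m i p (\<tau>' j p) = ?m i p (\<tau> j p) - ?m m p (\<tau> j p) * ?m i p (\<rho> p)"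
      unfolding \<tau>'_def if_P[OF True] mixed_coord_lincomb by (simp add: numeral_2_eq_2)
    moreover have "?m i p (\<tau> j p) = (if i = j then 1 else 0)" if "i < m"
      using dual[OF that True] \<open>p \<in> V'\<close> V'(3) V(4) by auto
    ultimately show ?thesis using \<mu>\<rho>[OF that(1,3)] that(1) True by (auto simp: less_Suc_eq)
  next
    case False
    then show ?thesis using \<mu>\<rho>[OF that(1,3)] that(2) by (auto simp: \<tau>'_def)
  qed
  ultimately show ?case using V' V(3) by (intro exI[of _ V'] exI[of _ \<tau>']) auto
qed

text \<open>By isotropy, pairing with a dual frame recovers the remaining coordinates.\<close>

lemma dual_frame_spans:
  assumes U: "(U, \<phi>) \<in> matlas M" "p \<in> U" and n: "mdim M = r + s"
    and lin: "linear_subspace M p W" and iso: "isotropic W"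
    and e: "\<And>i. i < r + s \<Longrightarrow> e i \<in> W"
    and dual: "\<And>i j. i < r + s \<Longrightarrow> j < r + s \<Longrightarrow> mixed_coord M (U, \<phi>) r i p (e j) = (if i = j then 1 else 0)"
    and w: "w \<in> W"
  shows "w = lincomb (r + s) (\<lambda>i. mixed_coord M (U, \<phi>) r i p w) e"
proof -
  let ?m = "\<lambda>i. mixed_coord M (U, \<phi>) r i p" and ?d = "\<lambda>i. coord_vec M (U, \<phi>) i p"
  \<comment> \<open>The difference of \<open>w\<close> and its proposed expansion, to be shown to be
    zero. Its mixed coordinates vanish by duality.\<close>
  define z where "z = lincomb (Suc (r + s)) (\<lambda>i. if i < r + s then - ?m i w else 1) (\<lambda>i. if i < r + s then e i else w)"
  have z: "z \<in> W"
    unfolding z_def by (rule lincomb_in_subspace[OF lin]) (use e w in auto)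
  have \<mu>z: "?m i z = 0" if i: "i < r + s" for i
  proof -
    have "?m i z = ?m i w - (\<Sum>j<r + s. ?m j w * ?m i (e j))"
      unfolding z_def mixed_coord_lincomb by (simp add: sum_negf)
    also have "(\<Sum>j<r + s. ?m j w * ?m i (e j)) = (\<Sum>j<r + s. ?m j w * (if i = j then 1 else 0))"
      using dual[OF i] by simp
    also have "\<dots> = ?m i w" using i by (simp add: if_distrib[of "\<lambda>x. _ * x"] cong: if_cong)
    finally show ?thesis by simp
  qed
  have G: "fst x \<in> tangent_space M p" "snd x \<in> cotangent_space M p" if "x \<in> W" for x
    using linear_subspaceD[OF lin that] .
  \<comment> \<open>In coordinates, each summand of the pairing of \<open>z\<close> with
    \<open>e i\<close> is a product of a mixed coordinate of one factor and the complementary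
    coordinate of the other. Only the term with index \<open>i\<close> survives.\<close>
  have zi: "(if i < r then snd z (?d i) else fst z (\<lambda>q. \<phi> q i)) = 0" if i: "i < r + s" for i
  proof -
    have "snd z (fst (e i)) + snd (e i) (fst z) = (\<Sum>k<r + s. fst (e i) (\<lambda>q. \<phi> q k) * snd z (?d k)
        + fst z (\<lambda>q. \<phi> q k) * snd (e i) (?d k))"
      using cotangent_apply_coords[OF U G(2)[OF z] G(1)[OF e[OF i]]]
        cotangent_apply_coords[OF U G(2)[OF e[OF i]] G(1)[OF z]] n by (simp add: sum.distrib)
    also have "\<dots> = (\<Sum>k<r + s. (if i = k then 1 else 0) * (if k < r then snd z (?d k) else fst z (\<lambda>q. \<phi> q k)))"
    proof (rule sum.cong)
      fix k assume "k \<in> {..<r + s}"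
      then show "fst (e i) (\<lambda>q. \<phi> q k) * snd z (?d k) + fst z (\<lambda>q. \<phi> q k) * snd (e i) (?d k) =
          (if i = k then 1 else 0) * (if k < r then snd z (?d k) else fst z (\<lambda>q. \<phi> q k))"
        using \<mu>z[of k] dual[of k i] i by (auto simp: mixed_coord_def split: if_splits)
    qed simp
    also have "\<dots> = (if i < r then snd z (?d i) else fst z (\<lambda>q. \<phi> q i))"
      using i by (simp add: if_distrib[of "\<lambda>x. x * _"] cong: if_cong)
    finally show ?thesis
      using iso z e[OF i] by (auto simp: isotropic_def pairing_def)
  qed
  have "fst z (\<lambda>q. \<phi> q k) = 0 \<and> snd z (?d k) = 0" if "k < r + s" for k
    using zi[OF that] \<mu>z[OF that] by (auto simp: mixed_coord_def split: if_splits)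
  then have "fst z f = 0" "snd z v = 0" for f v
    using fun_cong[OF tangent_expand[OF U G(1)[OF z]], of f] fun_cong[OF cotangent_expand[OF U G(2)[OF z]], of v] n
    by simp_all
  then show ?thesis
    unfolding z_def lincomb_def by (intro prod_eqI ext) (simp_all add: sum_negf)
qed

end

section \<open>Local form of sections\<close>

context smooth_mfd
begin

text \<open>Duality prescribes the dx_k(X) for \<open>k < r\<close> and the components of the
  covector from \<open>r\<close> on. The other half of the coordinates stays free and becomes the
  coefficient functions X and \<alpha>, or Z and \<beta>.\<close>

lemma dual_frame_normal_form:
  assumes U: "(U, \<phi>) \<in> matlas M" "p \<in> U" and n: "mdim M = r + s"
    and e: "e \<in> gspace M p" and i: "i < r + s"
    and dual: "\<And>k. k < r + s \<Longrightarrow> mixed_coord M (U, \<phi>) r k p e = (if k = i then 1 else 0)"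
  shows "i < r \<Longrightarrow> e =
      ((\<lambda>f. coord_vec M (U, \<phi>) i p f + (\<Sum>k<s. fst e (\<lambda>q. \<phi> q (r + k)) * coord_vec M (U, \<phi>) (r + k) p f)),
       (\<lambda>v. \<Sum>k<r. snd e (coord_vec M (U, \<phi>) k p) * differential M (\<lambda>q. \<phi> q k) p v))"
    and "r \<le> i \<Longrightarrow> e =
      ((\<lambda>f. \<Sum>k<s. fst e (\<lambda>q. \<phi> q (r + k)) * coord_vec M (U, \<phi>) (r + k) p f),
       (\<lambda>v. differential M (\<lambda>q. \<phi> q i) p v +
            (\<Sum>k<r. snd e (coord_vec M (U, \<phi>) k p) * differential M (\<lambda>q. \<phi> q k) p v)))"
proof -
  let ?c = "\<lambda>k. coord_vec M (U, \<phi>) k p" and ?d = "\<lambda>k. differential M (\<lambda>q. \<phi> q k) p"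
  have X: "fst e \<in> tangent_space M p" and A: "snd e \<in> cotangent_space M p"
    using e by (auto simp: gspace_def)
  have x: "fst e (\<lambda>q. \<phi> q k) = (if k = i then 1 else 0)" if "k < r" for k
    using dual[of k] that by (simp add: mixed_coord_def)
  have a: "snd e (?c (r + k)) = (if r + k = i then 1 else 0)" if "k < s" for k
    using dual[of "r + k"] that by (simp add: mixed_coord_def)
  have fst_e: "fst e f = (\<Sum>k<r. (if k = i then 1 else 0) * ?c k f) + (\<Sum>k<s. fst e (\<lambda>q. \<phi> q (r + k)) * ?c (r + k) f)" for f
    using fun_cong[OF tangent_expand[OF U X], of f] x unfolding n sum_lessThan_add by simp
  have snd_e: "snd e v = (\<Sum>k<r. snd e (?c k) * ?d k v) + (\<Sum>k<s. (if r + k = i then 1 else 0) * ?d (r + k) v)" for v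
    using fun_cong[OF cotangent_expand[OF U A], of v] a unfolding n sum_lessThan_add by simp
  show "e = ((\<lambda>f. ?c i f + (\<Sum>k<s. fst e (\<lambda>q. \<phi> q (r + k)) * ?c (r + k) f)), (\<lambda>v. \<Sum>k<r. snd e (?c k) * ?d k v))"
    if "i < r"
  proof (rule prod_eqI; rule ext)
    have h: "(\<Sum>k<r. (if k = i then 1 else 0) * ?c k f) = ?c i f" for f
      using that by (simp add: if_distrib[of "\<lambda>x. x * _"] cong: if_cong)
    show "fst e f = fst ((\<lambda>f. ?c i f + (\<Sum>k<s. fst e (\<lambda>q. \<phi> q (r + k)) * ?c (r + k) f)), (\<lambda>v. \<Sum>k<r. snd e (?c k) * ?d k v)) f" for f
      unfolding fst_conv using fst_e[of f] unfolding h by simp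
    have h': "(\<Sum>k<s. (if r + k = i then 1 else 0) * ?d (r + k) v) = 0" for v
      using that by (intro sum.neutral) simp
    show "snd e v = snd ((\<lambda>f. ?c i f + (\<Sum>k<s. fst e (\<lambda>q. \<phi> q (r + k)) * ?c (r + k) f)), (\<lambda>v. \<Sum>k<r. snd e (?c k) * ?d k v)) v" for v
      unfolding snd_conv using snd_e[of v] unfolding h' by simp
  qed
  show "e = ((\<lambda>f. \<Sum>k<s. fst e (\<lambda>q. \<phi> q (r + k)) * ?c (r + k) f), (\<lambda>v. ?d i v + (\<Sum>k<r. snd e (?c k) * ?d k v)))"
    if "r \<le> i"
  proof (rule prod_eqI; rule ext)
    have h: "(\<Sum>k<r. (if k = i then 1 else 0) * ?c k f) = 0" for f
      using that by (intro sum.neutral) simp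
    show "fst e f = fst ((\<lambda>f. \<Sum>k<s. fst e (\<lambda>q. \<phi> q (r + k)) * ?c (r + k) f), (\<lambda>v. ?d i v + (\<Sum>k<r. snd e (?c k) * ?d k v))) f" for f
      unfolding fst_conv using fst_e[of f] unfolding h by simp
    have "(\<Sum>k<s. (if r + k = i then 1 else 0) * ?d (r + k) v) = (\<Sum>k<s. if k = i - r then ?d i v else 0)" for v
      using that by (intro sum.cong) auto
    then have h': "(\<Sum>k<s. (if r + k = i then 1 else 0) * ?d (r + k) v) = ?d i v" for v
      using that i by simp
    show "snd e v = snd ((\<lambda>f. \<Sum>k<s. fst e (\<lambda>q. \<phi> q (r + k)) * ?c (r + k) f), (\<lambda>v. ?d i v + (\<Sum>k<r. snd e (?c k) * ?d k v))) v" for v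
      unfolding snd_conv using snd_e[of v] unfolding h' by simp
  qed
qed

text \<open>The coefficients of a section in the dual frame are its own mixed coordinates, so they
  depend smoothly on the point.\<close>

lemma sections_dual_frame:
  assumes U: "(U, \<phi>) \<in> matlas M" and n: "mdim M = r + s"
    and L: "smooth_subbundle M L" and iso: "\<And>p. p \<in> U \<Longrightarrow> isotropic (L p)"
    and \<tau>: "\<And>i. i < r + s \<Longrightarrow> \<tau> i \<in> sections M U L"
    and dual: "\<And>i j p. i < r + s \<Longrightarrow> j < r + s \<Longrightarrow> p \<in> U \<Longrightarrow>
      mixed_coord M (U, \<phi>) r i p (\<tau> j p) = (if i = j then 1 else 0)"
  shows "sections M U L = spanned_sections M U (\<tau> ` {..<r + s})"
proof (intro equalityI subsetI)
  fix \<sigma> assume \<sigma>: "\<sigma> \<in> sections M U L"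
  have lin: "linear_subspace M p (L p)" if "p \<in> U" for p
    using conjunct1[OF L[unfolded smooth_subbundle_def]] chart_subset[OF U] that by blast
  have "\<sigma> p = lincomb (r + s) (\<lambda>i. mixed_coord M (U, \<phi>) r i p (\<sigma> p)) (\<lambda>i. \<tau> i p)" if p: "p \<in> U" for p
    by (rule dual_frame_spans[OF U p n lin[OF p] iso[OF p]]) (use \<tau> \<sigma> p dual in \<open>auto simp: sections_def\<close>)
  moreover have "smooth_fun M U (\<lambda>p. mixed_coord M (U, \<phi>) r i p (\<sigma> p))" if "i < r + s" for i
    using mixed_coord_smooth[OF U subset_refl] \<sigma> that n by (simp add: sections_def)
  ultimately show "\<sigma> \<in> spanned_sections M U (\<tau> ` {..<r + s})"
    unfolding spanned_sections_def
    by (intro CollectI exI[of _ "r + s"] exI[of _ "\<lambda>i p. mixed_coord M (U, \<phi>) r i p (\<sigma> p)"] exI[of _ \<tau>]) auto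
next
  fix \<sigma> assume "\<sigma> \<in> spanned_sections M U (\<tau> ` {..<r + s})"
  then obtain k a e where *: "(\<forall>i<k. smooth_fun M U (a i) \<and> e i \<in> \<tau> ` {..<r + s}) \<and>
      (\<forall>p\<in>U. \<sigma> p = lincomb k (\<lambda>i. a i p) (\<lambda>i. e i p))"
    unfolding spanned_sections_def mem_Collect_eq by (elim exE)
  then have a: "\<And>i. i < k \<Longrightarrow> smooth_fun M U (a i)" and e: "\<And>i. i < k \<Longrightarrow> e i \<in> \<tau> ` {..<r + s}"
    and \<sigma>: "\<And>p. p \<in> U \<Longrightarrow> \<sigma> p = lincomb k (\<lambda>i. a i p) (\<lambda>i. e i p)"
    by simp_all
  have "e i \<in> sections M U L" if "i < k" for i using e[OF that] \<tau> by auto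
  from sections_combination[OF L chart_open[OF U] a this]
  have "(\<lambda>p. lincomb k (\<lambda>i. a i p) (\<lambda>i. e i p)) \<in> sections M U L" .
  then show "\<sigma> \<in> sections M U L"
    using gsection_cong[of U "\<lambda>p. lincomb k (\<lambda>i. a i p) (\<lambda>i. e i p)" \<sigma>] \<sigma> by (auto simp: sections_def)
qed

text \<open>The derivative of \<open>f\<close> along coordinate \<open>i\<close> is nonzero, so
  \<open>f\<close> can replace that coordinate; the function \<open>g\<close> recovering the old
  coordinate supplies the smooth inverse required for a new chart.\<close>

lemma chart_exchange:
  assumes W: "(W, \<psi>) \<in> matlas M" "p \<in> W" and f: "smooth_near M p f" and i: "i < mdim M"
    and nz: "coord_vec M (W, \<psi>) i p f \<noteq> 0"
  obtains W' \<theta> where "(W', \<theta>) \<in> matlas M" "p \<in> W'" "W' \<subseteq> W"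
    "\<And>q. q \<in> W' \<Longrightarrow> \<theta> q = (\<psi> q)(i := f q)"
proof -
  let ?n = "mdim M" and ?F = "f \<circ> inv_into W \<psi>"
  obtain S where S: "openin (Euclidean_space ?n) S" "\<psi> p \<in> S" "S \<subseteq> \<psi> ` W" "smooth_on ?n S ?F"
    using smooth_near_chartD[OF W f] .
  have "partial_deriv i ?F (\<psi> p) \<noteq> 0" using nz coord_vec_eq[OF f] by simp
  then obtain V g where V: "openin (Euclidean_space ?n) V" "\<psi> p \<in> V" "V \<subseteq> S" "inj_on (\<lambda>x. x(i := ?F x)) V"
    "openin (Euclidean_space ?n) ((\<lambda>x. x(i := ?F x)) ` V)"
    and g: "smooth_on ?n ((\<lambda>x. x(i := ?F x)) ` V) g" "\<And>x. x \<in> V \<Longrightarrow> g (x(i := ?F x)) = x i"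
    by (rule coordinate_replacement[OF S(1,4,2) i]) (rule that)
  have "({q \<in> W. \<psi> q \<in> V}, \<lambda>q. (\<lambda>x. x(i := ?F x)) (\<psi> q)) \<in> matlas M"
  proof (rule chart_compose[OF W(1) V(1) _ _ V(5), where \<Psi> = "\<lambda>y. y(i := g y)"])
    show "V \<subseteq> \<psi> ` W" using V(3) S(3) by blast
    show "smooth_on ?n V (\<lambda>x. (x(i := ?F x)) j)" for j
      using smooth_on_subset[OF S(4) V(3)] smooth_on_coord[OF V(1)] by (cases "j = i") (simp_all add: o_def)
    show "smooth_on ?n ((\<lambda>x. x(i := ?F x)) ` V) (\<lambda>y. (y(i := g y)) j)" for j
      using g(1) smooth_on_coord[OF V(5)] by (cases "j = i") simp_all
    show "(x(i := ?F x))(i := g (x(i := ?F x))) = x" if "x \<in> V" for x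
      unfolding g(2)[OF that] by simp
  qed
  then show ?thesis
    by (rule that) (use W V(2) chart_inv[OF W(1)] in auto)
qed

end

section \<open>Immersed submanifolds and their coordinates\<close>

lemma smooth_embedding_image_open:
  assumes S: "openin (Euclidean_space n) S" and \<Phi>: "\<And>x. x \<in> S \<Longrightarrow> \<Phi> x \<in> topspace (Euclidean_space n)"
    "\<And>i. i < n \<Longrightarrow> smooth_on n S (\<lambda>x. \<Phi> x i)" and inj: "inj_on \<Phi> S"
  shows "openin (Euclidean_space n) (\<Phi> ` S)"
  by (rule invariance_of_domain_Euclidean_space[OF S continuous_map_Euclidean_space_smooth[OF S \<Phi>] inj])

text \<open>Serves to reorder the coordinates of the ambient manifold so that those shared with the
  submanifold come first. The complements of the two index sets have the same size, hence a
  bijection between them exists.\<close>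

lemma extend_to_permutation:
  fixes \<tau> :: "nat \<Rightarrow> nat"
  assumes inj: "inj_on \<tau> {..<r}" and sub: "\<tau> ` {..<r} \<subseteq> {..<r + s}"
  obtains \<pi> where "bij_betw \<pi> {..<r + s} {..<r + s}" "\<And>i. i < r \<Longrightarrow> \<pi> i = \<tau> i"
proof -
  let ?C = "{..<r + s} - \<tau> ` {..<r}"
  have "card ?C = (r + s) - r"
    using card_Diff_subset[OF _ sub] card_image[OF inj] by simp
  then have "card {r..<r + s} = card ?C" by simp
  then obtain g where g: "bij_betw g {r..<r + s} ?C"
    using finite_same_card_bij[of "{r..<r + s}" ?C] by auto
  define \<pi> where "\<pi> i = (if i < r then \<tau> i else g i)" for i
  have "bij_betw \<pi> {..<r} (\<tau> ` {..<r})"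
    using inj by (auto simp: bij_betw_def \<pi>_def inj_on_def image_def)
  moreover have "bij_betw \<pi> {r..<r + s} ?C"
    using g by (subst bij_betw_cong[of _ \<pi> g]) (auto simp: \<pi>_def)
  ultimately have "bij_betw \<pi> ({..<r} \<union> {r..<r + s}) (\<tau> ` {..<r} \<union> ?C)"
    by (rule bij_betw_combine) auto
  moreover have "{..<r} \<union> {r..<r + s} = {..<r + s}" by auto
  moreover have "\<tau> ` {..<r} \<union> ?C = {..<r + s}" using sub by auto
  ultimately show ?thesis using that by (simp add: \<pi>_def)
qed

locale immersed = M: smooth_mfd M + N: smooth_mfd N for M N :: "'m manifold" +
  assumes immersed: "immersed_submanifold N M"
begin

lemma inclusion_smooth_fun:
  assumes "smooth_fun M A f" shows "smooth_fun N {p \<in> mcarrier N. p \<in> A} f"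
proof -
  have "smooth_map N M (\<lambda>q. q)" using immersed unfolding immersed_submanifold_def by (elim conjE)
  then show ?thesis using assms unfolding smooth_map_def o_def by blast
qed

lemma inclusion_open: "openin (mtop M) A \<Longrightarrow> openin (mtop N) {p \<in> mcarrier N. p \<in> A}"
  using N.smooth_fun_open[OF inclusion_smooth_fun[OF M.smooth_fun_const]] .

lemma inclusion_smooth_near: "smooth_near M p f \<Longrightarrow> p \<in> mcarrier N \<Longrightarrow> smooth_near N p f"
proof -
  assume "smooth_near M p f" and p: "p \<in> mcarrier N"
  then obtain A where "p \<in> A" "smooth_fun M A f" by (auto simp: smooth_near_def)
  then show "smooth_near N p f"
    using N.smooth_nearI[OF inclusion_smooth_fun] p by simp
qed

lemma pushforward_near: "smooth_near M p f \<Longrightarrow> pushforward N M (\<lambda>q. q) p v f = v f"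
  by (simp add: pushforward_def o_def)

lemma pushforward_tangent:
  assumes p: "p \<in> mcarrier N" and v: "v \<in> tangent_space N p"
  shows "pushforward N M (\<lambda>q. q) p v \<in> tangent_space M p"
proof -
  have pM: "p \<in> mcarrier M" using immersed p by (auto simp: immersed_submanifold_def)
  show ?thesis
    unfolding tangent_space_def
  proof (intro CollectI conjI allI impI; (elim conjE)?)
    show "pushforward N M (\<lambda>q. q) p v f = 0" if "\<not> smooth_near M p f" for f
      using that by (simp add: pushforward_def)
    fix f g assume f: "smooth_near M p f" and g: "smooth_near M p g"
    show "pushforward N M (\<lambda>q. q) p v (\<lambda>q. f q * g q) =
        f p * pushforward N M (\<lambda>q. q) p v g + g p * pushforward N M (\<lambda>q. q) p v f"
      using N.tangent_leibniz[OF v] f g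
      by (simp add: pushforward_near M.smooth_near_mult inclusion_smooth_near p)
    show "pushforward N M (\<lambda>q. q) p v (\<lambda>q. a * f q + b * g q) =
        a * pushforward N M (\<lambda>q. q) p v f + b * pushforward N M (\<lambda>q. q) p v g" for a b
    proof -
      have "smooth_near M p (\<lambda>q. a * f q + b * g q)"
        by (intro M.smooth_near_add M.smooth_near_mult f g M.smooth_near_const[OF pM])
      then show ?thesis
        using N.tangent_linear[OF v] f g by (simp add: pushforward_near inclusion_smooth_near p)
    qed
  qed
qed

text \<open>Induction on the number of coordinates of \<open>N\<close> already exchanged. The next
  coordinate vector of \<open>N\<close> is nonzero, and so is its pushforward because the inclusion
  is an immersion; thus some coordinate of \<open>M\<close> has a nonzero derivative along it and
  can be exchanged in.\<close>

lemma immersion_coordinates: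
  assumes U: "(U, \<phi>) \<in> matlas M" "m0 \<in> U" and m0: "m0 \<in> mcarrier N" and m: "m \<le> mdim N"
  shows "\<exists>W \<psi> \<tau>. (W, \<psi>) \<in> matlas N \<and> m0 \<in> W \<and> W \<subseteq> U \<and> inj_on \<tau> {..<m} \<and> \<tau> ` {..<m} \<subseteq> {..<mdim M} \<and>
    (\<forall>q\<in>W. \<forall>i<m. \<psi> q i = \<phi> q (\<tau> i))"
  using m
proof (induction m)
  case 0
  obtain c where "c \<in> matlas N" "m0 \<in> fst c" using bspec[OF N.smooth_manifoldD(2) m0] by blast
  then have c: "(fst c, snd c) \<in> matlas N" "m0 \<in> fst c" by simp_all
  have "openin (mtop N) (fst c \<inter> {p \<in> mcarrier N. p \<in> U})"
    using N.chart_open[OF c(1)] inclusion_open[OF M.chart_open[OF U(1)]] by (rule openin_Int)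
  from N.chart_restrict[OF c(1) this] show ?case
    using c(2) m0 U(2) by (intro exI[of _ "fst c \<inter> {p \<in> mcarrier N. p \<in> U}"] exI[of _ "snd c"] exI[of _ id]) auto
next
  case (Suc m)
  have "m \<le> mdim N" using Suc.prems by simp
  from Suc.IH[OF this] obtain W \<psi> \<tau> where W: "(W, \<psi>) \<in> matlas N" "m0 \<in> W" "W \<subseteq> U" and inj: "inj_on \<tau> {..<m}"
    and sub: "\<tau> ` {..<m} \<subseteq> {..<mdim M}" and \<psi>: "\<And>q i. q \<in> W \<Longrightarrow> i < m \<Longrightarrow> \<psi> q i = \<phi> q (\<tau> i)"
    by (elim exE conjE) metis
  have mN: "m < mdim N" using Suc.prems by simp
  define v where "v = coord_vec N (W, \<psi>) m m0"
  have v: "v \<in> tangent_space N m0" unfolding v_def by (rule N.coord_vec_tangent[OF W(1,2) mN])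
  have near: "smooth_near N m0 (\<lambda>q. \<phi> q j)" for j
    by (rule inclusion_smooth_near[OF M.smooth_near_coord[OF U] m0])
  have "\<exists>j<mdim M. v (\<lambda>q. \<phi> q j) \<noteq> 0"
  proof (rule ccontr)
    assume *: "\<not> ?thesis"
    let ?P = "pushforward N M (\<lambda>q. q) m0"
    have "?P v = (\<lambda>f. 0)"
    proof (rule M.tangent_eqI[OF U pushforward_tangent[OF m0 v] M.zero_tangent])
      show "?P v (\<lambda>q. \<phi> q j) = 0" if "j < mdim M" for j
        using * that by (simp add: pushforward_near M.smooth_near_coord[OF U])
    qed
    also have "\<dots> = ?P (\<lambda>f. 0)" by (auto simp: pushforward_def)
    finally have "?P v = ?P (\<lambda>f. 0)" .
    moreover have "inj_on ?P (tangent_space N m0)"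
      using immersed m0 unfolding immersed_submanifold_def by blast
    ultimately have "v = (\<lambda>f. 0)" using v N.zero_tangent by (auto simp: inj_on_def)
    then show False using N.coord_vec_coord[OF W(1,2) mN, of m] by (simp add: v_def)
  qed
  then obtain j where j: "j < mdim M" "v (\<lambda>q. \<phi> q j) \<noteq> 0" by blast
  \<comment> \<open>The coordinates exchanged before are now among the coordinates of
    \<open>N\<close>, and the coordinate vector with index \<open>m\<close> annihilates those below
    \<open>m\<close>.\<close>
  have jnew: "j \<notin> \<tau> ` {..<m}"
  proof
    assume "j \<in> \<tau> ` {..<m}"
    then obtain i where i: "i < m" "j = \<tau> i" by auto
    have "v (\<lambda>q. \<phi> q j) = v (\<lambda>q. \<psi> q i)"
      by (rule N.tangent_local[OF v near N.chart_open[OF W(1)] W(2)]) (simp add: \<psi> i)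
    then show False using j(2) i(1) N.coord_vec_coord[OF W(1,2) mN, of i] by (simp add: v_def)
  qed
  obtain W' \<theta> where W': "(W', \<theta>) \<in> matlas N" "m0 \<in> W'" "W' \<subseteq> W"
    and \<theta>: "\<And>q. q \<in> W' \<Longrightarrow> \<theta> q = (\<psi> q)(m := \<phi> q j)"
    using N.chart_exchange[OF W(1,2) near mN j(2)[unfolded v_def]] by metis
  let ?\<tau> = "\<tau>(m := j)"
  have "inj_on ?\<tau> {..<Suc m}"
    using inj jnew by (auto simp: inj_on_def less_Suc_eq)
  moreover have "?\<tau> ` {..<Suc m} \<subseteq> {..<mdim M}" using sub j(1) by (auto simp: less_Suc_eq image_subset_iff)
  moreover have "\<theta> q i = \<phi> q (?\<tau> i)" if "q \<in> W'" "i < Suc m" for q i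
    using \<theta>[OF that(1)] \<psi>[of q i] that W'(3) by (auto simp: less_Suc_eq)
  ultimately show ?case
    using W' W(3)
    by (intro exI[of _ W'] exI[of _ \<theta>] exI[of _ ?\<tau>] conjI ballI allI impI) (blast | simp only:)+
qed

end

section \<open>Charts adapted to an immersed submanifold\<close>

context immersed
begin

text \<open>Once the first \<open>r\<close> reordered coordinates of \<open>M\<close> restrict to
  the coordinates of \<open>N\<close>, the piece \<open>W\<close> is a graph over them. Subtracting
  the graph function from the remaining coordinates, a shear, flattens it; a shear is undone by
  adding the function back, so its inverse is explicit.\<close>

lemma adapted_chart:
  assumes m0: "m0 \<in> mcarrier N" and n: "mdim M = r + s" and r: "mdim N = r"
  obtains U \<theta> W \<psi> where "(U, \<theta>) \<in> matlas M" "(W, \<psi>) \<in> matlas N" "m0 \<in> W"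
    "W = {p \<in> U. \<forall>j<s. \<theta> p (r + j) = 0}" "\<And>q i. q \<in> W \<Longrightarrow> i < r \<Longrightarrow> \<psi> q i = \<theta> q i"
proof -
  let ?E = "Euclidean_space (r + s)"
  have "m0 \<in> mcarrier M" using immersed m0 by (auto simp: immersed_submanifold_def)
  then obtain c where "c \<in> matlas M" "m0 \<in> fst c" using bspec[OF M.smooth_manifoldD(2)] by blast
  then obtain U \<phi> where U: "(U, \<phi>) \<in> matlas M" "m0 \<in> U" by (metis prod.collapse)
  have "r \<le> mdim N" using r by simp
  from immersion_coordinates[OF U m0 this] obtain W \<psi> \<tau> where W: "(W, \<psi>) \<in> matlas N" "m0 \<in> W" "W \<subseteq> U"
    and \<tau>: "inj_on \<tau> {..<r}" "\<tau> ` {..<r} \<subseteq> {..<r + s}" and \<psi>\<tau>: "\<And>q i. q \<in> W \<Longrightarrow> i < r \<Longrightarrow> \<psi> q i = \<phi> q (\<tau> i)"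
    unfolding n by (elim exE conjE) metis
  obtain \<pi> where \<pi>: "bij_betw \<pi> {..<r + s} {..<r + s}" and \<pi>\<tau>: "\<And>i. i < r \<Longrightarrow> \<pi> i = \<tau> i"
    by (rule extend_to_permutation[OF \<tau>]) (rule that)
  define \<pi>' where "\<pi>' = inv_into {..<r + s} \<pi>"
  have \<pi>': "\<pi>' l < r + s" "\<pi> (\<pi>' l) = l" if "l < r + s" for l
    using that \<pi> bij_betw_inv_into_right[OF \<pi>, of l] inv_into_into[of l \<pi> "{..<r + s}"]
    by (auto simp: \<pi>'_def bij_betw_def)
  have \<psi>\<pi>: "\<psi> q i = \<phi> q (\<pi> i)" if "q \<in> W" "i < r" for q i
    using \<psi>\<tau> \<pi>\<tau> that by simp
  \<comment> \<open>\<open>R\<close> extracts the leaf coordinates from the old coordinates of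
    \<open>M\<close>, \<open>Q\<close> from the sheared ones. \<open>h j\<close> is the height
    function whose graph is \<open>W\<close>.\<close>
  define R where "R x = (\<lambda>k. if k < r then x (\<pi> k) else 0)" for x :: "nat \<Rightarrow> real"
  define Q where "Q y = (\<lambda>k. if k < r then y k else 0)" for y :: "nat \<Rightarrow> real"
  define h where "h j x = \<phi> (inv_into W \<psi> x) (\<pi> (r + j))" for j x
  have oW: "openin (Euclidean_space r) (\<psi> ` W)" using N.chart_image_open[OF W(1)] r by simp
  have R\<phi>: "R (\<phi> q) = \<psi> q" if "q \<in> W" for q
    using \<psi>\<pi>[OF that] N.chart_range[OF W(1) that] r by (auto simp: R_def topspace_Euclidean_space fun_eq_iff)
  have h\<psi>: "h j (\<psi> q) = \<phi> q (\<pi> (r + j))" if "q \<in> W" for j q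
    using N.chart_inv[OF W(1) that] by (simp add: h_def)
  have h: "smooth_on r (\<psi> ` W) (h j)" for j
  proof -
    have "smooth_fun N W (\<lambda>q. \<phi> q (\<pi> (r + j)))"
      by (rule N.smooth_fun_subset[OF inclusion_smooth_fun[OF M.smooth_fun_coord[OF U(1)]] N.chart_open[OF W(1)]])
        (use W(3) N.chart_subset[OF W(1)] in auto)
    from N.smooth_fun_chartD[OF this W(1) subset_refl] show ?thesis
      unfolding r h_def by (simp only: o_def)
  qed
  have oU: "openin ?E (\<phi> ` U)" using M.chart_image_open[OF U(1)] n by simp
  have Rs: "smooth_on (r + s) A (\<lambda>x. R x k)" if "openin ?E A" for A k
    using smooth_on_coord[OF that] smooth_on_const by (cases "k < r") (simp_all add: R_def)
  have Qs: "smooth_on (r + s) A (\<lambda>x. Q x k)" if "openin ?E A" for A k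
    using smooth_on_coord[OF that] smooth_on_const by (cases "k < r") (simp_all add: Q_def)
  \<comment> \<open>Only points whose leaf coordinates come from \<open>W\<close> are kept. There
    the height functions are defined, and there is a point of \<open>W\<close> with the same leaf
    coordinates.\<close>
  define S where "S = {x \<in> \<phi> ` U. R x \<in> \<psi> ` W}"
  have S: "openin ?E S"
  proof -
    have "continuous_map (subtopology ?E (\<phi> ` U)) (Euclidean_space r) R"
      by (rule continuous_map_Euclidean_space_smooth[OF oU _ Rs[OF oU]]) (simp add: R_def topspace_Euclidean_space)
    from openin_continuous_map_preimage[OF this oW] show ?thesis
      using oU openin_subset[OF oU] by (simp add: S_def Int_absorb1 openin_open_subtopology)
  qed
  define \<Phi> where "\<Phi> x i = (if i < r then x (\<pi> i) else if i < r + s then x (\<pi> i) + (- 1) * h (i - r) (R x) else 0)" for x i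
  define \<Psi> where "\<Psi> y l = (if l < r + s then if \<pi>' l < r then y (\<pi>' l) else y (\<pi>' l) + h (\<pi>' l - r) (Q y) else 0)" for y l
  have Q\<Phi>: "Q (\<Phi> x) = R x" for x by (auto simp: Q_def R_def \<Phi>_def)
  have \<Psi>\<Phi>: "\<Psi> (\<Phi> x) = x" if "x \<in> S" for x
  proof
    fix l
    show "\<Psi> (\<Phi> x) l = x l"
    proof (cases "l < r + s")
      case True
      then show ?thesis using \<pi>'[OF True] by (auto simp: \<Psi>_def Q\<Phi>) (simp_all add: \<Phi>_def)
    next
      case False
      then show ?thesis using open_in_Euclidean_space_zero[OF S that] by (simp add: \<Psi>_def)
    qed
  qed
  have \<Phi>s: "smooth_on (r + s) S (\<lambda>x. \<Phi> x i)" for i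
  proof -
    have "smooth_on (r + s) S (\<lambda>x. x (\<pi> i) + (- 1) * h (i - r) (R x))"
      by (intro smooth_on_add[OF S] smooth_on_mult[OF S] smooth_on_const smooth_on_coord[OF S]
          smooth_on_compose[OF S oW _ h Rs[OF S]]) (simp add: S_def)
    then show ?thesis
      using smooth_on_coord[OF S] smooth_on_const by (cases "i < r"; cases "i < r + s") (simp_all add: \<Phi>_def)
  qed
  have \<Phi>S: "openin ?E (\<Phi> ` S)"
  proof (rule smooth_embedding_image_open[OF S _ \<Phi>s])
    show "\<Phi> x \<in> topspace ?E" for x by (simp add: \<Phi>_def topspace_Euclidean_space)
    show "inj_on \<Phi> S" using \<Psi>\<Phi> by (metis inj_onI)
  qed
  have \<Psi>s: "smooth_on (r + s) (\<Phi> ` S) (\<lambda>y. \<Psi> y l)" for l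
  proof -
    have "smooth_on (r + s) (\<Phi> ` S) (\<lambda>y. y (\<pi>' l) + h (\<pi>' l - r) (Q y))"
      by (intro smooth_on_add[OF \<Phi>S] smooth_on_coord[OF \<Phi>S] smooth_on_compose[OF \<Phi>S oW _ h Qs[OF \<Phi>S]])
        (auto simp: S_def Q\<Phi>)
    then show ?thesis
      using smooth_on_coord[OF \<Phi>S] smooth_on_const by (cases "\<pi>' l < r"; cases "l < r + s") (simp_all add: \<Psi>_def)
  qed
  let ?U = "{p \<in> U. \<phi> p \<in> S}" and ?\<theta> = "\<lambda>p. \<Phi> (\<phi> p)"
  have chart: "(?U, ?\<theta>) \<in> matlas M"
    by (rule M.chart_compose[OF U(1), of S \<Phi> \<Psi>, unfolded n, OF S _ \<Phi>s \<Phi>S \<Psi>s \<Psi>\<Phi>]) (auto simp: S_def)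
  have \<theta>x: "?\<theta> p i = \<phi> p (\<pi> i)" if "i < r" for p i using that by (simp add: \<Phi>_def)
  have \<theta>y: "?\<theta> p (r + j) = \<phi> p (\<pi> (r + j)) - h j (R (\<phi> p))" if "j < s" for p j
    using that by (simp add: \<Phi>_def)
  have "W = {p \<in> ?U. \<forall>j<s. ?\<theta> p (r + j) = 0}"
  proof (intro equalityI subsetI)
    fix q assume q: "q \<in> W"
    then show "q \<in> {p \<in> ?U. \<forall>j<s. ?\<theta> p (r + j) = 0}"
      using W(3) by (auto simp: S_def R\<phi> \<theta>y h\<psi> simp del: add_less_cancel_left)
  next
    \<comment> \<open>By the choice of \<open>S\<close> some \<open>q\<close> in \<open>W\<close>
      has the leaf coordinates of \<open>p\<close>. Vanishing of the sheared coordinates gives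
      \<open>p\<close> the heights of \<open>q\<close>, so all coordinates agree. Hence no other
      sheet of \<open>N\<close> can contribute to the slice.\<close>
    fix p assume p: "p \<in> {p \<in> ?U. \<forall>j<s. ?\<theta> p (r + j) = 0}"
    then have pU: "p \<in> U" and "R (\<phi> p) \<in> \<psi> ` W" by (auto simp: S_def)
    then obtain q where q: "q \<in> W" "R (\<phi> p) = \<psi> q" by auto
    have y: "\<phi> p (\<pi> (r + j)) = \<phi> q (\<pi> (r + j))" if "j < s" for j
      using p \<theta>y[OF that, of p] that q(2) h\<psi>[OF q(1)] by simp
    have x: "\<phi> p (\<pi> i) = \<phi> q (\<pi> i)" if "i < r" for i
      using fun_cong[OF q(2), of i] \<psi>\<pi>[OF q(1) that] that by (simp add: R_def)
    have "\<phi> p l = \<phi> q l" for l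
    proof (cases "l < r + s")
      case True
      have "\<phi> p (\<pi> (\<pi>' l)) = \<phi> q (\<pi> (\<pi>' l))"
        using x[of "\<pi>' l"] y[of "\<pi>' l - r"] \<pi>'(1)[OF True] by (cases "\<pi>' l < r") auto
      then show ?thesis using \<pi>'(2)[OF True] by simp
    next
      case False
      then show ?thesis
        using open_in_Euclidean_space_zero[OF oU] pU q(1) W(3) by (metis imageI not_less subsetD)
    qed
    then have "\<phi> p = \<phi> q" by blast
    then show "p \<in> W" using M.chart_inj[OF U(1)] pU q(1) W(3) by (auto simp: inj_on_def)
  qed
  then show ?thesis
    using that[OF chart W(1,2)] \<theta>x \<psi>\<pi> by simp
qed

text \<open>The coordinates y_j vanish on \<open>W\<close>, which is open in \<open>N\<close>, so a
  pushed forward vector annihilates them. Conversely, a vector annihilating them is determined by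
  its first \<open>r\<close> components, and these are realised by a combination of coordinate
  vectors of \<open>N\<close>.\<close>

lemma submanifold_tangent_space:
  assumes U: "(U, \<theta>) \<in> matlas M" and W: "(W, \<psi>) \<in> matlas N" "m0 \<in> W"
    and n: "mdim M = r + s" and r: "mdim N = r"
    and WU: "W = {p \<in> U. \<forall>j<s. \<theta> p (r + j) = 0}" and \<psi>: "\<And>q i. q \<in> W \<Longrightarrow> i < r \<Longrightarrow> \<psi> q i = \<theta> q i"
  shows "pushforward N M (\<lambda>q. q) m0 ` tangent_space N m0 =
    {v \<in> tangent_space M m0. \<forall>j<s. v (\<lambda>q. \<theta> q (r + j)) = 0}"
proof -
  let ?P = "pushforward N M (\<lambda>q. q) m0"
  have m0: "m0 \<in> mcarrier N" "m0 \<in> U"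
    using N.chart_subset[OF W(1)] W(2) WU by auto
  have nearM: "smooth_near M m0 (\<lambda>q. \<theta> q k)" for k by (rule M.smooth_near_coord[OF U m0(2)])
  have nearN: "smooth_near N m0 (\<lambda>q. \<theta> q k)" for k by (rule inclusion_smooth_near[OF nearM m0(1)])
  have Py: "?P v (\<lambda>q. \<theta> q (r + j)) = 0" if "v \<in> tangent_space N m0" "j < s" for v j
  proof -
    have "v (\<lambda>q. \<theta> q (r + j)) = v (\<lambda>q. 0)"
      by (rule N.tangent_local[OF that(1) nearN N.chart_open[OF W(1)] W(2)]) (use WU that(2) in auto)
    then show ?thesis using N.tangent_const[OF that(1)] by (simp add: pushforward_near[OF nearM])
  qed
  have Px: "?P v (\<lambda>q. \<theta> q i) = v (\<lambda>q. \<psi> q i)" if "v \<in> tangent_space N m0" "i < r" for v i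
    unfolding pushforward_near[OF nearM]
    by (rule N.tangent_local[OF that(1) nearN N.chart_open[OF W(1)] W(2)]) (simp add: \<psi> that(2))
  show ?thesis
  proof (intro equalityI subsetI)
    fix u assume "u \<in> ?P ` tangent_space N m0"
    then show "u \<in> {v \<in> tangent_space M m0. \<forall>j<s. v (\<lambda>q. \<theta> q (r + j)) = 0}"
      using pushforward_tangent[OF m0(1)] Py by auto
  next
    fix u assume u: "u \<in> {v \<in> tangent_space M m0. \<forall>j<s. v (\<lambda>q. \<theta> q (r + j)) = 0}"
    define v where "v = (\<lambda>f. \<Sum>i<r. u (\<lambda>q. \<theta> q i) * coord_vec N (W, \<psi>) i m0 f)"
    have v: "v \<in> tangent_space N m0"
      unfolding v_def by (rule N.tangent_sum[OF m0(1)]) (use N.coord_vec_tangent[OF W] r in auto)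
    have vk: "v (\<lambda>q. \<psi> q k) = u (\<lambda>q. \<theta> q k)" if "k < r" for k
    proof -
      have "v (\<lambda>q. \<psi> q k) = (\<Sum>i<r. u (\<lambda>q. \<theta> q i) * (if i = k then 1 else 0))"
        unfolding v_def by (intro sum.cong) (use N.coord_vec_coord[OF W] r in auto)
      then show ?thesis using that by (simp add: if_distrib[of "\<lambda>x. _ * x"] cong: if_cong)
    qed
    have "?P v = u"
    proof (rule M.tangent_eqI[OF U m0(2) pushforward_tangent[OF m0(1) v]])
      show "u \<in> tangent_space M m0" using u by simp
      show "?P v (\<lambda>q. \<theta> q k) = u (\<lambda>q. \<theta> q k)" if "k < mdim M" for k
      proof (cases "k < r")
        case True
        then show ?thesis using Px[OF v True] vk[OF True] by simp
      next
        case False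
        then have k: "r + (k - r) = k" "k - r < s" using that n by auto
        have "?P v (\<lambda>q. \<theta> q (r + (k - r))) = u (\<lambda>q. \<theta> q (r + (k - r)))"
          using Py[OF v k(2)] u k(2) by simp
        then show ?thesis unfolding k(1) .
      qed
    qed
    then show "u \<in> ?P ` tangent_space N m0" using v by blast
  qed
qed

end

section \<open>Plaques in cubes\<close>

lemma connectedin_ecube: "connectedin (Euclidean_space n) (ecube n a e)"
proof -
  let ?S = "\<lambda>i. if i < n then ball (a i) e else {0}"
  have "ecube n a e = PiE UNIV ?S"
    by (auto simp: ecube_def PiE_UNIV_domain Pi_iff dist_real_def abs_minus_commute split: if_splits)
  moreover have "connectedin (powertop_real UNIV) (PiE UNIV ?S)"
    by (subst connectedin_PiE) (auto intro: convex_connected)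
  ultimately show ?thesis
    by (simp add: Euclidean_space_def connectedin_subtopology) (auto simp: ecube_def)
qed

context immersed
begin

text \<open>The slice corresponds to a cube in the coordinates of the leaf, so it is connected and
  open in the leaf topology. It is also closed in the part of the leaf inside \<open>U'\<close>, so
  no connected set there can leave it, even if the leaf passes through \<open>U'\<close>
  again.\<close>

lemma plaque_in_cube:
  assumes U: "(U, \<theta>) \<in> matlas M" and W: "(W, \<psi>) \<in> matlas N" "m0 \<in> W"
    and n: "mdim M = r + s" and r: "mdim N = r"
    and WU: "W = {p \<in> U. \<forall>j<s. \<theta> p (r + j) = 0}" and \<psi>: "\<And>q i. q \<in> W \<Longrightarrow> i < r \<Longrightarrow> \<psi> q i = \<theta> q i"
    and e: "e > 0" "ecube (r + s) (\<theta> m0) e \<subseteq> \<theta> ` U"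
    and U': "U' = {p \<in> U. \<theta> p \<in> ecube (r + s) (\<theta> m0) e}"
  shows "plaque N U' m0 = {p \<in> U'. \<forall>j<s. \<theta> p (r + j) = 0}"
proof -
  let ?C = "ecube r (\<psi> m0) e" and ?P = "{p \<in> U'. \<forall>j<s. \<theta> p (r + j) = 0}"
  have m0: "m0 \<in> U" "\<And>j. j < s \<Longrightarrow> \<theta> m0 (r + j) = 0" using W(2) WU by auto
  have \<theta>0: "\<theta> p k = 0" if "p \<in> U" "r + s \<le> k" for p k
    using M.chart_range[OF U that(1)] that(2) n by (simp add: topspace_Euclidean_space)
  have \<psi>0: "\<psi> q k = 0" if "q \<in> W" "r \<le> k" for q k
    using N.chart_range[OF W(1) that(1)] that(2) r by (simp add: topspace_Euclidean_space)
  \<comment> \<open>The coordinate tuples agree entirely: between \<open>r\<close> and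
    \<open>r + s\<close> by the slice equation, beyond that because coordinates out of range are
    0.\<close>
  have \<theta>W: "\<theta> q = \<psi> q" if q: "q \<in> W" for q
  proof
    fix k
    consider "k < r" | "r \<le> k" "k < r + s" | "r + s \<le> k" by linarith
    then show "\<theta> q k = \<psi> q k"
    proof cases
      case 2
      then have "k - r < s" by simp
      then have "\<theta> q (r + (k - r)) = 0" using q[unfolded WU] by blast
      then show ?thesis using 2 \<psi>0[OF q] by simp
    qed (use \<psi>[OF q] \<psi>0[OF q] \<theta>0 q WU in auto)
  qed
  have cube: "x \<in> ecube (r + s) (\<theta> m0) e \<longleftrightarrow> x \<in> ?C" if "\<And>k. r \<le> k \<Longrightarrow> x k = 0" for x
  proof -
    have "\<bar>x i - \<psi> m0 i\<bar> < e" if "\<not> i < r" for i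
      using \<open>\<And>k. r \<le> k \<Longrightarrow> x k = 0\<close>[of i] \<psi>0[OF W(2), of i] e(1) that by simp
    then show ?thesis
      unfolding \<theta>W[OF W(2)] ecube_def mem_Collect_eq using that
      by (metis le_add1 order_trans trans_less_add1)
  qed
  have P: "?P = {q \<in> W. \<psi> q \<in> ?C}"
  proof -
    have "q \<in> U' \<longleftrightarrow> \<psi> q \<in> ?C" if "q \<in> W" for q
      using cube[of "\<psi> q"] \<theta>W[OF that] \<psi>0[OF that] that WU by (simp add: U')
    then show ?thesis using WU U' by blast
  qed
  have "\<psi> ` ?P = ?C"
  proof (intro equalityI subsetI)
    fix x assume x: "x \<in> ?C"
    then have x0: "\<And>k. r \<le> k \<Longrightarrow> x k = 0" by (simp add: ecube_def)
    then have "x \<in> \<theta> ` U" using cube[of x] x e(2) by blast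
    then obtain p where p: "p \<in> U" "x = \<theta> p" by auto
    then have "p \<in> W" using x0 by (simp add: WU)
    then show "x \<in> \<psi> ` ?P" unfolding P using \<theta>W x p by auto
  qed (auto simp: P)
  moreover have "connectedin (subtopology (Euclidean_space r) (\<psi> ` W)) ?C"
    using calculation P connectedin_ecube by (auto simp: connectedin_subtopology)
  ultimately have "connectedin (subtopology (mtop N) W) ?P"
    using homeomorphic_map_connectedness[OF N.chart_homeomorphic[OF W(1)], of ?P] N.chart_subset[OF W(1)] P r
    by (auto simp: Int_absorb1)
  then have con: "connectedin (mtop N) ?P" by (simp add: connectedin_subtopology)
  have WN: "W \<subseteq> mcarrier N" by (rule N.chart_subset[OF W(1)])
  let ?X = "subtopology (mtop N) (U' \<inter> mcarrier N)"
  have conX: "connectedin ?X ?P"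
    using con P WN by (auto simp: connectedin_subtopology)
  have m0P: "m0 \<in> ?P"
    using m0 M.chart_range[OF U m0(1)] e(1) n by (auto simp: U' intro: centre_in_ecube)
  have oP: "openin (mtop N) ?P"
    unfolding P using N.chart_vimage_open[OF W(1)] openin_ecube r by metis
  have opX: "openin ?X ?P"
    unfolding openin_subtopology using oP P WN by (intro exI[of _ ?P]) auto
  have oU': "openin (mtop M) U'"
    unfolding U' using M.chart_vimage_open[OF U] openin_ecube n by metis
  have U'U: "U' \<subseteq> U" by (auto simp: U')
  \<comment> \<open>The complement is the union of the sets where some y_j is nonzero. They are open
    in \<open>M\<close> and hence in the possibly finer topology of the leaf.\<close>
  have "closedin ?X ?P"
  proof -
    have "openin (mtop M) (\<Union>j<s. {p \<in> U'. \<theta> p (r + j) \<in> - {0}})"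
      by (intro openin_Union ballI; clarify)
        (rule M.smooth_fun_continuous_open[OF M.smooth_fun_subset[OF M.smooth_fun_coord[OF U] oU' U'U]
            open_Compl[OF closed_singleton]])
    then have "openin ?X {p \<in> mcarrier N. p \<in> (\<Union>j<s. {p \<in> U'. \<theta> p (r + j) \<in> - {0}})}"
      unfolding openin_subtopology
      by (intro exI[of _ "{p \<in> mcarrier N. p \<in> (\<Union>j<s. {p \<in> U'. \<theta> p (r + j) \<in> - {0}})}"] conjI inclusion_open) auto
    moreover have "topspace ?X - ?P = {p \<in> mcarrier N. p \<in> (\<Union>j<s. {p \<in> U'. \<theta> p (r + j) \<in> - {0}})}"
      by auto
    ultimately show ?thesis
      using P WN by (auto simp: closedin_def)
  qed
  then have "connected_component_of_set ?X m0 \<subseteq> ?P \<or> disjnt (connected_component_of_set ?X m0) ?P"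
    using connectedin_clopen_cases[OF connectedin_connected_component_of _ opX] by blast
  moreover have sub: "?P \<subseteq> connected_component_of_set ?X m0"
    by (rule connected_component_of_maximal[OF conX m0P])
  ultimately have "connected_component_of_set ?X m0 = ?P"
    using m0P by (auto simp: disjnt_iff)
  then show ?thesis by (simp add: plaque_def)
qed

end

section \<open>The local normal form\<close>

theorem theorem3p2:
  fixes M N :: "'m manifold" and L :: "'m \<Rightarrow> 'm gvec set" and m0 :: 'm and r s :: nat
  assumes "smooth_manifold M"
    and "dirac_structure M L"
    and "m0 \<in> mcarrier M"
    and "presymplectic_leaf M L N"
    and "m0 \<in> mcarrier N"
    and "r = mdim N"
    and "r + s = mdim M"
  shows "\<exists>U \<phi>. (U, \<phi>) \<in> matlas M \<and> m0 \<in> U \<and>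
    plaque N U m0 = {p \<in> U. \<forall>j<s. \<phi> p (r + j) = 0} \<and>
    (embedded N M \<longrightarrow> U \<inter> mcarrier N = {p \<in> U. \<forall>j<s. \<phi> p (r + j) = 0}) \<and>
    (\<exists>(X :: nat \<Rightarrow> nat \<Rightarrow> 'm \<Rightarrow> real) (\<alpha> :: nat \<Rightarrow> nat \<Rightarrow> 'm \<Rightarrow> real)
        (Z :: nat \<Rightarrow> nat \<Rightarrow> 'm \<Rightarrow> real) (\<beta> :: nat \<Rightarrow> nat \<Rightarrow> 'm \<Rightarrow> real)
        (H :: nat \<Rightarrow> 'm \<Rightarrow> 'm gvec) (V :: nat \<Rightarrow> 'm \<Rightarrow> 'm gvec).
      (\<forall>i<r. \<forall>k<s. smooth_fun M U (X i k)) \<and>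
      (\<forall>i<r. \<forall>k<r. smooth_fun M U (\<alpha> i k)) \<and>
      (\<forall>j<s. \<forall>k<s. smooth_fun M U (Z j k)) \<and>
      (\<forall>j<s. \<forall>k<r. smooth_fun M U (\<beta> j k)) \<and>
      (\<forall>i<r. \<forall>p\<in>U. H i p =
        ((\<lambda>f. coord_vec M (U, \<phi>) i p f + (\<Sum>k<s. X i k p * coord_vec M (U, \<phi>) (r + k) p f)),
         (\<lambda>v. \<Sum>k<r. \<alpha> i k p * differential M (\<lambda>q. \<phi> q k) p v))) \<and>
      (\<forall>j<s. \<forall>p\<in>U. V j p =
        ((\<lambda>f. \<Sum>k<s. Z j k p * coord_vec M (U, \<phi>) (r + k) p f),
         (\<lambda>v. differential M (\<lambda>q. \<phi> q (r + j)) p v +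
              (\<Sum>k<r. \<beta> j k p * differential M (\<lambda>q. \<phi> q k) p v)))) \<and>
      sections M U L = spanned_sections M U (H ` {..<r} \<union> V ` {..<s}) \<and>
      (\<forall>i<r. \<forall>k<s. X i k m0 = 0) \<and>
      (\<forall>j<s. \<forall>k<s. Z j k m0 = 0))"
proof -
  have int: "integral_manifold M L N"
    using assms(4) unfolding presymplectic_leaf_def by (elim conjE)
  then have imm: "immersed_submanifold N M"
    and push: "\<forall>q\<in>mcarrier N. pushforward N M (\<lambda>q. q) q ` tangent_space N q = distribution L q"
    by (simp_all add: integral_manifold_def)
  have "smooth_manifold N" using imm unfolding immersed_submanifold_def by (elim conjE)
  then interpret immersed M N
    using assms(1) imm by unfold_locales
  have n: "mdim M = r + s" and r: "mdim N = r" using assms(6,7) by simp_all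
  have sub: "smooth_subbundle M L" and max: "\<And>p. p \<in> mcarrier M \<Longrightarrow> maximal_isotropic M p (L p)"
    using assms(2) by (auto simp: dirac_structure_def)
  obtain U1 \<theta> W \<psi> where U1: "(U1, \<theta>) \<in> matlas M" and W: "(W, \<psi>) \<in> matlas N" "m0 \<in> W"
    and WU: "W = {p \<in> U1. \<forall>j<s. \<theta> p (r + j) = 0}" and \<psi>: "\<And>q i. q \<in> W \<Longrightarrow> i < r \<Longrightarrow> \<psi> q i = \<theta> q i"
    by (rule adapted_chart[OF assms(5) n r]) (rule that)
  have m0U1: "m0 \<in> U1" using W(2) WU by auto
  have WN: "W \<subseteq> mcarrier N" by (rule N.chart_subset[OF W(1)])
  have D: "fst ` L m0 = {v \<in> tangent_space M m0. \<forall>j<s. v (\<lambda>q. \<theta> q (r + j)) = 0}"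
    using submanifold_tangent_space[OF U1 W n r WU \<psi>] bspec[OF push assms(5)] by (simp add: distribution_def)
  obtain V \<tau> where *: "openin (mtop M) V \<and> m0 \<in> V \<and> V \<subseteq> U1 \<and> (\<forall>j<r + s. \<tau> j \<in> sections M V L) \<and>
      (\<forall>i<r + s. \<forall>j<r + s. \<forall>p\<in>V. mixed_coord M (U1, \<theta>) r i p (\<tau> j p) = (if i = j then 1 else 0))"
    using M.dual_frame[OF U1 m0U1 n sub max[OF assms(3)] D order_refl] by (elim exE)
  then have V: "openin (mtop M) V" "m0 \<in> V" "V \<subseteq> U1" by simp_all
  have \<tau>V: "\<tau> j \<in> sections M V L" if "j < r + s" for j using * that by simp
  have dualV: "mixed_coord M (U1, \<theta>) r i p (\<tau> j p) = (if i = j then 1 else 0)"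
    if "i < r + s" "j < r + s" "p \<in> V" for i j p using * that by simp
  \<comment> \<open>For an embedded leaf the chart domain \<open>W\<close> is cut out by an open set
    of \<open>M\<close>, and staying inside it excludes all other sheets. Otherwise the whole
    manifold serves as \<open>A\<close>.\<close>
  have "\<exists>A. openin (mtop M) A \<and> m0 \<in> A \<and> (embedded N M \<longrightarrow> A \<inter> mcarrier N \<subseteq> W)"
  proof (cases "embedded N M")
    case True
    then obtain A where "openin (mtop M) A" "W = A \<inter> mcarrier N"
      using N.chart_open[OF W(1)] by (metis embedded_def openin_subtopology)
    then show ?thesis using W(2) by blast
  qed (use assms(3) openin_topspace in blast)
  then obtain A where A: "openin (mtop M) A" "m0 \<in> A" "embedded N M \<Longrightarrow> A \<inter> mcarrier N \<subseteq> W" by blast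
  have VA: "openin (mtop M) (V \<inter> A)" "V \<inter> A \<subseteq> U1" "m0 \<in> V \<inter> A"
    using V A by (auto simp: openin_Int)
  have oVA: "openin (Euclidean_space (r + s)) (\<theta> ` (V \<inter> A))"
    using M.chart_image_subset_open[OF U1 VA(1,2)] by (simp add: n)
  \<comment> \<open>The final domain has to be a cube for the plaque and has to lie in
    \<open>V\<close> for the frame and in \<open>A\<close> for the embedded case.\<close>
  obtain e where e: "e > 0" "ecube (r + s) (\<theta> m0) e \<subseteq> \<theta> ` (V \<inter> A)"
    using open_contains_ecube[OF oVA imageI[OF VA(3)]] .
  define U where "U = {p \<in> U1. \<theta> p \<in> ecube (r + s) (\<theta> m0) e}"
  have UVA: "U \<subseteq> V \<inter> A"
    using e(2) M.chart_inj[OF U1] VA(2) by (auto simp: U_def inj_on_def subset_iff image_iff)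
  have UU1: "U \<subseteq> U1" by (auto simp: U_def)
  have oU: "openin (mtop M) U"
    unfolding U_def using M.chart_vimage_open[OF U1] openin_ecube n by metis
  have U: "(U, \<theta>) \<in> matlas M" by (rule M.chart_restrict[OF U1 oU UU1])
  have m0U: "m0 \<in> U"
    using m0U1 M.chart_range[OF U1 m0U1] e(1) n by (auto simp: U_def intro: centre_in_ecube)
  have plaque: "plaque N U m0 = {p \<in> U. \<forall>j<s. \<theta> p (r + j) = 0}"
    by (rule plaque_in_cube[OF U1 W n r WU \<psi> e(1) _ U_def]) (use e(2) VA(2) in auto)
  have emb: "U \<inter> mcarrier N = {p \<in> U. \<forall>j<s. \<theta> p (r + j) = 0}" if "embedded N M"
    using A(3)[OF that] UVA UU1 WN unfolding WU by blast
  have \<tau>: "\<tau> i \<in> sections M U L" if "i < r + s" for i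
    by (rule M.sections_subset[OF \<tau>V[OF that] oU]) (use UVA in auto)
  \<comment> \<open>The frame was built for the chart on \<open>U1\<close>; restriction of the
    domain leaves the coordinate vectors unchanged.\<close>
  have dual: "mixed_coord M (U, \<theta>) r i p (\<tau> j p) = (if i = j then 1 else 0)"
    if "i < r + s" "j < r + s" "p \<in> U" for i j p
    using dualV[OF that(1,2), of p] UVA that M.coord_vec_restrict[OF U1 oU UU1 that(3), of i] n
    by (auto simp: mixed_coord_def)
  have gs: "gsection_on M U (\<tau> i)" if "i < r + s" for i using \<tau>[OF that] by (simp add: sections_def)
  have gsp: "\<tau> i p \<in> gspace M p" if "i < r + s" "p \<in> U" for i p
    using gs[OF that(1)] that(2) by (auto simp: gsection_on_def vector_field_on_def one_form_on_def gspace_def mem_Times_iff)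
  \<comment> \<open>With \<open>r + s\<close> or 0 as the dividing index, the mixed coordinates
    become all vector components or all covector components. One smoothness lemma thus covers every
    coefficient function.\<close>
  have fst_smooth: "smooth_fun M U (\<lambda>p. fst (\<tau> i p) (\<lambda>q. \<theta> q k))" if "i < r + s" "k < r + s" for i k
    using M.mixed_coord_smooth[OF U subset_refl gs[OF that(1)], of k "r + s"] that n by (simp add: mixed_coord_def)
  have snd_smooth: "smooth_fun M U (\<lambda>p. snd (\<tau> i p) (coord_vec M (U, \<theta>) k p))" if "i < r + s" "k < r + s" for i k
    using M.mixed_coord_smooth[OF U subset_refl gs[OF that(1)], of k 0] that n by (simp add: mixed_coord_def)
  \<comment> \<open>At \<open>m0\<close> the vector parts of elements of \<open>L\<close> are
    tangent to the leaf and have no components in the y directions. This is the asserted vanishing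
    of X and Z.\<close>
  have vanish: "fst (\<tau> i m0) (\<lambda>q. \<theta> q (r + k)) = 0" if "i < r + s" "k < s" for i k
  proof -
    have "\<tau> i m0 \<in> L m0" using \<tau>[OF that(1)] m0U by (simp add: sections_def)
    then have "fst (\<tau> i m0) \<in> fst ` L m0" by (rule imageI)
    then show ?thesis unfolding D using that(2) by simp
  qed
  have iso: "isotropic (L p)" if "p \<in> U" for p
    using maximal_isotropicD(2)[OF max] M.chart_subset[OF U] that by blast
  have split: "\<tau> ` {..<r} \<union> (\<lambda>j. \<tau> (r + j)) ` {..<s} = \<tau> ` {..<r + s}"
  proof -
    have "(\<lambda>j. r + j) ` {..<s} = {r..<r + s}"
      by (simp add: lessThan_atLeast0 add.commute)
    moreover have "{..<r} \<union> {r..<r + s} = {..<r + s}" by auto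
    ultimately have "{..<r + s} = {..<r} \<union> (\<lambda>j. r + j) ` {..<s}" by simp
    then show ?thesis by (simp add: image_Un image_image)
  qed
  have span: "sections M U L = spanned_sections M U (\<tau> ` {..<r} \<union> (\<lambda>j. \<tau> (r + j)) ` {..<s})"
    unfolding split by (rule M.sections_dual_frame[OF U n sub iso \<tau> dual])
  have H: "\<tau> i p = ((\<lambda>f. coord_vec M (U, \<theta>) i p f + (\<Sum>k<s. fst (\<tau> i p) (\<lambda>q. \<theta> q (r + k)) * coord_vec M (U, \<theta>) (r + k) p f)),
       (\<lambda>v. \<Sum>k<r. snd (\<tau> i p) (coord_vec M (U, \<theta>) k p) * differential M (\<lambda>q. \<theta> q k) p v))"
    if "i < r" "p \<in> U" for i p
    using that dual[of _ i p] by (intro M.dual_frame_normal_form(1)[OF U that(2) n gsp]) auto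
  have Z: "\<tau> (r + j) p = ((\<lambda>f. \<Sum>k<s. fst (\<tau> (r + j) p) (\<lambda>q. \<theta> q (r + k)) * coord_vec M (U, \<theta>) (r + k) p f),
       (\<lambda>v. differential M (\<lambda>q. \<theta> q (r + j)) p v +
            (\<Sum>k<r. snd (\<tau> (r + j) p) (coord_vec M (U, \<theta>) k p) * differential M (\<lambda>q. \<theta> q k) p v)))"
    if "j < s" "p \<in> U" for j p
    using that dual[of _ "r + j" p] by (intro M.dual_frame_normal_form(2)[OF U that(2) n gsp]) auto
  show ?thesis
    apply (rule exI[of _ U], rule exI[of _ \<theta>])
    apply (intro conjI impI U m0U plaque emb)
     apply assumption
    apply (rule exI[of _ "\<lambda>i k p. fst (\<tau> i p) (\<lambda>q. \<theta> q (r + k))"])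
    apply (rule exI[of _ "\<lambda>i k p. snd (\<tau> i p) (coord_vec M (U, \<theta>) k p)"])
    apply (rule exI[of _ "\<lambda>j k p. fst (\<tau> (r + j) p) (\<lambda>q. \<theta> q (r + k))"])
    apply (rule exI[of _ "\<lambda>j k p. snd (\<tau> (r + j) p) (coord_vec M (U, \<theta>) k p)"])
    apply (rule exI[of _ \<tau>], rule exI[of _ "\<lambda>j. \<tau> (r + j)"])
    apply (intro conjI allI impI ballI fst_smooth snd_smooth H Z span vanish)
    apply simp_all
    done
qed

end
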